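(* Let $(X^n)_n$ be a sequence of càdlàg processes which converges in law (for the Skorokhod topology) to a quasi-left continuous càdlàg process $X$. Suppose that the processes $X^n$ have independent increments. Let $\mathcal{F}^n$ be the natural filtration of $X^n$ and $\mathcal{F}$ the right-continuous filtration associated to the natural filtration of $X$. Let $\gamma:[0,T]\times\mathbb{R}\to\mathbb{R}$ be bounded and continuous. For each $n$, let $\tau^n$ be an optimal $\mathcal{F}^n$-stopping time for $X^n$, i.e. an $\mathcal{F}^n$-stopping time bounded by $T$ with $\mathbb{E}[\gamma(\tau^n,X^n_{\tau^n})]=\Gamma_n(T)$. If $(X,\tau)$ is the limit in law of a subsequence of $((X^n,\tau^n))_n$ and if $\tau$ is $\mathcal{F}_T$-measurable, then $\tau$ is an optimal stopping time for $X$, i.e. $\tau$ is an $\mathcal{F}$-stopping time bounded by $T$ such that $\mathbb{E}[\gamma(\tau,X_\tau)]=\Gamma(T)$.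
   Context: $T>0$ is fixed, all processes are real-valued and indexed by $[0,T]$, all filtrations are indexed by $[0,T]$; $(\Omega,\mathcal{A},\mathbb{P})$ is the underlying probability space. $\mathbb{D}([0,T])$ is the space of càdlàg functions $[0,T]\to\mathbb{R}$ with the Skorokhod ($J_1$) topology. Convergence in law of $(X^n,\tau^n)$ is in $\mathbb{D}([0,T])\times\mathbb{R}$ with the product topology. The natural filtration of a process $Y$ is $\mathcal{F}^Y_t=\sigma(Y_s,\,s\leqslant t)$. The right-continuous filtration associated to the natural filtration of $X$ is $\mathcal{F}_t=\mathcal{F}^X_{t^+}=\bigcap_{s>t}\mathcal{F}^X_s$ for $t<T$, with $\mathcal{F}_T=\mathcal{F}^X_T$. A random variable $\tau$ is an $\mathcal{F}$-stopping time if $\{\tau\leqslant t\}\in\mathcal{F}_t$ for every $t\in[0,T]$, and similarly for $\mathcal{F}^n$. $\mathcal{T}_T$ (resp. $\mathcal{T}^n_T$) is the set of $\mathcal{F}$-stopping times (resp. $\mathcal{F}^n$-stopping times) bounded by $T$, and $$\Gamma(T)=\sup_{\tau\in\mathcal{T}_T}\mathbb{E}[\gamma(\tau,X_\tau)],\qquad \Gamma_n(T)=\sup_{\tau\in\mathcal{T}^n_T}\mathbb{E}[\gamma(\tau,X^n_\tau)].$$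
   Formalization: The conclusion is proved up to null sets: τ equals almost surely an optimal F-stopping time bounded by T; since F is not completed, τ itself can fail to be an F-stopping time after a change on an F_T-measurable null set. *)

theory Defs
  imports "HOL-Probability.Probability"
begin

section \<open>The Skorokhod space on a compact interval\<close>

definition cadlag_on :: "real \<Rightarrow> (real \<Rightarrow> real) \<Rightarrow> bool" where
  "cadlag_on T x \<longleftrightarrow>
     (\<forall>t\<in>{0..<T}. (x \<longlongrightarrow> x t) (at_right t)) \<and>
     (\<forall>t\<in>{0<..T}. \<exists>l. (x \<longlongrightarrow> l) (at_left t))"

text \<open>Functions on \<open>[0,T]\<close> are represented extensionally, so that equality in the
  Skorokhod space is equality on \<open>[0,T]\<close>.\<close>

definition skorokhod_space :: "real \<Rightarrow> (real \<Rightarrow> real) set" where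
  "skorokhod_space T = {x \<in> extensional {0..T}. cadlag_on T x}"

definition time_changes :: "real \<Rightarrow> (real \<Rightarrow> real) set" where
  "time_changes T = {h. strict_mono_on {0..T} h \<and> h ` {0..T} = {0..T}}"

definition skorokhod_close :: "real \<Rightarrow> (real \<Rightarrow> real) \<Rightarrow> (real \<Rightarrow> real) \<Rightarrow> real set" where
  "skorokhod_close T x y =
     {e. 0 < e \<and> (\<exists>h\<in>time_changes T. \<forall>t\<in>{0..T}. \<bar>h t - t\<bar> \<le> e \<and> \<bar>x t - y (h t)\<bar> \<le> e)}"

text \<open>The value outside the Skorokhod space is irrelevant; it is set to 0 because the locale
  \<^locale>\<open>Metric_space\<close> requires nonnegativity and symmetry on the whole type.\<close>

definition skorokhod_dist :: "real \<Rightarrow> (real \<Rightarrow> real) \<Rightarrow> (real \<Rightarrow> real) \<Rightarrow> real" where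
  "skorokhod_dist T x y =
     (if x \<in> skorokhod_space T \<and> y \<in> skorokhod_space T then Inf (skorokhod_close T x y) else 0)"

definition skorokhod_topology :: "real \<Rightarrow> (real \<Rightarrow> real) topology" where
  "skorokhod_topology T = Metric_space.mtopology (skorokhod_space T) (skorokhod_dist T)"

lemma cadlag_on_bounded:
  assumes "cadlag_on T x"
  shows "\<exists>B. \<forall>t\<in>{0..T}. \<bar>x t\<bar> \<le> B"
proof -
  have "\<exists>U B. open U \<and> t \<in> U \<and> (\<forall>s\<in>U \<inter> {0..T}. \<bar>x s\<bar> \<le> B)" if t: "t \<in> {0..T}" for t
  proof -
    have "\<exists>b B. t < b \<and> (\<forall>s. t < s \<and> s < b \<and> s \<le> T \<longrightarrow> \<bar>x s\<bar> \<le> B)"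
    proof (cases "t < T")
      case True
      then have "(x \<longlongrightarrow> x t) (at_right t)" using assms t by (auto simp: cadlag_on_def)
      then have "eventually (\<lambda>s. dist (x s) (x t) < 1) (at_right t)" by (rule tendstoD) simp
      then obtain b where "t < b" "\<And>s. t < s \<Longrightarrow> s < b \<Longrightarrow> dist (x s) (x t) < 1"
        by (auto simp: eventually_at_right_field)
      then show ?thesis
        by (intro exI[of _ b] exI[of _ "\<bar>x t\<bar> + 1"]) (force simp: dist_real_def)
    qed (auto intro: exI[of _ "t + 1"])
    then obtain b B1 where b: "t < b" "\<And>s. t < s \<Longrightarrow> s < b \<Longrightarrow> s \<le> T \<Longrightarrow> \<bar>x s\<bar> \<le> B1"
      by blast
    have "\<exists>a B. a < t \<and> (\<forall>s. a < s \<and> s < t \<and> 0 \<le> s \<longrightarrow> \<bar>x s\<bar> \<le> B)"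
    proof (cases "0 < t")
      case True
      then obtain l where "(x \<longlongrightarrow> l) (at_left t)"
        using assms t unfolding cadlag_on_def by (meson atLeastAtMost_iff greaterThanAtMost_iff)
      then have "eventually (\<lambda>s. dist (x s) l < 1) (at_left t)" by (rule tendstoD) simp
      then obtain a where "a < t" "\<And>s. a < s \<Longrightarrow> s < t \<Longrightarrow> dist (x s) l < 1"
        by (auto simp: eventually_at_left_field)
      then show ?thesis
        by (intro exI[of _ a] exI[of _ "\<bar>l\<bar> + 1"]) (force simp: dist_real_def)
    qed (auto intro: exI[of _ "t - 1"])
    then obtain a B2 where a: "a < t" "\<And>s. a < s \<Longrightarrow> s < t \<Longrightarrow> 0 \<le> s \<Longrightarrow> \<bar>x s\<bar> \<le> B2"
      by blast
    have "\<bar>x s\<bar> \<le> max (max B1 B2) \<bar>x t\<bar>" if "s \<in> {a<..<b} \<inter> {0..T}" for s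
      using a(2)[of s] b(2)[of s] that by (cases s t rule: linorder_cases) auto
    then show ?thesis using a(1) b(1)
      by (intro exI[of _ "{a<..<b}"] exI[of _ "max (max B1 B2) \<bar>x t\<bar>"]) auto
  qed
  then obtain U B where U: "\<And>t. t \<in> {0..T} \<Longrightarrow> open (U t) \<and> t \<in> U t"
      and B: "\<And>t s. t \<in> {0..T} \<Longrightarrow> s \<in> U t \<inter> {0..T} \<Longrightarrow> \<bar>x s\<bar> \<le> B t"
    by metis
  have "compact {0..T}" by simp
  then obtain C where C: "C \<subseteq> {0..T}" "finite C" "{0..T} \<subseteq> (\<Union>t\<in>C. U t)"
    by (rule compactE_image[where f = U and C = "{0..T}"]) (use U in auto)
  have "\<bar>x s\<bar> \<le> (\<Sum>t\<in>C. \<bar>B t\<bar>)" if s: "s \<in> {0..T}" for s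
  proof -
    obtain t where "t \<in> C" "s \<in> U t" using C s by blast
    then have "\<bar>x s\<bar> \<le> \<bar>B t\<bar>" using B[of t s] s C by force
    also have "\<dots> \<le> (\<Sum>t\<in>C. \<bar>B t\<bar>)" using \<open>t \<in> C\<close> C by (intro member_le_sum) auto
    finally show ?thesis .
  qed
  then show ?thesis by blast
qed

lemma time_changes_id: "id \<in> time_changes T"
  by (auto simp: time_changes_def strict_mono_on_def)

lemma time_changes_comp:
  assumes "f \<in> time_changes T" "g \<in> time_changes T"
  shows "g \<circ> f \<in> time_changes T"
proof -
  have mem: "f t \<in> {0..T}" if "t \<in> {0..T}" for t
    using assms(1) that unfolding time_changes_def by blast
  have "strict_mono_on {0..T} (g \<circ> f)"
  proof (rule strict_mono_onI)
    fix r s assume "r \<in> {0..T}" "s \<in> {0..T}" "r < s"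
    then show "(g \<circ> f) r < (g \<circ> f) s"
      using assms mem strict_mono_onD[of "{0..T}" f r s] strict_mono_onD[of "{0..T}" g "f r" "f s"]
      unfolding time_changes_def by auto
  qed
  moreover have "(g \<circ> f) ` {0..T} = {0..T}"
    using assms unfolding time_changes_def image_comp [symmetric] by simp
  ultimately show ?thesis unfolding time_changes_def by blast
qed

lemma time_changes_inv:
  assumes "f \<in> time_changes T"
  shows "\<exists>g\<in>time_changes T. \<forall>t\<in>{0..T}. g t \<in> {0..T} \<and> f (g t) = t"
proof -
  have m: "strict_mono_on {0..T} f" and i: "f ` {0..T} = {0..T}"
    using assms by (auto simp: time_changes_def)
  define g where "g = inv_into {0..T} f"
  have inj: "inj_on f {0..T}" using m by (rule strict_mono_on_imp_inj_on)
  have g: "g t \<in> {0..T} \<and> f (g t) = t" if "t \<in> {0..T}" for t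
    using that i inv_into_into[of t f "{0..T}"] f_inv_into_f[of t f "{0..T}"] by (simp add: g_def)
  have "strict_mono_on {0..T} g"
  proof (rule strict_mono_onI)
    fix r s assume rs: "r \<in> {0..T}" "s \<in> {0..T}" "r < s"
    show "g r < g s"
    proof (rule ccontr)
      assume "\<not> g r < g s"
      then have "f (g s) \<le> f (g r)"
        using m g rs by (metis linorder_not_less order_le_less strict_mono_onD)
      then show False using g rs by simp
    qed
  qed
  moreover have "g ` {0..T} = {0..T}"
    using inj i by (simp add: g_def) (metis inv_into_image_cancel order_refl)
  ultimately show ?thesis using g by (auto simp: time_changes_def)
qed

lemma time_changes_mem: "f \<in> time_changes T \<Longrightarrow> t \<in> {0..T} \<Longrightarrow> f t \<in> {0..T}"
  by (auto simp: time_changes_def)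

lemma time_changes_right_end:
  assumes "f \<in> time_changes T" "0 \<le> T"
  shows "f T = T"
proof -
  obtain g where g: "g \<in> {0..T}" "f g = T"
    using assms by (auto simp: time_changes_def image_iff) (metis atLeastAtMost_iff imageE order_refl)
  show ?thesis
  proof (cases "g = T")
    case False
    then have "T < f T"
      using assms g by (auto simp: time_changes_def strict_mono_on_def)
    then show ?thesis using time_changes_mem[OF assms(1), of T] assms(2) by auto
  qed (use g in simp)
qed

lemma skorokhod_close_sym_le: "skorokhod_close T x y \<subseteq> skorokhod_close T y x"
proof
  fix e assume "e \<in> skorokhod_close T x y"
  then obtain f where f: "0 < e" "f \<in> time_changes T"
      "\<And>t. t \<in> {0..T} \<Longrightarrow> \<bar>f t - t\<bar> \<le> e \<and> \<bar>x t - y (f t)\<bar> \<le> e"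
    by (auto simp: skorokhod_close_def)
  obtain g where g: "g \<in> time_changes T" "\<And>t. t \<in> {0..T} \<Longrightarrow> g t \<in> {0..T} \<and> f (g t) = t"
    using time_changes_inv[OF f(2)] by blast
  have "\<bar>g t - t\<bar> \<le> e \<and> \<bar>y t - x (g t)\<bar> \<le> e" if "t \<in> {0..T}" for t
    using f(3)[of "g t"] g(2)[OF that] by (simp add: abs_minus_commute)
  then show "e \<in> skorokhod_close T y x"
    unfolding skorokhod_close_def using f(1) g(1) by blast
qed

lemma skorokhod_close_sym: "skorokhod_close T x y = skorokhod_close T y x"
  using skorokhod_close_sym_le by blast

lemma skorokhod_close_nonempty:
  assumes "x \<in> skorokhod_space T" "y \<in> skorokhod_space T"
  shows "skorokhod_close T x y \<noteq> {}"
proof -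
  obtain B C where B: "\<And>t. t \<in> {0..T} \<Longrightarrow> \<bar>x t\<bar> \<le> B" and C: "\<And>t. t \<in> {0..T} \<Longrightarrow> \<bar>y t\<bar> \<le> C"
    using assms cadlag_on_bounded unfolding skorokhod_space_def by blast
  have "\<bar>x t - y t\<bar> \<le> \<bar>B\<bar> + \<bar>C\<bar> + 1" if "t \<in> {0..T}" for t
    using B[OF that] C[OF that] by linarith
  then have "\<bar>B\<bar> + \<bar>C\<bar> + 1 \<in> skorokhod_close T x y"
    unfolding skorokhod_close_def
    by (auto intro!: bexI[of _ id] time_changes_id)
  then show ?thesis by blast
qed

lemma skorokhod_close_triangle:
  assumes "e \<in> skorokhod_close T x y" "e' \<in> skorokhod_close T y z"
  shows "e + e' \<in> skorokhod_close T x z"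
proof -
  obtain f where f: "0 < e" "f \<in> time_changes T"
      "\<And>t. t \<in> {0..T} \<Longrightarrow> \<bar>f t - t\<bar> \<le> e \<and> \<bar>x t - y (f t)\<bar> \<le> e"
    using assms(1) by (auto simp: skorokhod_close_def)
  obtain g where g: "0 < e'" "g \<in> time_changes T"
      "\<And>t. t \<in> {0..T} \<Longrightarrow> \<bar>g t - t\<bar> \<le> e' \<and> \<bar>y t - z (g t)\<bar> \<le> e'"
    using assms(2) by (auto simp: skorokhod_close_def)
  have "\<bar>(g \<circ> f) t - t\<bar> \<le> e + e' \<and> \<bar>x t - z ((g \<circ> f) t)\<bar> \<le> e + e'" if "t \<in> {0..T}" for t
    using f(3)[OF that] g(3)[OF time_changes_mem[OF f(2) that]] by auto
  then show ?thesis
    using time_changes_comp[OF f(2) g(2)] f(1) g(1) unfolding skorokhod_close_def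
    by (intro CollectI conjI bexI[of _ "g \<circ> f"]) auto
qed

lemma skorokhod_close_eq:
  assumes x: "x \<in> skorokhod_space T" and y: "y \<in> skorokhod_space T"
    and close: "\<And>\<epsilon>. 0 < \<epsilon> \<Longrightarrow> \<exists>e\<in>skorokhod_close T x y. e < \<epsilon>"
  shows "x = y"
proof -
  have *: "\<exists>f\<in>time_changes T. \<forall>t\<in>{0..T}. \<bar>f t - t\<bar> < \<epsilon> \<and> \<bar>x t - y (f t)\<bar> < \<epsilon>" if "0 < \<epsilon>" for \<epsilon>
    using close[OF that] unfolding skorokhod_close_def by (blast intro: order_le_less_trans)
  have "x t = y t" if t: "t \<in> {0..T}" for t
  proof (rule ccontr)
    assume "x t \<noteq> y t"
    define \<eta> where "\<eta> = \<bar>x t - y t\<bar> / 3"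
    have \<eta>: "0 < \<eta>" using \<open>x t \<noteq> y t\<close> by (simp add: \<eta>_def)
    show False
    proof (cases "t = T")
      case True
      then show False
        using *[OF \<eta>] t time_changes_right_end[of _ T] \<eta> by (force simp: \<eta>_def)
    next
      case False
      then have lim: "(x \<longlongrightarrow> x t) (at_right t)" "(y \<longlongrightarrow> y t) (at_right t)"
        using t x y by (auto simp: skorokhod_space_def cadlag_on_def)
      have "eventually (\<lambda>s. dist (x s) (x t) < \<eta> \<and> dist (y s) (y t) < \<eta> \<and> s < T) (at_right t)"
        using False t
        by (intro eventually_conj tendstoD[OF lim(1) \<eta>] tendstoD[OF lim(2) \<eta>])
          (auto simp: eventually_at_right_field intro!: exI[of _ T])
      then obtain b where b: "t < b"
          "\<And>s. t < s \<Longrightarrow> s < b \<Longrightarrow> dist (x s) (x t) < \<eta> \<and> dist (y s) (y t) < \<eta> \<and> s < T"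
        by (auto simp: eventually_at_right_field)
      define s where "s = (t + b) / 2"
      have s: "t < s" "s < b" using b(1) by (auto simp: s_def)
      have "0 < min \<eta> ((b - t) / 2)" using \<eta> b(1) by simp
      from *[OF this] obtain f where f: "f \<in> time_changes T"
          "\<And>u. u \<in> {0..T} \<Longrightarrow> \<bar>f u - u\<bar> < min \<eta> ((b - t) / 2) \<and> \<bar>x u - y (f u)\<bar> < min \<eta> ((b - t) / 2)"
        by blast
      have sT: "s \<in> {0..T}" using b(2)[OF s] s t by auto
      have "t < f s" "f s < b" using f(2)[OF sT] by (auto simp: s_def field_simps abs_less_iff)
      then have "\<bar>x s - x t\<bar> < \<eta>" "\<bar>y (f s) - y t\<bar> < \<eta>" "\<bar>x s - y (f s)\<bar> < \<eta>"
        using f(2)[OF sT] b(2)[of s] b(2)[of "f s"] s by (auto simp: dist_real_def)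
      moreover have "\<bar>x t - y t\<bar> = 3 * \<eta>" by (simp add: \<eta>_def)
      ultimately show False by linarith
    qed
  qed
  then show ?thesis using x y by (auto simp: skorokhod_space_def intro!: extensionalityI)
qed

lemma skorokhod_close_bdd_below: "bdd_below (skorokhod_close T x y)"
  by (rule bdd_belowI[of _ 0]) (auto simp: skorokhod_close_def)

lemma Metric_space_skorokhod: "Metric_space (skorokhod_space T) (skorokhod_dist T)"
proof
  fix x y
  show "0 \<le> skorokhod_dist T x y"
    using skorokhod_close_nonempty[of x T y]
    by (auto simp: skorokhod_dist_def skorokhod_close_def intro!: cInf_greatest)
  show "skorokhod_dist T x y = skorokhod_dist T y x"
    by (simp add: skorokhod_dist_def skorokhod_close_sym[of T x y] conj_commute)
next
  fix x y assume xy: "x \<in> skorokhod_space T" "y \<in> skorokhod_space T"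
  show "skorokhod_dist T x y = 0 \<longleftrightarrow> x = y"
  proof
    assume "skorokhod_dist T x y = 0"
    then have "Inf (skorokhod_close T x y) = 0" using xy by (simp add: skorokhod_dist_def)
    then show "x = y"
      using cInf_lessD[OF skorokhod_close_nonempty[OF xy]]
      by (intro skorokhod_close_eq[OF xy]) force
  next
    assume "x = y"
    have "e \<in> skorokhod_close T y y" if "0 < e" for e
      using that unfolding skorokhod_close_def
      by (auto intro!: bexI[of _ id] time_changes_id)
    then have "skorokhod_close T y y = {0<..}" by (auto simp: skorokhod_close_def)
    then show "skorokhod_dist T x y = 0" using xy \<open>x = y\<close> by (simp add: skorokhod_dist_def)
  qed
next
  fix x y z assume xyz: "x \<in> skorokhod_space T" "y \<in> skorokhod_space T" "z \<in> skorokhod_space T"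
  have "Inf (skorokhod_close T x z) - e' \<le> Inf (skorokhod_close T x y)"
    if "e' \<in> skorokhod_close T y z" for e'
    using cInf_lower[OF skorokhod_close_triangle[OF _ that, of _ x] skorokhod_close_bdd_below] xyz
    by (intro cInf_greatest skorokhod_close_nonempty) (auto simp: algebra_simps)
  then have "Inf (skorokhod_close T x z) - Inf (skorokhod_close T x y) \<le> Inf (skorokhod_close T y z)"
    using xyz by (intro cInf_greatest skorokhod_close_nonempty) (auto simp: algebra_simps)
  then show "skorokhod_dist T x z \<le> skorokhod_dist T x y + skorokhod_dist T y z"
    using xyz by (simp add: skorokhod_dist_def)
qed


section \<open>Convergence in law\<close>

definition borel_of :: "'b topology \<Rightarrow> 'b measure" where
  "borel_of S = sigma (topspace S) {U. openin S U}"

text \<open>The measurability clauses say that the maps are random elements of \<open>S\<close>. For cadlag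
  processes they hold automatically, since the Borel sets of the Skorokhod space are generated
  by the coordinate maps and the space is separable.\<close>

definition converges_in_law ::
  "'a measure \<Rightarrow> 'b topology \<Rightarrow> (nat \<Rightarrow> 'a \<Rightarrow> 'b) \<Rightarrow> ('a \<Rightarrow> 'b) \<Rightarrow> bool" where
  "converges_in_law M S Y Z \<longleftrightarrow>
     (\<forall>n. Y n \<in> M \<rightarrow>\<^sub>M borel_of S) \<and> Z \<in> M \<rightarrow>\<^sub>M borel_of S \<and>
     (\<forall>f. continuous_map S euclideanreal f \<and> bounded (f ` topspace S) \<longrightarrow>
        (\<lambda>n. \<integral>\<omega>. f (Y n \<omega>) \<partial>M) \<longlonglongrightarrow> (\<integral>\<omega>. f (Z \<omega>) \<partial>M))"


section \<open>Processes and filtrations on \<open>[0,T]\<close>\<close>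

text \<open>A process is a function of type \<open>real \<Rightarrow> 'a \<Rightarrow> real\<close>; only its values at times in
  \<open>[0,T]\<close> matter.\<close>

definition cadlag_process :: "'a measure \<Rightarrow> real \<Rightarrow> (real \<Rightarrow> 'a \<Rightarrow> real) \<Rightarrow> bool" where
  "cadlag_process M T X \<longleftrightarrow>
     (\<forall>t\<in>{0..T}. X t \<in> borel_measurable M) \<and> (\<forall>\<omega>\<in>space M. cadlag_on T (\<lambda>t. X t \<omega>))"

definition sample_path :: "real \<Rightarrow> (real \<Rightarrow> 'a \<Rightarrow> real) \<Rightarrow> 'a \<Rightarrow> (real \<Rightarrow> real)" where
  "sample_path T X \<omega> = restrict (\<lambda>t. X t \<omega>) {0..T}"

text \<open>Filtrations are not augmented by null sets. Hence a random time that is only known through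
  its law, such as a limit in law, can be identified as a stopping time only up to almost sure
  equality.\<close>

definition natural_filtration :: "'a measure \<Rightarrow> (real \<Rightarrow> 'a \<Rightarrow> real) \<Rightarrow> real \<Rightarrow> 'a measure" where
  "natural_filtration M X t =
     sigma (space M) {X s -` B \<inter> space M | s B. 0 \<le> s \<and> s \<le> t \<and> B \<in> sets borel}"

definition right_cont_filtration ::
  "'a measure \<Rightarrow> real \<Rightarrow> (real \<Rightarrow> 'a \<Rightarrow> real) \<Rightarrow> real \<Rightarrow> 'a measure" where
  "right_cont_filtration M T X t =
     (if t < T then sigma (space M) (\<Inter>s\<in>{t<..T}. sets (natural_filtration M X s))
      else natural_filtration M X T)"

text \<open>The library predicate \<^const>\<open>stopping_time\<close> tests all real times \<open>t\<close>. Since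
  \<open>\<tau>\<close> takes values in \<open>[0,T]\<close>, the event \<open>\<tau> \<le> t\<close> is empty for \<open>t < 0\<close> and the
  whole space for \<open>t > T\<close>, so only times in \<open>[0,T]\<close> impose a condition.\<close>

definition stopping_times :: "'a measure \<Rightarrow> real \<Rightarrow> (real \<Rightarrow> 'a measure) \<Rightarrow> ('a \<Rightarrow> real) set" where
  "stopping_times M T F = {\<tau>. stopping_time F \<tau> \<and> (\<forall>\<omega>\<in>space M. \<tau> \<omega> \<in> {0..T})}"

text \<open>Increments are independent of the whole past, hence in particular of the initial value.\<close>

definition independent_increments :: "'a measure \<Rightarrow> real \<Rightarrow> (real \<Rightarrow> 'a \<Rightarrow> real) \<Rightarrow> bool" where
  "independent_increments M T X \<longleftrightarrow>
     (\<forall>s t. 0 \<le> s \<and> s < t \<and> t \<le> T \<longrightarrow>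
        prob_space.indep_set M
          (sets (natural_filtration M X s))
          (sets (vimage_algebra (space M) (\<lambda>\<omega>. X t \<omega> - X s \<omega>) borel)))"

text \<open>Continuity along increasing sequences of stopping times; the limit \<open>\<rho>\<close> is
  automatically a stopping time with values in \<open>[0,T]\<close>.\<close>

definition quasi_left_continuous ::
  "'a measure \<Rightarrow> real \<Rightarrow> (real \<Rightarrow> 'a measure) \<Rightarrow> (real \<Rightarrow> 'a \<Rightarrow> real) \<Rightarrow> bool" where
  "quasi_left_continuous M T F X \<longleftrightarrow>
     (\<forall>\<sigma> \<rho>. (\<forall>k::nat. \<sigma> k \<in> stopping_times M T F) \<and>
        (\<forall>\<omega>\<in>space M. incseq (\<lambda>k. \<sigma> k \<omega>) \<and> (\<lambda>k. \<sigma> k \<omega>) \<longlonglongrightarrow> \<rho> \<omega>) \<longrightarrow>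
        (AE \<omega> in M. (\<lambda>k. X (\<sigma> k \<omega>) \<omega>) \<longlonglongrightarrow> X (\<rho> \<omega>) \<omega>))"


section \<open>Optimal stopping\<close>

definition reward ::
  "'a measure \<Rightarrow> (real \<times> real \<Rightarrow> real) \<Rightarrow> (real \<Rightarrow> 'a \<Rightarrow> real) \<Rightarrow> ('a \<Rightarrow> real) \<Rightarrow> real" where
  "reward M \<gamma> X \<tau> = (\<integral>\<omega>. \<gamma> (\<tau> \<omega>, X (\<tau> \<omega>) \<omega>) \<partial>M)"

definition optimal_value ::
  "'a measure \<Rightarrow> real \<Rightarrow> (real \<Rightarrow> 'a measure) \<Rightarrow> (real \<times> real \<Rightarrow> real) \<Rightarrow>
   (real \<Rightarrow> 'a \<Rightarrow> real) \<Rightarrow> real" where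
  "optimal_value M T F \<gamma> X = (SUP \<tau>\<in>stopping_times M T F. reward M \<gamma> X \<tau>)"

definition optimal_stopping_time ::
  "'a measure \<Rightarrow> real \<Rightarrow> (real \<Rightarrow> 'a measure) \<Rightarrow> (real \<times> real \<Rightarrow> real) \<Rightarrow>
   (real \<Rightarrow> 'a \<Rightarrow> real) \<Rightarrow> ('a \<Rightarrow> real) \<Rightarrow> bool" where
  "optimal_stopping_time M T F \<gamma> X \<tau> \<longleftrightarrow>
     \<tau> \<in> stopping_times M T F \<and> reward M \<gamma> X \<tau> = optimal_value M T F \<gamma> X"

end

theory Submission
  imports Defs
begin

text \<open>Let \<open>Y k\<close> be the processes along the subsequence and \<open>\<rho> k\<close> their optimal times, so that
\<open>(Y k, \<rho> k)\<close> converges in law to \<open>(X, \<tau>)\<close>. Three facts give the theorem.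

The limit \<open>\<tau>\<close> is almost surely equal to a stopping time of \<open>X\<close>. The event
\<open>\<rho> k < t\<close> belongs to the past of \<open>Y k\<close>, which is independent of the increments after \<open>t\<close>. Independence
survives the limit in law: \<open>\<tau> < t\<close>, together with the past of \<open>X\<close> before \<open>t\<close>, is independent of the increments of
\<open>X\<close> after \<open>t\<close> (\<open>limit_past_independent_of_future\<close>). As \<open>\<tau>\<close> is a function of the path of \<open>X\<close>, this
event is measurable in past and future jointly; being, jointly with the past, independent of the future, it is measurable in the past up to
a null set (\<open>independent_enlargement_mod_null\<close>). Assembling these events over rational \<open>t\<close> yields a stopping
time of the right-continuous filtration.

No stopping time \<open>\<sigma>\<close> of \<open>X\<close> earns more than the lower limit of the values for \<open>Y k\<close>
(\<open>value_lower_bound\<close>). Round \<open>\<sigma>\<close> up to a finite grid. The events that determine the rounded time are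
approximated by events that are given by sets of paths whose indicator is continuous at almost every path of
\<open>X\<close>. The same sets of paths define stopping times for \<open>Y k\<close>, and the rewards of these converge.

The rewards of \<open>\<rho> k\<close> do not exceed, in the limit, the reward of \<open>\<tau>\<close> (\<open>reward_upper_bound\<close>). Evaluation at a
random time is not continuous on the Skorokhod space, so one compares \<open>\<rho> k\<close> with grid times slightly later. Since
\<open>X\<close> has no fixed jumps, the increments of \<open>Y k\<close> over short deterministic intervals are small in probability, uniformly in
position and for all large \<open>k\<close> (\<open>equicontinuous_in_probability\<close>). Independence of the increments transfers this
to intervals that start at the stopping time (\<open>stopped_increment_bound\<close>). For grid times, evaluation is almost
surely continuous, and the grid is refined at the end, using right-continuity of \<open>X\<close>.

Discontinuous functionals of the path pass to the limit in law by one mapping theorem, \<open>portmanteau_upper\<close>, which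
replaces them by Lipschitz majorants.\<close>

section \<open>Independence and approximation in a probability space\<close>

lemma (in prob_space) integrable_indicator_event: "A \<in> events \<Longrightarrow> integrable M (indicator A :: 'a \<Rightarrow> real)"
  by (intro integrable_real_indicator) (auto simp: less_top[symmetric])

lemma (in prob_space) indep_set_integral_mult:
  fixes U V :: "'a \<Rightarrow> real"
  assumes indep: "indep_set (sets F) (sets G)" and sp: "space F = space M" "space G = space M"
    and U: "U \<in> borel_measurable F" and V: "V \<in> borel_measurable G"
    and int: "integrable M U" "integrable M V"
  shows "(\<integral>\<omega>. U \<omega> * V \<omega> \<partial>M) = (\<integral>\<omega>. U \<omega> \<partial>M) * (\<integral>\<omega>. V \<omega> \<partial>M)"
proof (rule indep_var_lebesgue_integral)
  have "sigma_sets (space M) {U -` A \<inter> space M |A. A \<in> sets borel} \<subseteq> sets F"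
    using measurable_sets[OF U] sp(1) by (intro sets.sigma_sets_subset[of _ F, unfolded sp]) auto
  moreover have "sigma_sets (space M) {V -` A \<inter> space M |A. A \<in> sets borel} \<subseteq> sets G"
    using measurable_sets[OF V] sp(2) by (intro sets.sigma_sets_subset[of _ G, unfolded sp]) auto
  ultimately have "indep_set (sigma_sets (space M) {U -` A \<inter> space M |A. A \<in> sets borel})
      (sigma_sets (space M) {V -` A \<inter> space M |A. A \<in> sets borel})"
    using indep unfolding indep_sets2_eq by (meson subset_iff)
  then show "indep_var borel U borel V"
    using int by (simp add: indep_var_eq borel_measurable_integrable)
qed (fact int)+

text \<open>Let \<open>D\<close> be the difference of the indicator of \<open>A\<close> and its conditional probability given \<open>F\<close>. On an
intersection \<open>K \<inter> L\<close> with \<open>K\<close> in \<open>F\<close> and \<open>L\<close> in \<open>G\<close>, the integral of \<open>D\<close> factorizes,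
and its first factor, the integral over \<open>K\<close>, vanishes. By Dynkin's argument the integral of \<open>D\<close> vanishes on
all of the sigma algebra generated by \<open>F\<close> and \<open>G\<close>. Since \<open>D\<close> is measurable there, it is
zero almost surely.\<close>

lemma (in prob_space) independent_enlargement_mod_null:
  assumes BM: "subalgebra M B" and FB: "subalgebra B F" and G: "space G = space M"
    and indep: "indep_set (sets B) (sets G)"
    and A: "A \<in> sets B" "A \<in> sigma_sets (space M) (sets F \<union> sets G)"
  shows "\<exists>A'\<in>sets F. AE \<omega> in M. \<omega> \<in> A \<longleftrightarrow> \<omega> \<in> A'"
proof -
  have sp: "space B = space M" "space F = space M" using BM FB by (auto simp: subalgebra_def)
  have sub: "sets F \<subseteq> sets B" "sets B \<subseteq> events" "sets G \<subseteq> events"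
    using BM FB indep_setD_ev2[OF indep] by (auto simp: subalgebra_def)
  have FM: "subalgebra M F" using sub sp by (auto simp: subalgebra_def)
  define H where "H = sigma (space M) (sets F \<union> sets G)"
  have FGsub: "sets F \<union> sets G \<subseteq> Pow (space M)"
    using sets.space_closed[of F] sets.space_closed[of G] sp G by auto
  have setsH: "sets H = sigma_sets (space M) (sets F \<union> sets G)"
    using FGsub by (simp add: H_def sets_measure_of)
  have HM: "subalgebra M H"
    using sub sets.sigma_sets_subset[of "sets F \<union> sets G" M] FGsub
    by (auto simp: subalgebra_def setsH H_def space_measure_of)
  interpret F: finite_measure_subalgebra M F by unfold_locales (rule FM)
  interpret H: finite_measure_subalgebra M H by unfold_locales (rule HM)
  define C where "C = real_cond_exp M F (indicator A)"
  have AM: "A \<in> events" using A sub by blast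
  have intA: "integrable M (indicator A :: 'a \<Rightarrow> real)"
    using AM by (intro integrable_indicator_event) auto
  have intC: "integrable M C" unfolding C_def by (rule F.real_cond_exp_int(1)[OF intA])
  have CF: "C \<in> borel_measurable F" unfolding C_def by simp
  have CB: "C \<in> borel_measurable B" using CF FB by (rule measurable_from_subalg[rotated])
  \<comment> \<open>the part of the indicator that the past does not explain\<close>
  define D where "D \<omega> = indicator A \<omega> - C \<omega>" for \<omega>
  have intD: "integrable M D" unfolding D_def using intA intC by (rule Bochner_Integration.integrable_diff)
  have DB: "D \<in> borel_measurable B" unfolding D_def using A(1) CB by simp
  
  define \<R> where "\<R> = {K \<inter> L |K L. K \<in> sets F \<and> L \<in> sets G}"
  have \<R>_zero: "(LINT \<omega>:K|M. D \<omega>) = 0" if K: "K \<in> \<R>" for K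
  proof -
    obtain K1 K2 where K12: "K = K1 \<inter> K2" "K1 \<in> sets F" "K2 \<in> sets G" using K by (auto simp: \<R>_def)
    have "(LINT \<omega>:K|M. D \<omega>) = (\<integral>\<omega>. (indicator K1 \<omega> * D \<omega>) * indicator K2 \<omega> \<partial>M)"
      by (auto simp: set_lebesgue_integral_def K12 indicator_inter_arith ac_simps)
    also have "\<dots> = (\<integral>\<omega>. indicator K1 \<omega> * D \<omega> \<partial>M) * (\<integral>\<omega>. indicator K2 \<omega> \<partial>M)"
    proof (rule indep_set_integral_mult[OF indep sp(1) G])
      show "(\<lambda>\<omega>. indicator K1 \<omega> * D \<omega>) \<in> borel_measurable B"
        using DB K12 sub by (intro borel_measurable_times borel_measurable_indicator) auto
      show "(indicat_real K2) \<in> borel_measurable G" using K12 by simp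
      show "integrable M (\<lambda>\<omega>. indicator K1 \<omega> * D \<omega>)"
        using integrable_mult_indicator[OF _ intD, of K1] K12 sub by auto
      show "integrable M (indicat_real K2)"
        using K12 sub by (intro integrable_indicator_event) auto
    qed
    also have "(\<integral>\<omega>. indicator K1 \<omega> * D \<omega> \<partial>M) = 0"
    proof -
      have "(\<integral>\<omega>. indicator K1 \<omega> * D \<omega> \<partial>M)
          = (LINT \<omega>:K1|M. indicator A \<omega>) - (LINT \<omega>:K1|M. C \<omega>)"
        unfolding D_def set_lebesgue_integral_def
        using integrable_mult_indicator[OF _ intA, of K1] integrable_mult_indicator[OF _ intC, of K1]
          K12 sub
        by (subst Bochner_Integration.integral_diff[symmetric])
          (auto simp: algebra_simps intro!: Bochner_Integration.integral_cong)
      then show ?thesis using F.real_cond_exp_intA[OF intA K12(2)] by (simp add: C_def)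
    qed
    finally show ?thesis by simp
  qed
  have Int: "Int_stable \<R>"
  proof (rule Int_stableI)
    fix a b assume "a \<in> \<R>" "b \<in> \<R>"
    then obtain K L K' L' where "a = K \<inter> L" "b = K' \<inter> L'" "K \<in> sets F" "L \<in> sets G" "K' \<in> sets F" "L' \<in> sets G"
      by (auto simp: \<R>_def)
    then have "a \<inter> b = (K \<inter> K') \<inter> (L \<inter> L') \<and> K \<inter> K' \<in> sets F \<and> L \<inter> L' \<in> sets G" by auto
    then show "a \<inter> b \<in> \<R>" unfolding \<R>_def by blast
  qed
  have \<R>sub: "\<R> \<subseteq> Pow (space M)" using FGsub by (auto simp: \<R>_def)
  have gen: "sets F \<union> sets G \<subseteq> \<R>"
  proof
    fix K assume "K \<in> sets F \<union> sets G"
    moreover have "K = K \<inter> space M" "K = space M \<inter> K" if "K \<in> sets F \<union> sets G" for K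
      using that FGsub by auto
    ultimately show "K \<in> \<R>"
      using sets.top[of F] sets.top[of G] sp G unfolding \<R>_def by (metis (mono_tags, lifting) Un_iff mem_Collect_eq)
  qed
  have FGH: "sets F \<subseteq> sets H" "sets G \<subseteq> sets H" by (auto simp: setsH)
  have \<R>H: "\<R> \<subseteq> sets H" using FGH unfolding \<R>_def by (auto intro!: sets.Int)
  have \<R>sig: "sigma_sets (space M) \<R> \<subseteq> events"
    using \<R>H HM by (intro sets.sigma_sets_subset) (auto simp: subalgebra_def)
  have spaceMH: "space M \<in> \<R>" using gen sets.top[of F] sp by auto
  have zero: "(LINT \<omega>:K|M. D \<omega>) = 0" if K: "K \<in> sets H" for K
  proof -
    have "K \<in> sigma_sets (space M) \<R>" using K sigma_sets_mono'[OF gen] by (auto simp: setsH)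
    from Int \<R>sub this show ?thesis
    proof (induction rule: sigma_sets_induct_disjoint)
      case (basic A) then show ?case by (rule \<R>_zero)
    next
      case empty then show ?case by (simp add: set_lebesgue_integral_def)
    next
      case (compl K)
      have KM: "K \<in> events" using compl(1) \<R>sig by blast
      have "(LINT \<omega>:space M - K|M. D \<omega>)
          = (\<integral>\<omega>. indicator (space M) \<omega> *\<^sub>R D \<omega> - indicator K \<omega> *\<^sub>R D \<omega> \<partial>M)"
        unfolding set_lebesgue_integral_def using sets.sets_into_space[OF KM]
        by (intro Bochner_Integration.integral_cong) (auto simp: indicator_def)
      also have "\<dots> = (LINT \<omega>:space M|M. D \<omega>) - (LINT \<omega>:K|M. D \<omega>)"
        unfolding set_lebesgue_integral_def
        by (intro Bochner_Integration.integral_diff integrable_mult_indicator KM sets.top intD)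
      finally have "(LINT \<omega>:space M - K|M. D \<omega>) = (LINT \<omega>:space M|M. D \<omega>) - (LINT \<omega>:K|M. D \<omega>)" .
      then show ?case using compl \<R>_zero[OF spaceMH] by simp
    next
      case (union K)
      have KM: "K i \<in> events" for i
        using union(2) \<R>sig by blast
      have "(LINT \<omega>:(\<Union>i. K i)|M. D \<omega>) = (\<Sum>i. (LINT \<omega>:K i|M. D \<omega>))"
        using union(1) integrable_mult_indicator[OF sets.countable_UN intD, of K UNIV] KM
        by (intro lebesgue_integral_countable_add) (auto simp: disjoint_family_on_def set_integrable_def)
      then show ?case using union by simp
    qed
  qed
  have "AE \<omega> in M. real_cond_exp M H (indicator A) \<omega> = C \<omega>"
  proof (rule H.real_cond_exp_charact[OF _ intA intC])
    fix K assume K: "K \<in> sets H"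
    then have KM: "K \<in> events" using HM by (auto simp: subalgebra_def)
    have "(LINT \<omega>:K|M. indicator A \<omega>) - (LINT \<omega>:K|M. C \<omega>) = (LINT \<omega>:K|M. D \<omega>)"
      unfolding D_def set_lebesgue_integral_def
      using integrable_mult_indicator[OF KM intA] integrable_mult_indicator[OF KM intC]
      by (subst Bochner_Integration.integral_diff[symmetric])
        (auto simp: algebra_simps intro!: Bochner_Integration.integral_cong)
    then show "(LINT \<omega>:K|M. indicat_real A \<omega>) = (LINT \<omega>:K|M. C \<omega>)" using zero[OF K] by simp
  next
    show "C \<in> borel_measurable H"
    proof (rule measurable_from_subalg[OF _ CF])
      show "subalgebra H F" using FGH sp HM by (auto simp: subalgebra_def)
    qed
  qed
  moreover have "AE \<omega> in M. real_cond_exp M H (indicator A) \<omega> = indicat_real A \<omega>"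
    using A(2) by (intro H.real_cond_exp_F_meas intA borel_measurable_indicator) (simp add: setsH)
  ultimately have eq: "AE \<omega> in M. C \<omega> = indicator A \<omega>" by eventually_elim simp
  have "{\<omega>\<in>space M. 1/2 < C \<omega>} \<in> sets F"
    using CF sp(2) by (metis borel_measurable_iff_greater)
  moreover have "AE \<omega> in M. \<omega> \<in> A \<longleftrightarrow> \<omega> \<in> {\<omega>\<in>space M. 1/2 < C \<omega>}"
    using eq AE_space by eventually_elim (auto simp: indicator_def split: if_splits)
  ultimately show ?thesis by blast
qed

text \<open>The sets that can be approximated form a sigma algebra: a countable union is cut to a finite union at a small cost, and
the finitely many members are approximated with errors that add up.\<close>

lemma (in prob_space) algebra_approximates_sigma_algebra:
  assumes alg: "algebra (space M) \<S>" and sub: "\<S> \<subseteq> events"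
    and A: "A \<in> sigma_sets (space M) \<S>" and "0 < \<epsilon>"
  shows "\<exists>S\<in>\<S>. prob ((A - S) \<union> (S - A)) < \<epsilon>"
  using A \<open>0 < \<epsilon>\<close>
proof (induction arbitrary: \<epsilon>)
  interpret S: algebra "space M" \<S> by fact
  {
    case (Basic a) then show ?case by (intro bexI[of _ a]) auto
  next
    case Empty then show ?case by (intro bexI[of _ "{}"]) auto
  next
    case (Compl a)
    then obtain S where S: "S \<in> \<S>" "prob ((a - S) \<union> (S - a)) < \<epsilon>" by blast
    have "a \<in> events" using Compl(1) sub sets.sigma_sets_subset[OF sub] by auto
    then have "((space M - a) - (space M - S)) \<union> ((space M - S) - (space M - a)) = (a - S) \<union> (S - a)"
      using S(1) sub sets.sets_into_space by blast
    then show ?case using S by (intro bexI[of _ "space M - S"]) auto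
  next
    case (Union a)
    have aM: "a i \<in> events" for i using Union(1) sets.sigma_sets_subset[OF sub] by auto
    define b where "b m = (\<Union>i<m. a i)" for m :: nat
    have bM: "b m \<in> events" for m by (auto simp: b_def intro!: sets.finite_UN aM)
    have "(\<lambda>m. prob (b m)) \<longlonglongrightarrow> prob (\<Union>m. b m)"
      by (rule finite_Lim_measure_incseq) (use bM in \<open>auto simp: incseq_def b_def\<close>, force)
    moreover have Ub: "(\<Union>m. b m) = (\<Union>i. a i)" by (auto simp: b_def)
    ultimately have "eventually (\<lambda>m. prob (\<Union>i. a i) - \<epsilon> / 2 < prob (b m)) sequentially"
      using \<open>0 < \<epsilon>\<close> by (intro order_tendstoD(1)) auto
    then obtain m where m: "prob (\<Union>i. a i) - \<epsilon> / 2 < prob (b m)" by (auto simp: eventually_sequentially)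
    have "\<exists>S\<in>\<S>. prob ((a i - S) \<union> (S - a i)) < \<epsilon> / (2 * (real m + 1))" for i
      using Union(2) \<open>0 < \<epsilon>\<close> by simp
    then obtain S where S: "\<And>i. S i \<in> \<S>" "\<And>i. prob ((a i - S i) \<union> (S i - a i)) < \<epsilon> / (2 * (real m + 1))"
      by metis
    define U where "U = (\<Union>i<m. S i)"
    have US: "U \<in> \<S>" unfolding U_def using S by (intro S.finite_UN) auto
    have dM: "(a i - S i) \<union> (S i - a i) \<in> events" for i using aM S sub by (intro sets.Un sets.Diff) auto
    have "prob (((\<Union>i. a i) - U) \<union> (U - (\<Union>i. a i)))
        \<le> prob (((\<Union>i. a i) - b m) \<union> (\<Union>i<m. (a i - S i) \<union> (S i - a i)))"
      by (rule finite_measure_mono)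
        (use dM aM bM in \<open>auto simp: U_def b_def intro!: sets.Un sets.Diff sets.finite_UN sets.countable_UN\<close>)
    also have "\<dots> \<le> prob ((\<Union>i. a i) - b m) + prob (\<Union>i<m. (a i - S i) \<union> (S i - a i))"
      by (rule measure_Un_le) (use dM aM bM in \<open>auto intro!: sets.finite_UN\<close>)
    also have "prob ((\<Union>i. a i) - b m) = prob (\<Union>i. a i) - prob (b m)"
      using aM bM by (intro finite_measure_Diff) (auto simp: b_def)
    also have "prob (\<Union>i<m. (a i - S i) \<union> (S i - a i)) \<le> (\<Sum>i<m. prob ((a i - S i) \<union> (S i - a i)))"
      using dM by (intro finite_measure_subadditive_finite) auto
    also have "\<dots> \<le> (\<Sum>i<m. \<epsilon> / (2 * (real m + 1)))"
      using S(2) by (intro sum_mono) (simp add: less_imp_le)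
    also have "\<dots> \<le> \<epsilon> / 2" using \<open>0 < \<epsilon>\<close> by (simp add: field_simps)
    finally show ?case using m US by (intro bexI[of _ U]) auto
  }
qed

section \<open>A one-sided mapping theorem on metric spaces\<close>

lemma continuous_map_borel_of_measurable:
  assumes "continuous_map S euclideanreal f"
  shows "f \<in> borel_measurable (borel_of S)"
proof (rule borel_measurableI)
  have sp: "space (borel_of S) = topspace S"
    by (simp add: borel_of_def space_measure_of_conv)
  have sets: "sets (borel_of S) = sigma_sets (topspace S) {U. openin S U}"
    unfolding borel_of_def by (rule sets_measure_of) (auto dest: openin_subset)
  fix U :: "real set" assume "open U"
  then have "openin S {x \<in> topspace S. f x \<in> U}"
    using assms by (auto simp: continuous_map_def)
  moreover have "{x \<in> topspace S. f x \<in> U} = f -` U \<inter> topspace S" by auto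
  ultimately show "f -` U \<inter> space (borel_of S) \<in> sets (borel_of S)"
    unfolding sp sets by auto
qed

lemma space_borel_of: "space (borel_of S) = topspace S"
  by (simp add: borel_of_def space_measure_of_conv)

context Metric_space
begin

text \<open>Sup-convolution with the distance: the least \<open>k\<close>-Lipschitz majorant. For large \<open>k\<close> its value at a point only
depends on \<open>g\<close> near that point, see \<open>upper_hull_le\<close>.\<close>

definition upper_hull :: "real \<Rightarrow> ('a \<Rightarrow> real) \<Rightarrow> 'a \<Rightarrow> real" where
  "upper_hull k g x = (SUP y\<in>M. g y - k * d x y)"

context
  fixes g :: "'a \<Rightarrow> real" and k :: real
  assumes g: "\<And>y. y \<in> M \<Longrightarrow> 0 \<le> g y \<and> g y \<le> 1" and k: "0 < k"
begin

lemma upper_hull_bdd: "bdd_above ((\<lambda>y. g y - k * d x y) ` M)"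
proof (rule bdd_aboveI2)
  fix y assume "y \<in> M"
  then show "g y - k * d x y \<le> 1" using g[of y] k nonneg[of x y] mult_nonneg_nonneg[of k "d x y"] by linarith
qed

lemma upper_hull_ge: "x \<in> M \<Longrightarrow> g x \<le> upper_hull k g x"
  unfolding upper_hull_def using cSUP_upper[OF _ upper_hull_bdd, of x x] by simp

lemma upper_hull_le:
  assumes x: "x \<in> M" and "0 \<le> c" and near: "\<And>y. y \<in> M \<Longrightarrow> d x y < 1 / k \<Longrightarrow> g y \<le> c"
  shows "upper_hull k g x \<le> c"
  unfolding upper_hull_def
proof (rule cSUP_least)
  show "M \<noteq> {}" using x by auto
  fix y assume y: "y \<in> M"
  show "g y - k * d x y \<le> c"
  proof (cases "d x y < 1 / k")
    case True
    then show ?thesis using near[OF y True] k nonneg[of x y] mult_nonneg_nonneg[of k "d x y"] by linarith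
  next
    case False
    then have "1 \<le> k * d x y" using k by (simp add: field_simps)
    then show ?thesis using g[OF y] \<open>0 \<le> c\<close> by linarith
  qed
qed

lemma upper_hull_range: "x \<in> M \<Longrightarrow> 0 \<le> upper_hull k g x \<and> upper_hull k g x \<le> 1"
  using upper_hull_ge[of x] upper_hull_le[of x 1] g by force

lemma upper_hull_Lipschitz:
  assumes "x \<in> M" "x' \<in> M"
  shows "upper_hull k g x \<le> upper_hull k g x' + k * d x x'"
  unfolding upper_hull_def[of k g x]
proof (rule cSUP_least)
  show "M \<noteq> {}" using assms by auto
  fix y assume y: "y \<in> M"
  have "g y - k * d x' y \<le> upper_hull k g x'"
    unfolding upper_hull_def by (rule cSUP_upper[OF y upper_hull_bdd])
  moreover have "k * d x' y \<le> k * (d x x' + d x y)"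
    using triangle[of x' x y] assms y k commute[of x x'] by (intro mult_left_mono) auto
  ultimately show "g y - k * d x y \<le> upper_hull k g x' + k * d x x'"
    by (simp add: algebra_simps)
qed

lemma continuous_map_upper_hull: "continuous_map mtopology euclideanreal (upper_hull k g)"
proof -
  have "\<exists>\<delta>>0. \<forall>x. x \<in> M \<and> d a x < \<delta> \<longrightarrow> dist (upper_hull k g a) (upper_hull k g x) < \<epsilon>"
    if "a \<in> M" "0 < \<epsilon>" for a and \<epsilon> :: real
  proof (intro exI[of _ "\<epsilon> / k"] conjI allI impI)
    show "0 < \<epsilon> / k" using that k by simp
    fix x assume x: "x \<in> M \<and> d a x < \<epsilon> / k"
    then have "k * d a x < \<epsilon>" using k by (simp add: field_simps)
    then show "dist (upper_hull k g a) (upper_hull k g x) < \<epsilon>"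
      using upper_hull_Lipschitz[of a x] upper_hull_Lipschitz[of x a] x that commute[of a x]
      by (auto simp: dist_real_def)
  qed
  then show ?thesis
    using metric_continuous_map[OF Met_TC.Metric_space_axioms[where ?'a = real], of "upper_hull k g"]
    by auto
qed

end

text \<open>A mapping theorem with three degrees of freedom. The functionals \<open>g m\<close> may change with the radius on which they are controlled
near the limit, so that they can describe oscillations over shrinking windows. The conclusion speaks of all measurable \<open>f\<close> below them, with \<open>m\<close> and the threshold for \<open>k\<close> chosen before
\<open>f\<close>; so \<open>g m\<close> may be a supremum over uncountably many times, and the bound is uniform over these times. The weight \<open>a\<close> carries the second coordinate. The proof passes to the
limit with the Lipschitz majorants of the \<open>g m\<close>, whose upper limit at \<open>Z\<close> is at most \<open>l\<close> almost surely.\<close>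

lemma portmanteau_upper:
  fixes N :: "'w measure" and a :: "real \<Rightarrow> real"
  assumes N: "prob_space N"
    and conv: "converges_in_law N (prod_topology mtopology euclideanreal)
      (\<lambda>k \<omega>. (Y k \<omega>, \<rho> k \<omega>)) (\<lambda>\<omega>. (Z \<omega>, \<tau> \<omega>))"
    and a: "continuous_on UNIV a" "\<And>s. 0 \<le> a s \<and> a s \<le> 1"
    and g: "\<And>m y. y \<in> M \<Longrightarrow> 0 \<le> g m y \<and> g m y \<le> (1::real)"
    and l: "l \<in> borel_measurable N" "\<And>\<omega>. \<omega> \<in> space N \<Longrightarrow> 0 \<le> l \<omega> \<and> l \<omega> \<le> (1::real)"
    and lim: "AE \<omega> in N. \<forall>\<epsilon>>0. \<exists>m0. \<forall>m\<ge>m0. \<forall>y\<in>M. d (Z \<omega>) y < 1 / real (Suc m) \<longrightarrow> g m y \<le> l \<omega> + \<epsilon>"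
    and "0 < \<eta>"
  shows "\<exists>m. eventually (\<lambda>k. \<forall>f\<in>borel_measurable N. (\<forall>\<omega>\<in>space N. 0 \<le> f \<omega> \<and> f \<omega> \<le> g m (Y k \<omega>)) \<longrightarrow>
      (\<integral>\<omega>. a (\<rho> k \<omega>) * f \<omega> \<partial>N) \<le> (\<integral>\<omega>. a (\<tau> \<omega>) * l \<omega> \<partial>N) + \<eta>) sequentially"
proof -
  interpret N: prob_space N by fact
  define P where "P = prod_topology mtopology euclideanreal"
  have topP: "topspace P = M \<times> UNIV" by (simp add: P_def)
  define H where "H m = upper_hull (real (Suc m)) (g m)" for m
  define \<Phi> where "\<Phi> m z = a (snd z) * H m (fst z)" for m and z :: "'a \<times> real"
  have meas: "(\<lambda>\<omega>. (Y k \<omega>, \<rho> k \<omega>)) \<in> N \<rightarrow>\<^sub>M borel_of P" "(\<lambda>\<omega>. (Z \<omega>, \<tau> \<omega>)) \<in> N \<rightarrow>\<^sub>M borel_of P" for k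
    using conv by (auto simp: converges_in_law_def P_def)
  have mem: "Y k \<omega> \<in> M" "Z \<omega> \<in> M" if "\<omega> \<in> space N" for k \<omega>
    using measurable_space[OF meas(1) that] measurable_space[OF meas(2) that]
    by (auto simp: space_borel_of topP)
  have Hr: "0 \<le> H m x \<and> H m x \<le> 1" if "x \<in> M" for m x
    unfolding H_def using g that by (intro upper_hull_range) auto
  have contH: "continuous_map mtopology euclideanreal (H m)" for m
    unfolding H_def using g by (intro continuous_map_upper_hull) auto
  have contfst: "continuous_map P euclideanreal (\<lambda>z. H m (fst z))" for m
    unfolding P_def using continuous_map_compose[OF continuous_map_fst contH] by (simp add: o_def)
  have contsnd: "continuous_map P euclideanreal (\<lambda>z. a (snd z))"
    unfolding P_def using continuous_map_compose[OF continuous_map_snd, of euclideanreal euclideanreal a] a(1)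
    by (simp add: o_def)
  have cont\<Phi>: "continuous_map P euclideanreal (\<Phi> m)" for m
    unfolding \<Phi>_def by (intro continuous_map_real_mult contfst contsnd)
  have \<Phi>r: "0 \<le> \<Phi> m z \<and> \<Phi> m z \<le> 1" if "z \<in> topspace P" for m z
    unfolding \<Phi>_def using a(2)[of "snd z"] Hr[of "fst z" m] that topP
    by (auto simp: mult_le_one)
  have bdd: "bounded (\<Phi> m ` topspace P)" for m
    by (rule boundedI[of _ 1]) (use \<Phi>r in force)
  have conv\<Phi>: "(\<lambda>k. \<integral>\<omega>. \<Phi> m (Y k \<omega>, \<rho> k \<omega>) \<partial>N) \<longlonglongrightarrow> (\<integral>\<omega>. \<Phi> m (Z \<omega>, \<tau> \<omega>) \<partial>N)" for m
    using conv cont\<Phi>[of m] bdd[of m] by (auto simp: converges_in_law_def P_def)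
  note cm = continuous_map_borel_of_measurable
  have m\<Phi>: "(\<lambda>\<omega>. \<Phi> m (Y k \<omega>, \<rho> k \<omega>)) \<in> borel_measurable N" "(\<lambda>\<omega>. \<Phi> m (Z \<omega>, \<tau> \<omega>)) \<in> borel_measurable N" for m k
    using measurable_compose[OF meas(1) cm[OF cont\<Phi>]] measurable_compose[OF meas(2) cm[OF cont\<Phi>]] by auto
  have ma: "(\<lambda>\<omega>. a (\<rho> k \<omega>)) \<in> borel_measurable N" "(\<lambda>\<omega>. a (\<tau> \<omega>)) \<in> borel_measurable N" for k
    using measurable_compose[OF meas(1) cm[OF contsnd]] measurable_compose[OF meas(2) cm[OF contsnd]] by auto
  have mH: "(\<lambda>\<omega>. H m (Z \<omega>)) \<in> borel_measurable N" for m
    using measurable_compose[OF meas(2) cm[OF contfst]] by auto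
  note ma[measurable] mH[measurable] l(1)[measurable]
  have "(\<lambda>m. \<integral>\<omega>. a (\<tau> \<omega>) * max (H m (Z \<omega>)) (l \<omega>) \<partial>N) \<longlonglongrightarrow> (\<integral>\<omega>. a (\<tau> \<omega>) * l \<omega> \<partial>N)"
  proof (rule integral_dominated_convergence[where w = "\<lambda>_. 1"])
    show "AE \<omega> in N. (\<lambda>m. a (\<tau> \<omega>) * max (H m (Z \<omega>)) (l \<omega>)) \<longlonglongrightarrow> a (\<tau> \<omega>) * l \<omega>"
      using lim AE_space
    proof eventually_elim
      case (elim \<omega>)
      have "(\<lambda>m. max (H m (Z \<omega>)) (l \<omega>)) \<longlonglongrightarrow> l \<omega>"
      proof (rule LIMSEQ_I)
        fix e :: real assume "0 < e"
        then obtain m0 where m0: "\<And>m y. m \<ge> m0 \<Longrightarrow> y \<in> M \<Longrightarrow> d (Z \<omega>) y < 1 / real (Suc m) \<Longrightarrow> g m y \<le> l \<omega> + e / 2"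
          using elim(1) by (meson half_gt_zero)
        have "H m (Z \<omega>) \<le> l \<omega> + e / 2" if "m \<ge> m0" for m
          unfolding H_def using m0[OF that] mem(2)[OF elim(2)] l(2)[OF elim(2)] g \<open>0 < e\<close>
          by (intro upper_hull_le) auto
        then show "\<exists>m0. \<forall>m\<ge>m0. norm (max (H m (Z \<omega>)) (l \<omega>) - l \<omega>) < e"
          using \<open>0 < e\<close> by (intro exI[of _ m0]) (force simp: max_def)
      qed
      then show ?case by (intro tendsto_mult_left)
    qed
    show "AE \<omega> in N. norm (a (\<tau> \<omega>) * max (H m (Z \<omega>)) (l \<omega>)) \<le> 1" for m
      using AE_space
    proof eventually_elim
      case (elim \<omega>)
      show ?case using a(2)[of "\<tau> \<omega>"] Hr[OF mem(2)[OF elim], of m] l(2)[OF elim]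
        by (auto simp: abs_mult intro!: mult_le_one)
    qed
  qed auto
  then have "eventually (\<lambda>m. (\<integral>\<omega>. a (\<tau> \<omega>) * max (H m (Z \<omega>)) (l \<omega>) \<partial>N) < (\<integral>\<omega>. a (\<tau> \<omega>) * l \<omega> \<partial>N) + \<eta> / 2) sequentially"
    using \<open>0 < \<eta>\<close> by (intro order_tendstoD(2)) auto
  then obtain m where m: "(\<integral>\<omega>. a (\<tau> \<omega>) * max (H m (Z \<omega>)) (l \<omega>) \<partial>N) < (\<integral>\<omega>. a (\<tau> \<omega>) * l \<omega> \<partial>N) + \<eta> / 2"
    by (auto simp: eventually_sequentially)
  have "(\<integral>\<omega>. \<Phi> m (Z \<omega>, \<tau> \<omega>) \<partial>N) \<le> (\<integral>\<omega>. a (\<tau> \<omega>) * max (H m (Z \<omega>)) (l \<omega>) \<partial>N)"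
  proof (rule integral_mono)
    show "integrable N (\<lambda>\<omega>. \<Phi> m (Z \<omega>, \<tau> \<omega>))"
      using \<Phi>r mem topP m\<Phi> by (intro N.integrable_const_bound[of _ 1]) auto
    show "integrable N (\<lambda>\<omega>. a (\<tau> \<omega>) * max (H m (Z \<omega>)) (l \<omega>))"
    proof (rule N.integrable_const_bound[of _ 1])
      show "AE \<omega> in N. norm (a (\<tau> \<omega>) * max (H m (Z \<omega>)) (l \<omega>)) \<le> 1"
        using AE_space
      proof eventually_elim
        case (elim \<omega>)
        show ?case using a(2)[of "\<tau> \<omega>"] Hr[OF mem(2)[OF elim], of m] l(2)[OF elim]
          by (auto simp: abs_mult intro!: mult_le_one)
      qed
    qed auto
    show "\<Phi> m (Z \<omega>, \<tau> \<omega>) \<le> a (\<tau> \<omega>) * max (H m (Z \<omega>)) (l \<omega>)" for \<omega>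
      using a(2)[of "\<tau> \<omega>"] by (auto simp: \<Phi>_def intro!: mult_left_mono)
  qed
  with m have "(\<integral>\<omega>. \<Phi> m (Z \<omega>, \<tau> \<omega>) \<partial>N) < (\<integral>\<omega>. a (\<tau> \<omega>) * l \<omega> \<partial>N) + \<eta>" using \<open>0 < \<eta>\<close> by simp
  then have "eventually (\<lambda>k. (\<integral>\<omega>. \<Phi> m (Y k \<omega>, \<rho> k \<omega>) \<partial>N) < (\<integral>\<omega>. a (\<tau> \<omega>) * l \<omega> \<partial>N) + \<eta>) sequentially"
    by (rule order_tendstoD(2)[OF conv\<Phi>])
  then have "eventually (\<lambda>k. \<forall>f\<in>borel_measurable N. (\<forall>\<omega>\<in>space N. 0 \<le> f \<omega> \<and> f \<omega> \<le> g m (Y k \<omega>)) \<longrightarrow>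
      (\<integral>\<omega>. a (\<rho> k \<omega>) * f \<omega> \<partial>N) \<le> (\<integral>\<omega>. a (\<tau> \<omega>) * l \<omega> \<partial>N) + \<eta>) sequentially"
  proof eventually_elim
    case (elim k)
    show ?case
    proof (intro ballI impI)
      fix f assume f: "f \<in> borel_measurable N" "\<forall>\<omega>\<in>space N. 0 \<le> f \<omega> \<and> f \<omega> \<le> g m (Y k \<omega>)"
      have le: "f \<omega> \<le> H m (Y k \<omega>)" if "\<omega> \<in> space N" for \<omega>
        using f(2) that mem(1)[OF that, of k] upper_hull_ge[of "g m" "real (Suc m)" "Y k \<omega>"] g
        unfolding H_def by force
      have "(\<integral>\<omega>. a (\<rho> k \<omega>) * f \<omega> \<partial>N) \<le> (\<integral>\<omega>. \<Phi> m (Y k \<omega>, \<rho> k \<omega>) \<partial>N)"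
      proof (rule integral_mono)
        show "integrable N (\<lambda>\<omega>. a (\<rho> k \<omega>) * f \<omega>)"
        proof (rule N.integrable_const_bound[of _ 1])
          show "AE \<omega> in N. norm (a (\<rho> k \<omega>) * f \<omega>) \<le> 1"
            using AE_space
          proof eventually_elim
            case (elim \<omega>)
            then show ?case using a(2)[of "\<rho> k \<omega>"] f(2) le[OF elim] Hr[OF mem(1)[OF elim], of m k]
              by (auto simp: abs_mult intro!: mult_le_one)
          qed
        qed (use f in auto)
        show "integrable N (\<lambda>\<omega>. \<Phi> m (Y k \<omega>, \<rho> k \<omega>))"
          using \<Phi>r mem topP m\<Phi> by (intro N.integrable_const_bound[of _ 1]) auto
        show "a (\<rho> k \<omega>) * f \<omega> \<le> \<Phi> m (Y k \<omega>, \<rho> k \<omega>)" if "\<omega> \<in> space N" for \<omega>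
          using a(2)[of "\<rho> k \<omega>"] le[OF that] by (auto simp: \<Phi>_def intro!: mult_left_mono)
      qed
      then show "(\<integral>\<omega>. a (\<rho> k \<omega>) * f \<omega> \<partial>N) \<le> (\<integral>\<omega>. a (\<tau> \<omega>) * l \<omega> \<partial>N) + \<eta>" using elim by simp
    qed
  qed
  then show ?thesis by blast
qed

end

section \<open>Evaluation on the Skorokhod space and time grids\<close>

interpretation Skorokhod: Metric_space "skorokhod_space T" "skorokhod_dist T" for T
  by (rule Metric_space_skorokhod)

lemma skorokhod_dist_less_imp_time_change:
  assumes "x \<in> skorokhod_space T" "y \<in> skorokhod_space T" "skorokhod_dist T x y < e"
  obtains h where "h \<in> time_changes T"
    "\<And>t. t \<in> {0..T} \<Longrightarrow> \<bar>h t - t\<bar> < e \<and> \<bar>x t - y (h t)\<bar> < e"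
proof -
  have "Inf (skorokhod_close T x y) < e" using assms by (simp add: skorokhod_dist_def)
  then obtain e' where "e' \<in> skorokhod_close T x y" "e' < e"
    using cInf_lessD[OF skorokhod_close_nonempty[OF assms(1,2)]] by blast
  then show ?thesis
    by (auto simp: skorokhod_close_def intro!: that intro: order_le_less_trans)
qed

text \<open>A time change is onto, so each value of \<open>y\<close> is matched by a value of \<open>x\<close> at a nearby time.\<close>

lemma skorokhod_close_value:
  assumes "x \<in> skorokhod_space T" "y \<in> skorokhod_space T" "skorokhod_dist T x y < e" "s \<in> {0..T}"
  obtains u where "u \<in> {0..T}" "\<bar>u - s\<bar> < e" "\<bar>y s - x u\<bar> < e"
proof -
  obtain h where h: "h \<in> time_changes T"
    "\<And>t. t \<in> {0..T} \<Longrightarrow> \<bar>h t - t\<bar> < e \<and> \<bar>x t - y (h t)\<bar> < e"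
    using skorokhod_dist_less_imp_time_change[OF assms(1-3)] by blast
  have "s \<in> h ` {0..T}" using h(1) assms(4) by (simp add: time_changes_def)
  then obtain u where "u \<in> {0..T}" "s = h u" by blast
  then show ?thesis using h(2)[of u] that[of u] by (auto simp: abs_minus_commute)
qed

text \<open>At a continuity point \<open>t\<close> of \<open>x\<close>, evaluation is jointly continuous in the path and in the time.\<close>

lemma skorokhod_eval_near:
  assumes x: "x \<in> skorokhod_space T" and c: "continuous (at t within {0..T}) x" and "0 < e"
  obtains \<delta> where "0 < \<delta>"
    "\<And>y s. y \<in> skorokhod_space T \<Longrightarrow> skorokhod_dist T x y < \<delta> \<Longrightarrow> s \<in> {0..T} \<Longrightarrow> \<bar>s - t\<bar> \<le> \<delta> \<Longrightarrow> \<bar>y s - x t\<bar> < e"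
proof -
  obtain d where d: "0 < d" "\<And>u. u \<in> {0..T} \<Longrightarrow> \<bar>u - t\<bar> < d \<Longrightarrow> \<bar>x u - x t\<bar> < e / 2"
    using c \<open>0 < e\<close> unfolding continuous_within_eps_delta dist_real_def by (meson half_gt_zero)
  show ?thesis
  proof (rule that[of "min (d / 2) (e / 2)"])
    show "0 < min (d / 2) (e / 2)" using d \<open>0 < e\<close> by simp
    fix y s assume y: "y \<in> skorokhod_space T" "skorokhod_dist T x y < min (d / 2) (e / 2)"
      and s: "s \<in> {0..T}" "\<bar>s - t\<bar> \<le> min (d / 2) (e / 2)"
    obtain u where u: "u \<in> {0..T}" "\<bar>u - s\<bar> < min (d / 2) (e / 2)" "\<bar>y s - x u\<bar> < min (d / 2) (e / 2)"
      using skorokhod_close_value[OF x y s(1)] by blast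
    then have "\<bar>u - s\<bar> < d / 2" "\<bar>s - t\<bar> \<le> d / 2" using s(2) by auto
    then have "\<bar>u - t\<bar> < d" by linarith
    then have "\<bar>x u - x t\<bar> < e / 2" by (rule d(2)[OF u(1)])
    moreover have "\<bar>y s - x u\<bar> < e / 2" using u(3) by simp
    ultimately show "\<bar>y s - x t\<bar> < e" by linarith
  qed
qed

text \<open>The index is shifted by one step and cut at \<open>T\<close>. A time \<open>s\<close> of the cell that ends at \<open>T * j / N\<close>
is assigned the end of the following cell. Hence an event of the right-continuous filtration at
\<open>T * j / N < T\<close> lies in the natural filtration at the assigned time.\<close>

definition clamped_grid :: "real \<Rightarrow> nat \<Rightarrow> nat \<Rightarrow> real" where
  "clamped_grid T N j = T * real (min (Suc j) N) / real N"

lemma clamped_grid_range: "0 < T \<Longrightarrow> clamped_grid T N j \<in> {0..T}"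
  by (cases "N = 0") (auto simp: clamped_grid_def field_simps)

lemma clamped_grid_mono: "0 < T \<Longrightarrow> i \<le> j \<Longrightarrow> clamped_grid T N i \<le> clamped_grid T N j"
  by (auto simp: clamped_grid_def intro!: divide_right_mono mult_left_mono)

definition grid_index :: "real \<Rightarrow> nat \<Rightarrow> real \<Rightarrow> nat" where
  "grid_index T N s = nat \<lceil>s * real N / T\<rceil>"

lemma grid_index_le_iff:
  assumes "0 < T" "0 < N"
  shows "grid_index T N s \<le> j \<longleftrightarrow> s \<le> T * real j / real N"
proof -
  have "grid_index T N s \<le> j \<longleftrightarrow> s * real N / T \<le> real j"
    unfolding grid_index_def by (metis ceiling_le_iff nat_le_iff of_int_of_nat_eq)
  then show ?thesis using assms by (simp add: field_simps)
qed

lemma grid_index_le: "0 < T \<Longrightarrow> 0 < N \<Longrightarrow> s \<in> {0..T} \<Longrightarrow> grid_index T N s \<le> N"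
  by (simp add: grid_index_le_iff)

lemma grid_index_clamped:
  assumes "0 < T" "0 < N" "s \<in> {0..T}"
  shows "s \<le> clamped_grid T N (grid_index T N s)" "clamped_grid T N (grid_index T N s) \<le> s + 2 * T / real N"
proof -
  let ?j = "grid_index T N s"
  have le: "?j \<le> N" by (rule grid_index_le[OF assms])
  have s: "s \<le> T * real ?j / real N" using grid_index_le_iff[OF assms(1,2), of s ?j] by simp
  have "T * real ?j / real N \<le> clamped_grid T N ?j"
    using assms le by (auto simp: clamped_grid_def intro!: divide_right_mono mult_left_mono)
  then show "s \<le> clamped_grid T N ?j" using s by simp
  have "real ?j \<le> s * real N / T + 1"
    using assms by (simp add: grid_index_def)
  then have "real (min (Suc ?j) N) \<le> s * real N / T + 2" by linarith
  then have "T * real (min (Suc ?j) N) / real N \<le> T * (s * real N / T + 2) / real N"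
    using assms by (intro divide_right_mono mult_left_mono) auto
  also have "\<dots> = s + 2 * T / real N" using assms by (simp add: field_simps)
  finally show "clamped_grid T N ?j \<le> s + 2 * T / real N" by (simp add: clamped_grid_def)
qed

definition ramp :: "real \<Rightarrow> real" where "ramp x = min 1 (max 0 x)"

lemma ramp_range: "0 \<le> ramp x" "ramp x \<le> 1" by (auto simp: ramp_def)

lemma continuous_ramp: "continuous_on UNIV ramp"
  unfolding ramp_def by (intro continuous_intros)

text \<open>The hat function centred at \<open>T * j / N\<close>, written as a difference of ramps so that the sum over \<open>j\<close> telescopes. These
continuous weights replace the indicators of the grid cells when a random time passes to the limit in law.\<close>

definition grid_hat :: "real \<Rightarrow> nat \<Rightarrow> nat \<Rightarrow> real \<Rightarrow> real" where
  "grid_hat T N j s = ramp (s * real N / T - real j + 1) - ramp (s * real N / T - real j)"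

lemma continuous_grid_hat: "0 < T \<Longrightarrow> continuous_on UNIV (grid_hat T N j)"
  unfolding grid_hat_def
  by (intro continuous_intros continuous_on_compose2[OF continuous_ramp]) auto

lemma grid_hat_range: "0 \<le> grid_hat T N j s" "grid_hat T N j s \<le> 1"
  by (auto simp: grid_hat_def ramp_def)

lemma sum_grid_hat:
  assumes "0 < T" "0 < N" "s \<in> {0..T}"
  shows "(\<Sum>j\<le>N. grid_hat T N j s) = 1"
proof -
  let ?c = "\<lambda>j. ramp (s * real N / T - real j + 1)"
  have "(\<Sum>j\<le>N. grid_hat T N j s) = (\<Sum>j\<le>N. ?c j - ?c (Suc j))"
    by (simp add: grid_hat_def algebra_simps)
  also have "\<dots> = ?c 0 - ?c (Suc N)" by (rule sum_telescope)
  also have "?c 0 = 1" using assms by (simp add: ramp_def)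
  also have "?c (Suc N) = 0"
  proof -
    have "s * real N / T \<le> real N" using assms by (simp add: field_simps)
    then show ?thesis by (simp add: ramp_def)
  qed
  finally show ?thesis by simp
qed

lemma grid_hat_support:
  assumes "0 < T" "0 < N" "s \<in> {0..T}" "j \<le> N" "grid_hat T N j s \<noteq> 0"
  shows "s \<le> clamped_grid T N j" "clamped_grid T N j \<le> s + 2 * T / real N"
proof -
  let ?z = "s * real N / T"
  have z: "?z < real j + 1" "real j - 1 < ?z"
    using assms(5) by (auto simp: grid_hat_def ramp_def min_def max_def split: if_splits)
  have "?z \<le> real (min (Suc j) N)" using z(1) assms by (auto simp: min_def field_simps)
  then have "s \<le> T * real (min (Suc j) N) / real N" using assms by (simp add: field_simps)
  then show "s \<le> clamped_grid T N j" by (simp add: clamped_grid_def)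
  have "real (min (Suc j) N) \<le> ?z + 2" using z(2) by (simp add: min_def)
  then have "T * real (min (Suc j) N) / real N \<le> T * (?z + 2) / real N"
    using assms by (intro divide_right_mono mult_left_mono) auto
  also have "\<dots> = s + 2 * T / real N" using assms by (simp add: field_simps)
  finally show "clamped_grid T N j \<le> s + 2 * T / real N" by (simp add: clamped_grid_def)
qed

text \<open>The weights are concentrated on grid times in a short interval to the right of \<open>s\<close>, where a right-continuous function is
close to its value at \<open>s\<close>.\<close>

lemma weighted_grid_limit:
  fixes f :: "real \<Rightarrow> real"
  assumes T: "0 < T" and s: "s \<in> {0..T}"
    and rc: "continuous (at s within {s..T}) f"
    and w: "\<And>N j. 0 \<le> w N j" "\<And>N. 0 < N \<Longrightarrow> (\<Sum>j\<le>N. w N j) = 1"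
      "\<And>N j. 0 < N \<Longrightarrow> j \<le> N \<Longrightarrow> w N j \<noteq> 0 \<Longrightarrow> s \<le> clamped_grid T N j \<and> clamped_grid T N j \<le> s + 2 * T / real N"
  shows "(\<lambda>N. \<Sum>j\<le>N. w N j * f (clamped_grid T N j)) \<longlonglongrightarrow> f s"
proof (rule LIMSEQ_I)
  fix e :: real assume "0 < e"
  then obtain \<delta> where \<delta>: "0 < \<delta>" "\<And>u. u \<in> {s..T} \<Longrightarrow> \<bar>u - s\<bar> < \<delta> \<Longrightarrow> \<bar>f u - f s\<bar> < e / 2"
    using rc unfolding continuous_within_eps_delta dist_real_def by (meson half_gt_zero)
  obtain N0 :: nat where N0: "2 * T / \<delta> < real N0" using reals_Archimedean2 by blast
  have "norm ((\<Sum>j\<le>N. w N j * f (clamped_grid T N j)) - f s) < e" if N: "N \<ge> max N0 1" for N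
  proof -
    have N': "0 < N" "N0 \<le> N" using N by auto
    have "2 * T / \<delta> < real N" using N0 N' by linarith
    then have small: "2 * T / real N < \<delta>" using \<delta>(1) N' T by (simp add: field_simps)
    have "(\<Sum>j\<le>N. w N j * f (clamped_grid T N j)) - f s = (\<Sum>j\<le>N. w N j * (f (clamped_grid T N j) - f s))"
      using w(2)[OF N'(1)] by (simp add: algebra_simps sum_subtractf flip: sum_distrib_left)
    also have "norm \<dots> \<le> (\<Sum>j\<le>N. norm (w N j * (f (clamped_grid T N j) - f s)))" by (rule norm_sum)
    also have "\<dots> \<le> (\<Sum>j\<le>N. w N j * (e / 2))"
    proof (rule sum_mono)
      fix j assume j: "j \<in> {..N}"
      show "norm (w N j * (f (clamped_grid T N j) - f s)) \<le> w N j * (e / 2)"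
      proof (cases "w N j = 0")
        case False
        then have "\<bar>f (clamped_grid T N j) - f s\<bar> < e / 2"
          using w(3)[of N j] j N' small clamped_grid_range[OF T, of N j] by (intro \<delta>(2)) auto
        then show ?thesis
          using w(1)[of N j] mult_left_mono[of "\<bar>f (clamped_grid T N j) - f s\<bar>" "e / 2" "w N j"]
          by (simp add: abs_mult)
      qed simp
    qed
    also have "\<dots> = e / 2" using w(2)[OF N'(1)] by (simp flip: sum_distrib_right sum_divide_distrib)
    finally show ?thesis using \<open>0 < e\<close> by simp
  qed
  then show "\<exists>N0. \<forall>N\<ge>N0. norm ((\<Sum>j\<le>N. w N j * f (clamped_grid T N j)) - f s) < e" by blast
qed

lemma cadlag_on_right_continuous:
  assumes "cadlag_on T x" "s \<in> {0..T}"
  shows "continuous (at s within {s..T}) x"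
proof (cases "s = T")
  case False
  then have "(x \<longlongrightarrow> x s) (at_right s)" using assms by (auto simp: cadlag_on_def)
  then have "(x \<longlongrightarrow> x s) (at s within {s..T})"
    using False assms by (simp add: at_within_Icc_at_right)
  then show ?thesis by (simp add: continuous_within)
qed (auto simp: continuous_within_eps_delta intro: exI[of _ 1])

section \<open>Filtrations, increments and random times\<close>

lemma space_natural_filtration [simp]: "space (natural_filtration M X t) = space M"
  by (simp add: natural_filtration_def space_measure_of_conv)

lemma sets_natural_filtration:
  "sets (natural_filtration M X t) =
     sigma_sets (space M) {X s -` B \<inter> space M | s B. 0 \<le> s \<and> s \<le> t \<and> B \<in> sets borel}"
  unfolding natural_filtration_def by (rule sets_measure_of) auto

lemma natural_filtration_least:
  assumes "space N = space M" "\<And>s. 0 \<le> s \<Longrightarrow> s \<le> t \<Longrightarrow> X s \<in> borel_measurable N"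
  shows "sets (natural_filtration M X t) \<subseteq> sets N"
proof -
  have "{X s -` B \<inter> space M | s B. 0 \<le> s \<and> s \<le> t \<and> B \<in> sets borel} \<subseteq> sets N"
    using measurable_sets[OF assms(2)] assms(1) by auto
  then show ?thesis
    unfolding sets_natural_filtration assms(1)[symmetric] by (rule sets.sigma_sets_subset)
qed

lemma measurable_natural_filtration:
  "0 \<le> s \<Longrightarrow> s \<le> t \<Longrightarrow> X s \<in> borel_measurable (natural_filtration M X t)"
  by (rule measurableI) (auto simp: sets_natural_filtration)

lemma natural_filtration_mono:
  "s \<le> t \<Longrightarrow> sets (natural_filtration M X s) \<subseteq> sets (natural_filtration M X t)"
  by (rule natural_filtration_least) (auto intro: measurable_natural_filtration)

lemma natural_filtration_subalgebra:
  assumes "cadlag_process M T X" "t \<le> T"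
  shows "subalgebra M (natural_filtration M X t)"
  using natural_filtration_least[of M M t X] assms by (auto simp: subalgebra_def cadlag_process_def)

text \<open>The set \<open>J\<close> restricts the end points of the increments; finite sets are the induction stages towards \<open>J = UNIV\<close>.\<close>

definition increments_after :: "'a measure \<Rightarrow> real \<Rightarrow> (real \<Rightarrow> 'a \<Rightarrow> real) \<Rightarrow> real \<Rightarrow> real set \<Rightarrow> 'a measure" where
  "increments_after M T X t J =
     sigma (space M) {(\<lambda>\<omega>. X v \<omega> - X t \<omega>) -` B \<inter> space M | v B. v \<in> J \<inter> {t<..T} \<and> B \<in> sets borel}"

lemma space_increments_after [simp]: "space (increments_after M T X t J) = space M"
  by (simp add: increments_after_def space_measure_of_conv)

lemma sets_increments_after:
  "sets (increments_after M T X t J) =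
     sigma_sets (space M) {(\<lambda>\<omega>. X v \<omega> - X t \<omega>) -` B \<inter> space M | v B. v \<in> J \<inter> {t<..T} \<and> B \<in> sets borel}"
  unfolding increments_after_def by (rule sets_measure_of) auto

lemma increments_after_least:
  assumes "space N = space M"
    "\<And>v. v \<in> J \<Longrightarrow> t < v \<Longrightarrow> v \<le> T \<Longrightarrow> (\<lambda>\<omega>. X v \<omega> - X t \<omega>) \<in> borel_measurable N"
  shows "sets (increments_after M T X t J) \<subseteq> sets N"
proof -
  have "{(\<lambda>\<omega>. X v \<omega> - X t \<omega>) -` B \<inter> space M | v B. v \<in> J \<inter> {t<..T} \<and> B \<in> sets borel} \<subseteq> sets N"
    using measurable_sets[OF assms(2)] assms(1) by auto
  then show ?thesis
    unfolding sets_increments_after assms(1)[symmetric] by (rule sets.sigma_sets_subset)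
qed

lemma measurable_increments_after:
  "v \<in> J \<Longrightarrow> t < v \<Longrightarrow> v \<le> T \<Longrightarrow> (\<lambda>\<omega>. X v \<omega> - X t \<omega>) \<in> borel_measurable (increments_after M T X t J)"
  by (rule measurableI) (auto simp: sets_increments_after)

lemma increments_after_mono:
  "J \<subseteq> J' \<Longrightarrow> sets (increments_after M T X t J) \<subseteq> sets (increments_after M T X t J')"
  by (rule increments_after_least) (auto intro: measurable_increments_after)

text \<open>Induction on the latest end point \<open>v\<close>. Let \<open>w\<close> be the end point before it. The increment from \<open>w\<close> to \<open>v\<close> is
independent of everything up to time \<open>w\<close>, so adding it keeps the earlier increments independent of the past of \<open>t\<close>;
the increment from \<open>t\<close> to \<open>v\<close> is the sum of two that are already covered.\<close>

lemma finite_increments_independent: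
  assumes "prob_space M" and X: "cadlag_process M T X" and ind: "independent_increments M T X"
    and t: "0 \<le> t" "t \<le> T" and J: "finite J" "J \<subseteq> {t<..T}"
  shows "prob_space.indep_set M (sets (natural_filtration M X t)) (sets (increments_after M T X t J))"
  using J
proof (induction J rule: finite_linorder_max_induct)
  interpret prob_space M by fact
  note subF = natural_filtration_subalgebra[OF X]
  {
    case empty
    have "sets (increments_after M T X t {}) = {{}, space M}"
      by (simp add: sets_increments_after sigma_sets_empty_eq)
    then show ?case using subF[OF t(2)]
      by (intro indep_setI) (auto simp: subalgebra_def prob_space dest: sets.sets_into_space intro: arg_cong[where f=prob])
  next
    case (insert v J)
    define w where "w = Max (insert t J)"
    have w: "t \<le> w" "w < v" "v \<le> T" "w \<in> insert t J" "\<And>u. u \<in> J \<Longrightarrow> u \<le> w"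
      using insert t Max_in[of "insert t J"] unfolding w_def by (auto simp: Max_less_iff)
    define V where "V = vimage_algebra (space M) (\<lambda>\<omega>. X v \<omega> - X w \<omega>) borel"
    have indw: "indep_set (sets (natural_filtration M X w)) (sets V)"
      using ind w t unfolding independent_increments_def V_def by auto
    have spV: "space V = space M" by (simp add: V_def)
    let ?F = "sets (natural_filtration M X t)" and ?I = "sets (increments_after M T X t J)"
    have Fw: "?F \<subseteq> sets (natural_filtration M X w)" using w by (intro natural_filtration_mono)
    have Iw: "?I \<subseteq> sets (natural_filtration M X w)"
      using w t by (intro increments_after_least)
        (auto intro!: borel_measurable_diff measurable_natural_filtration)
    define R where "R = {B \<inter> C |B C. B \<in> ?I \<and> C \<in> sets V}"
    have events: "?F \<subseteq> events" "sets (natural_filtration M X w) \<subseteq> events" "sets V \<subseteq> events"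
      using subF[of t] subF[of w] w t indep_setD_ev2[OF indw] by (auto simp: subalgebra_def)
    have "indep_set ?F R"
    proof (rule indep_setI)
      show "?F \<subseteq> events" "R \<subseteq> events" using events Iw by (auto simp: R_def intro!: sets.Int)
      fix A D assume A: "A \<in> ?F" and "D \<in> R"
      then obtain B C where BC: "D = B \<inter> C" "B \<in> ?I" "C \<in> sets V" by (auto simp: R_def)
      have "prob (A \<inter> D) = prob ((A \<inter> B) \<inter> C)" by (simp add: BC Int_assoc)
      also have "\<dots> = prob (A \<inter> B) * prob C"
        using A BC Fw Iw by (intro indep_setD[OF indw]) auto
      also have "prob (A \<inter> B) = prob A * prob B"
        using A BC insert by (intro indep_setD[OF insert.IH]) auto
      also have "prob A * prob B * prob C = prob A * prob D"
        using indep_setD[OF indw, of B C] BC Iw by (simp add: subset_iff)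
      finally show "prob (A \<inter> D) = prob A * prob D" .
    qed
    moreover have "Int_stable R"
    proof (rule Int_stableI)
      fix a b assume "a \<in> R" "b \<in> R"
      then obtain K L K' L' where "a = K \<inter> L" "b = K' \<inter> L'" "K \<in> ?I" "L \<in> sets V" "K' \<in> ?I" "L' \<in> sets V"
        by (auto simp: R_def)
      then have "a \<inter> b = (K \<inter> K') \<inter> (L \<inter> L') \<and> K \<inter> K' \<in> ?I \<and> L \<inter> L' \<in> sets V" by auto
      then show "a \<inter> b \<in> R" unfolding R_def by blast
    qed
    ultimately have "indep_set (sigma_sets (space M) ?F) (sigma_sets (space M) R)"
      by (intro indep_set_sigma_sets) (auto simp: Int_stable_def)
    moreover have "sets (increments_after M T X t (insert v J)) \<subseteq> sigma_sets (space M) R"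
    proof -
      define S where "S = sigma (space M) R"
      have Rsp: "R \<subseteq> Pow (space M)" using sets.space_closed[of V] spV by (auto simp: R_def)
      have setsS: "sets S = sigma_sets (space M) R" "space S = space M"
        using Rsp by (simp_all add: S_def)
      have IS: "?I \<subseteq> sets S"
      proof
        fix B assume "B \<in> ?I"
        moreover from this have "B = B \<inter> space V" using sets.sets_into_space spV by fastforce
        ultimately show "B \<in> sets S" unfolding setsS R_def by (intro sigma_sets.Basic) blast
      qed
      have VS: "sets V \<subseteq> sets S"
      proof
        fix C assume "C \<in> sets V"
        moreover from this have "C = space (increments_after M T X t J) \<inter> C"
          using sets.sets_into_space spV by fastforce
        ultimately show "C \<in> sets S" unfolding setsS R_def by (intro sigma_sets.Basic) blast
      qed
      have mI: "(\<lambda>\<omega>. X u \<omega> - X t \<omega>) \<in> borel_measurable S" if "u \<in> insert t J" for u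
      proof (cases "u = t")
        case False
        then have "(\<lambda>\<omega>. X u \<omega> - X t \<omega>) \<in> borel_measurable (increments_after M T X t J)"
          using that insert.prems by (intro measurable_increments_after) auto
        then show ?thesis using IS setsS by (auto intro: measurable_from_subalg[rotated] simp: subalgebra_def)
      qed simp
      have "(\<lambda>\<omega>. X v \<omega> - X w \<omega>) \<in> borel_measurable V"
        unfolding V_def by (rule measurable_vimage_algebra1) auto
      then have "(\<lambda>\<omega>. X v \<omega> - X w \<omega>) \<in> borel_measurable S"
        using VS setsS spV by (auto intro: measurable_from_subalg[rotated] simp: subalgebra_def)
      then have "(\<lambda>\<omega>. (X v \<omega> - X w \<omega>) + (X w \<omega> - X t \<omega>)) \<in> borel_measurable S"
        using mI[OF w(4)] by (rule borel_measurable_add)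
      then have "(\<lambda>\<omega>. X u \<omega> - X t \<omega>) \<in> borel_measurable S" if "u \<in> insert v J" for u
        using mI that by auto
      then show ?thesis using setsS by (metis increments_after_least)
    qed
    moreover have "sigma_sets (space M) ?F = ?F"
      using sets.sigma_sets_eq[of "natural_filtration M X t"] by simp
    ultimately show ?case unfolding indep_sets2_eq by auto
  }
qed

text \<open>The events that depend on finitely many increments are stable under intersection and generate the future.\<close>

lemma future_increments_independent:
  assumes "prob_space M" and X: "cadlag_process M T X" and ind: "independent_increments M T X"
    and t: "0 \<le> t" "t \<le> T"
  shows "prob_space.indep_set M (sets (natural_filtration M X t)) (sets (increments_after M T X t UNIV))"
proof -
  interpret prob_space M by fact
  let ?F = "sets (natural_filtration M X t)"
  define R where "R = (\<Union>J\<in>{J. finite J \<and> J \<subseteq> {t<..T}}. sets (increments_after M T X t J))"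
  note fin = finite_increments_independent[OF assms]
  have "indep_set ?F R"
    using fin indep_setD_ev1[OF fin[of "{}"]] unfolding R_def indep_sets2_eq by auto
  moreover have "Int_stable R"
  proof (rule Int_stableI)
    fix a b assume "a \<in> R" "b \<in> R"
    then obtain J K where JK: "a \<in> sets (increments_after M T X t J)" "b \<in> sets (increments_after M T X t K)"
      "finite J" "J \<subseteq> {t<..T}" "finite K" "K \<subseteq> {t<..T}" by (auto simp: R_def)
    then have "a \<inter> b \<in> sets (increments_after M T X t (J \<union> K))"
      using increments_after_mono[of J "J \<union> K"] increments_after_mono[of K "J \<union> K"] by blast
    then show "a \<inter> b \<in> R" using JK unfolding R_def by blast
  qed
  ultimately have "indep_set (sigma_sets (space M) ?F) (sigma_sets (space M) R)"
    by (intro indep_set_sigma_sets) (auto simp: Int_stable_def)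
  moreover have "sets (increments_after M T X t UNIV) \<subseteq> sigma_sets (space M) R"
  proof -
    have "sets (increments_after M T X t UNIV) \<subseteq> sets (sigma (space M) R)"
    proof (rule increments_after_least)
      fix v assume v: "t < v" "v \<le> T"
      have Rsp: "R \<subseteq> Pow (space M)"
        using sets.space_closed[of "increments_after M T X t _"] by (auto simp: R_def)
      have "sets (increments_after M T X t {v}) \<subseteq> sets (sigma (space M) R)"
        using v Rsp by (auto simp: R_def intro!: sigma_sets.Basic)
      then show "(\<lambda>\<omega>. X v \<omega> - X t \<omega>) \<in> borel_measurable (sigma (space M) R)"
        using measurable_increments_after[of v "{v}" t T X M] v
        by (auto intro: measurable_from_subalg[rotated] simp: subalgebra_def space_measure_of_conv)
    qed (simp add: space_measure_of_conv)
    also have "\<dots> = sigma_sets (space M) R"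
      using sets.space_closed[of "increments_after M T X t _"] by (intro sets_measure_of) (auto simp: R_def)
    finally show ?thesis .
  qed
  moreover have "sigma_sets (space M) ?F = ?F"
    using sets.sigma_sets_eq[of "natural_filtration M X t"] by simp
  ultimately show ?thesis unfolding indep_sets2_eq by auto
qed

text \<open>The value of a right-continuous process at a random time is a pointwise limit of weighted values at grid times. This gives
its measurability and, by dominated convergence, its expectation.\<close>

lemma weighted_random_time:
  fixes f :: "real \<Rightarrow> 'a \<Rightarrow> real"
  assumes "prob_space M" and T: "0 < T"
    and fM: "\<And>t. t \<in> {0..T} \<Longrightarrow> f t \<in> borel_measurable M"
    and rc: "\<And>\<omega> s. \<omega> \<in> space M \<Longrightarrow> s \<in> {0..T} \<Longrightarrow> continuous (at s within {s..T}) (\<lambda>t. f t \<omega>)"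
    and B: "\<And>\<omega> t. \<omega> \<in> space M \<Longrightarrow> t \<in> {0..T} \<Longrightarrow> \<bar>f t \<omega>\<bar> \<le> B"
    and \<rho>: "\<rho> \<in> borel_measurable M" "\<And>\<omega>. \<omega> \<in> space M \<Longrightarrow> \<rho> \<omega> \<in> {0..T}"
    and w: "\<And>N j. w N j \<in> borel_measurable borel" "\<And>N j s. 0 \<le> w N j s"
      "\<And>N s. 0 < N \<Longrightarrow> s \<in> {0..T} \<Longrightarrow> (\<Sum>j\<le>N. w N j s) = 1"
      "\<And>N j s. 0 < N \<Longrightarrow> j \<le> N \<Longrightarrow> s \<in> {0..T} \<Longrightarrow> w N j s \<noteq> 0 \<Longrightarrow>
         s \<le> clamped_grid T N j \<and> clamped_grid T N j \<le> s + 2 * T / real N"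
  shows "(\<lambda>\<omega>. f (\<rho> \<omega>) \<omega>) \<in> borel_measurable M"
    and "(\<lambda>N. \<integral>\<omega>. (\<Sum>j\<le>N. w N j (\<rho> \<omega>) * f (clamped_grid T N j) \<omega>) \<partial>M) \<longlonglongrightarrow> (\<integral>\<omega>. f (\<rho> \<omega>) \<omega> \<partial>M)"
proof -
  interpret prob_space M by fact
  let ?S = "\<lambda>N \<omega>. \<Sum>j\<le>N. w N j (\<rho> \<omega>) * f (clamped_grid T N j) \<omega>"
  have lim: "(\<lambda>N. ?S N \<omega>) \<longlonglongrightarrow> f (\<rho> \<omega>) \<omega>" if "\<omega> \<in> space M" for \<omega>
    using weighted_grid_limit[of T "\<rho> \<omega>" "\<lambda>t. f t \<omega>" "\<lambda>N j. w N j (\<rho> \<omega>)"] T rc[OF that \<rho>(2)[OF that]] \<rho>(2)[OF that] w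
    by blast
  have SM: "?S N \<in> borel_measurable M" for N
    using fM[OF clamped_grid_range[OF T]] measurable_compose[OF \<rho>(1) w(1)]
    by (intro borel_measurable_sum borel_measurable_times) auto
  show fM': "(\<lambda>\<omega>. f (\<rho> \<omega>) \<omega>) \<in> borel_measurable M"
    by (rule borel_measurable_LIMSEQ_real[OF lim SM])
  have "(\<lambda>N. \<integral>\<omega>. ?S (Suc N) \<omega> \<partial>M) \<longlonglongrightarrow> (\<integral>\<omega>. f (\<rho> \<omega>) \<omega> \<partial>M)"
  proof (rule integral_dominated_convergence[where w = "\<lambda>_. B"])
    show "AE \<omega> in M. (\<lambda>N. ?S (Suc N) \<omega>) \<longlonglongrightarrow> f (\<rho> \<omega>) \<omega>"
      using LIMSEQ_Suc[OF lim] by (intro AE_I2)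
    show "AE \<omega> in M. norm (?S (Suc N) \<omega>) \<le> B" for N
    proof (rule AE_I2)
      fix \<omega> assume \<omega>: "\<omega> \<in> space M"
      have "norm (?S (Suc N) \<omega>) \<le> (\<Sum>j\<le>Suc N. norm (w (Suc N) j (\<rho> \<omega>) * f (clamped_grid T (Suc N) j) \<omega>))"
        by (rule norm_sum)
      also have "\<dots> \<le> (\<Sum>j\<le>Suc N. w (Suc N) j (\<rho> \<omega>) * B)"
        using B[OF \<omega> clamped_grid_range[OF T]] w(2)
        by (intro sum_mono) (simp add: abs_mult mult_left_mono)
      also have "\<dots> = B" using w(3)[OF _ \<rho>(2)[OF \<omega>], of "Suc N"] by (simp only: flip: sum_distrib_right)
      finally show "norm (?S (Suc N) \<omega>) \<le> B" .
    qed
  qed (use fM' SM[of "Suc _"] in \<open>simp_all del: sum.atMost_Suc\<close>)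
  then show "(\<lambda>N. \<integral>\<omega>. ?S N \<omega> \<partial>M) \<longlonglongrightarrow> (\<integral>\<omega>. f (\<rho> \<omega>) \<omega> \<partial>M)"
    by (rule filterlim_sequentially_Suc[THEN iffD1])
qed

lemma grid_index_measurable:
  assumes "0 < T" "0 < N"
  shows "(\<lambda>s. of_bool (grid_index T N s = j) :: real) \<in> borel_measurable borel"
proof -
  have eq: "(\<lambda>s. of_bool (grid_index T N s = j) :: real) = indicator {s. grid_index T N s = j}"
    by (auto simp: indicator_def)
  have le: "{s. grid_index T N s \<le> i} \<in> sets borel" for i
    using assms by (simp add: grid_index_le_iff)
  have "{s. grid_index T N s = j} = {s. grid_index T N s \<le> j} - (if j = 0 then {} else {s. grid_index T N s \<le> j - 1})"
    by auto
  also have "\<dots> \<in> sets borel"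
    by (intro sets.Diff le) (use le[of "j - 1"] in auto)
  finally show ?thesis unfolding eq by simp
qed

lemma grid_index_weights:
  assumes "0 < T"
  shows "(\<lambda>s. of_bool (0 < N \<and> grid_index T N s = j) :: real) \<in> borel_measurable borel"
    "0 < N \<Longrightarrow> s \<in> {0..T} \<Longrightarrow> (\<Sum>j\<le>N. of_bool (0 < N \<and> grid_index T N s = j)) = (1::real)"
    "0 < N \<Longrightarrow> s \<in> {0..T} \<Longrightarrow> of_bool (0 < N \<and> grid_index T N s = j) \<noteq> (0::real) \<Longrightarrow>
       s \<le> clamped_grid T N j \<and> clamped_grid T N j \<le> s + 2 * T / real N"
proof -
  show "(\<lambda>s. of_bool (0 < N \<and> grid_index T N s = j) :: real) \<in> borel_measurable borel"
    using grid_index_measurable[OF assms, of N j] by (cases "N = 0") auto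
next
  assume N: "0 < N" and s: "s \<in> {0..T}"
  have "(\<Sum>j\<le>N. of_bool (0 < N \<and> grid_index T N s = j)) = (\<Sum>j\<in>{grid_index T N s}. 1::real)"
    using N grid_index_le[OF assms N s] by (intro sum.mono_neutral_cong_right) auto
  then show "(\<Sum>j\<le>N. of_bool (0 < N \<and> grid_index T N s = j)) = (1::real)" by simp
next
  assume "0 < N" "s \<in> {0..T}" "of_bool (0 < N \<and> grid_index T N s = j) \<noteq> (0::real)"
  then show "s \<le> clamped_grid T N j \<and> clamped_grid T N j \<le> s + 2 * T / real N"
    using grid_index_clamped[OF assms, of N s] by (auto split: if_splits)
qed

lemma random_time_grid_limits:
  fixes f :: "real \<Rightarrow> 'a \<Rightarrow> real"
  assumes "prob_space M" and T: "0 < T"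
    and fM: "\<And>t. t \<in> {0..T} \<Longrightarrow> f t \<in> borel_measurable M"
    and rc: "\<And>\<omega> s. \<omega> \<in> space M \<Longrightarrow> s \<in> {0..T} \<Longrightarrow> continuous (at s within {s..T}) (\<lambda>t. f t \<omega>)"
    and B: "\<And>\<omega> t. \<omega> \<in> space M \<Longrightarrow> t \<in> {0..T} \<Longrightarrow> \<bar>f t \<omega>\<bar> \<le> B"
    and \<rho>: "\<rho> \<in> borel_measurable M" "\<And>\<omega>. \<omega> \<in> space M \<Longrightarrow> \<rho> \<omega> \<in> {0..T}"
  shows "(\<lambda>\<omega>. f (\<rho> \<omega>) \<omega>) \<in> borel_measurable M" (is ?meas)
    and "(\<lambda>N. \<integral>\<omega>. (\<Sum>j\<le>N. of_bool (0 < N \<and> grid_index T N (\<rho> \<omega>) = j) * f (clamped_grid T N j) \<omega>) \<partial>M)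
           \<longlonglongrightarrow> (\<integral>\<omega>. f (\<rho> \<omega>) \<omega> \<partial>M)" (is ?index)
    and "(\<lambda>N. \<integral>\<omega>. (\<Sum>j\<le>N. grid_hat T N j (\<rho> \<omega>) * f (clamped_grid T N j) \<omega>) \<partial>M)
           \<longlonglongrightarrow> (\<integral>\<omega>. f (\<rho> \<omega>) \<omega> \<partial>M)" (is ?hat)
proof -
  note weighted = weighted_random_time[where f = f and \<rho> = \<rho>, OF \<open>prob_space M\<close> T fM rc B \<rho>]
  have hat: "grid_hat T N j \<in> borel_measurable borel" for N j
    by (rule borel_measurable_continuous_onI[OF continuous_grid_hat[OF T]])
  show ?hat
    by (rule weighted(2)) (use T in \<open>simp_all add: hat grid_hat_range sum_grid_hat grid_hat_support\<close>)
  show ?meas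
    by (rule weighted(1)[where w = "grid_hat T"])
      (use T in \<open>simp_all add: hat grid_hat_range sum_grid_hat grid_hat_support\<close>)
  show ?index
  proof (rule weighted(2))
    fix N j :: nat and s
    show "(\<lambda>s. of_bool (0 < N \<and> grid_index T N s = j) :: real) \<in> borel_measurable borel"
      by (rule grid_index_weights(1)[OF T])
    show "(0::real) \<le> of_bool (0 < N \<and> grid_index T N s = j)" by simp
    assume N: "0 < N" "s \<in> {0..T}"
    show "(\<Sum>j\<le>N. of_bool (0 < N \<and> grid_index T N s = j)) = (1::real)"
      by (rule grid_index_weights(2)[OF T N])
    assume "of_bool (0 < N \<and> grid_index T N s = j) \<noteq> (0::real)"
    then show "s \<le> clamped_grid T N j \<and> clamped_grid T N j \<le> s + 2 * T / real N"
      by (rule grid_index_weights(3)[OF T N])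
  qed
qed

section \<open>Increments after a stopping time\<close>

text \<open>The natural filtration at the assigned grid time contains the filtration at the end of the cell.\<close>

lemma stopping_time_grid_event:
  assumes \<rho>: "\<rho> \<in> stopping_times M T (natural_filtration M Y)" and T: "0 < T" "0 < N" and j: "j \<le> N"
  shows "{\<omega>\<in>space M. grid_index T N (\<rho> \<omega>) = j} \<in> sets (natural_filtration M Y (clamped_grid T N j))"
proof -
  let ?F = "natural_filtration M Y"
  have le: "{\<omega>\<in>space M. grid_index T N (\<rho> \<omega>) \<le> i} \<in> sets (?F (clamped_grid T N j))" if "i \<le> j" for i
  proof -
    have "{\<omega>\<in>space (?F (T * real i / real N)). \<rho> \<omega> \<le> T * real i / real N} \<in> sets (?F (T * real i / real N))"
      using \<rho> unfolding stopping_times_def stopping_time_def pred_def by auto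
    moreover have "T * real i / real N \<le> clamped_grid T N j"
      using that j T by (auto simp: clamped_grid_def intro!: divide_right_mono mult_left_mono)
    ultimately show ?thesis
      using natural_filtration_mono[of "T * real i / real N" "clamped_grid T N j" M Y] T
      by (auto simp: grid_index_le_iff)
  qed
  have "{\<omega>\<in>space M. grid_index T N (\<rho> \<omega>) = j} =
      {\<omega>\<in>space M. grid_index T N (\<rho> \<omega>) \<le> j} - (if j = 0 then {} else {\<omega>\<in>space M. grid_index T N (\<rho> \<omega>) \<le> j - 1})"
    by auto
  also have "\<dots> \<in> sets (?F (clamped_grid T N j))"
    by (intro sets.Diff le) (use le[of "j - 1"] in auto)
  finally show ?thesis .
qed

lemma stopping_times_measurable:
  assumes F: "\<And>t. t \<le> T \<Longrightarrow> subalgebra M (F t)" and \<rho>: "\<rho> \<in> stopping_times M T F"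
  shows "\<rho> \<in> borel_measurable M"
proof (rule borel_measurable_iff_le[THEN iffD2, rule_format])
  fix c
  show "{\<omega>\<in>space M. \<rho> \<omega> \<le> c} \<in> sets M"
  proof (cases "c \<le> T")
    case True
    have "{\<omega>\<in>space (F c). \<rho> \<omega> \<le> c} \<in> sets (F c)"
      using \<rho> unfolding stopping_times_def stopping_time_def pred_def by auto
    then show ?thesis using F[OF True] by (auto simp: subalgebra_def)
  next
    case False
    then have "{\<omega>\<in>space M. \<rho> \<omega> \<le> c} = space M" using \<rho> by (force simp: stopping_times_def)
    then show ?thesis by simp
  qed
qed

text \<open>A bound for the increments up to \<open>t\<close> from fixed times passes to the increment from a stopping time \<open>\<rho>\<close>. After
rounding \<open>\<rho>\<close> up to a grid, each event on which the rounded time takes a given value is independent of the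
increment from this value to \<open>t\<close>, so the expectation factorizes there. Right-continuity removes the rounding.
The weight \<open>a\<close> restricts attention to values of \<open>\<rho>\<close> for which the bound is known.\<close>

lemma stopped_increment_bound:
  fixes a h :: "real \<Rightarrow> real"
  assumes "prob_space M" and T: "0 < T" and Y: "cadlag_process M T Y" and ind: "independent_increments M T Y"
    and \<rho>: "\<rho> \<in> stopping_times M T (natural_filtration M Y)" and t: "t \<in> {0..T}"
    and a: "continuous_on UNIV a" "\<And>s. 0 \<le> a s \<and> a s \<le> 1"
    and h: "continuous_on UNIV h" "\<And>x. 0 \<le> h x \<and> h x \<le> 1" "h 0 = 0"
    and w: "\<And>u. u \<in> {0..T} \<Longrightarrow> a u \<noteq> 0 \<Longrightarrow> u \<le> t \<and> (\<integral>\<omega>. h (Y t \<omega> - Y u \<omega>) \<partial>M) \<le> w"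
  shows "(\<integral>\<omega>. a (\<rho> \<omega>) * h (Y t \<omega> - Y (\<rho> \<omega>) \<omega>) \<partial>M) \<le> w * (\<integral>\<omega>. a (\<rho> \<omega>) \<partial>M)"
proof -
  interpret prob_space M by fact
  have \<rho>M: "\<rho> \<in> borel_measurable M"
    using natural_filtration_subalgebra[OF Y] \<rho> by (rule stopping_times_measurable)
  have \<rho>T: "\<rho> \<omega> \<in> {0..T}" if "\<omega> \<in> space M" for \<omega>
    using \<rho> that by (auto simp: stopping_times_def)
  have YM: "Y u \<in> borel_measurable M" if "u \<in> {0..T}" for u
    using Y that by (auto simp: cadlag_process_def)
  have hM: "(\<lambda>\<omega>. h (Y t \<omega> - Y u \<omega>)) \<in> borel_measurable M" if "u \<in> {0..T}" for u
    using YM[OF t] YM[OF that] borel_measurable_continuous_onI[OF h(1)]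
    by (intro measurable_compose[of _ M borel h]) auto
  let ?w = "\<lambda>N j s. of_bool (0 < N \<and> grid_index T N s = j) :: real"
  have ca: "continuous (at s within S) a" for s S
    using a(1) continuous_on_eq_continuous_at continuous_at_imp_continuous_at_within by blast
  have ch: "continuous (at s) h" for s
    using h(1) continuous_on_eq_continuous_at by blast
  have rcY: "continuous (at s within {s..T}) (\<lambda>u. Y u \<omega>)" if "\<omega> \<in> space M" "s \<in> {0..T}" for s \<omega>
    using Y that cadlag_on_right_continuous by (auto simp: cadlag_process_def)
  have lim1: "(\<lambda>N. \<integral>\<omega>. (\<Sum>j\<le>N. ?w N j (\<rho> \<omega>) * (a (clamped_grid T N j) * h (Y t \<omega> - Y (clamped_grid T N j) \<omega>))) \<partial>M)
      \<longlonglongrightarrow> (\<integral>\<omega>. a (\<rho> \<omega>) * h (Y t \<omega> - Y (\<rho> \<omega>) \<omega>) \<partial>M)"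
  proof (rule random_time_grid_limits(2)[where B=1 and f = "\<lambda>u \<omega>. a u * h (Y t \<omega> - Y u \<omega>)", OF \<open>prob_space M\<close> T])
    show "continuous (at s within {s..T}) (\<lambda>u. a u * h (Y t \<omega> - Y u \<omega>))" if "\<omega> \<in> space M" "s \<in> {0..T}" for \<omega> s
      by (intro continuous_intros ca continuous_within_compose3[OF ch] rcY that)
    show "\<bar>a u * h (Y t \<omega> - Y u \<omega>)\<bar> \<le> 1" for u \<omega>
      using a(2)[of u] h(2)[of "Y t \<omega> - Y u \<omega>"] by (auto simp: abs_mult intro!: mult_le_one)
    show "(\<lambda>\<omega>. a u * h (Y t \<omega> - Y u \<omega>)) \<in> borel_measurable M" if "u \<in> {0..T}" for u
      using hM[OF that] by simp
  qed (use \<rho>M \<rho>T in blast)+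
  have lim2: "(\<lambda>N. \<integral>\<omega>. (\<Sum>j\<le>N. ?w N j (\<rho> \<omega>) * a (clamped_grid T N j)) \<partial>M) \<longlonglongrightarrow> (\<integral>\<omega>. a (\<rho> \<omega>) \<partial>M)"
  proof (rule random_time_grid_limits(2)[where B=1 and f = "\<lambda>u \<omega>. a u", OF \<open>prob_space M\<close> T])
    show "\<bar>a u\<bar> \<le> 1" for u using a(2)[of u] by auto
    show "continuous (at s within {s..T}) a" for s by (rule ca)
  qed (use \<rho>M \<rho>T in auto)
  have "(\<integral>\<omega>. (\<Sum>j\<le>N. ?w N j (\<rho> \<omega>) * (a (clamped_grid T N j) * h (Y t \<omega> - Y (clamped_grid T N j) \<omega>))) \<partial>M)
      \<le> w * (\<integral>\<omega>. (\<Sum>j\<le>N. ?w N j (\<rho> \<omega>) * a (clamped_grid T N j)) \<partial>M)" if N: "0 < N" for N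
  proof -
    let ?c = "clamped_grid T N" and ?E = "\<lambda>j. {\<omega>\<in>space M. grid_index T N (\<rho> \<omega>) = j}"
    note cr = clamped_grid_range[OF T, of N]
    have E: "?E j \<in> sets (natural_filtration M Y (?c j))" if "j \<le> N" for j
      by (rule stopping_time_grid_event[OF \<rho> T N that])
    have EM: "?E j \<in> events" if "j \<le> N" for j
      using E[OF that] natural_filtration_subalgebra[OF Y, of "?c j"] cr[of j] by (auto simp: subalgebra_def)
    have ind_eq: "?w N j (\<rho> \<omega>) = indicator (?E j) \<omega>" if "\<omega> \<in> space M" for j \<omega>
      using that N by (auto simp: indicator_def)
    have int1: "integrable M (\<lambda>\<omega>. indicator (?E j) \<omega> * h (Y t \<omega> - Y (?c j) \<omega>))" if "j \<le> N" for j
    proof (rule integrable_const_bound[of _ 1])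
      show "AE \<omega> in M. norm (indicator (?E j) \<omega> * h (Y t \<omega> - Y (?c j) \<omega>)) \<le> 1"
        using h(2) by (auto simp: indicator_def abs_mult)
      show "(\<lambda>\<omega>. indicator (?E j) \<omega> * h (Y t \<omega> - Y (?c j) \<omega>)) \<in> borel_measurable M"
        using EM[OF that] hM[OF cr] by (intro borel_measurable_times borel_measurable_indicator)
    qed
    have int2: "integrable M (indicat_real (?E j))" if "j \<le> N" for j
      using EM[OF that] by (intro integrable_indicator_event) auto
    have "(\<integral>\<omega>. (\<Sum>j\<le>N. ?w N j (\<rho> \<omega>) * (a (?c j) * h (Y t \<omega> - Y (?c j) \<omega>))) \<partial>M)
        = (\<integral>\<omega>. (\<Sum>j\<le>N. a (?c j) * (indicator (?E j) \<omega> * h (Y t \<omega> - Y (?c j) \<omega>))) \<partial>M)"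
      using ind_eq by (intro Bochner_Integration.integral_cong refl sum.cong) simp_all
    also have "\<dots> = (\<Sum>j\<le>N. a (?c j) * (\<integral>\<omega>. indicator (?E j) \<omega> * h (Y t \<omega> - Y (?c j) \<omega>) \<partial>M))"
      using int1 by (subst Bochner_Integration.integral_sum) auto
    also have "\<dots> \<le> (\<Sum>j\<le>N. a (?c j) * (w * (\<integral>\<omega>. indicator (?E j) \<omega> \<partial>M)))"
    proof (rule sum_mono)
      fix j assume j: "j \<in> {..N}"
      show "a (?c j) * (\<integral>\<omega>. indicator (?E j) \<omega> * h (Y t \<omega> - Y (?c j) \<omega>) \<partial>M) \<le> a (?c j) * (w * (\<integral>\<omega>. indicator (?E j) \<omega> \<partial>M))"
      proof (cases "a (?c j) = 0")
        case False
        note w' = w[OF cr False]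
        have "(\<integral>\<omega>. indicator (?E j) \<omega> * h (Y t \<omega> - Y (?c j) \<omega>) \<partial>M)
            = (\<integral>\<omega>. indicator (?E j) \<omega> \<partial>M) * (\<integral>\<omega>. h (Y t \<omega> - Y (?c j) \<omega>) \<partial>M)"
        proof (cases "?c j = t")
          case True then show ?thesis using h(3) by simp
        next
          case False
          then have lt: "?c j < t" using w' by simp
          let ?V = "vimage_algebra (space M) (\<lambda>\<omega>. Y t \<omega> - Y (?c j) \<omega>) borel"
          have "indep_set (sets (natural_filtration M Y (?c j))) (sets ?V)"
            using ind lt cr[of j] t unfolding independent_increments_def by auto
          then show ?thesis
          proof (rule indep_set_integral_mult)
            show "(\<lambda>\<omega>. h (Y t \<omega> - Y (?c j) \<omega>)) \<in> borel_measurable ?V"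
              using borel_measurable_continuous_onI[OF h(1)]
              by (intro measurable_compose[OF measurable_vimage_algebra1]) auto
            show "integrable M (\<lambda>\<omega>. h (Y t \<omega> - Y (?c j) \<omega>))"
              using hM[OF cr] h(2) by (intro integrable_const_bound[of _ 1]) auto
          qed (use E[of j] int2[of j] j in auto)
        qed
        also have "\<dots> \<le> (\<integral>\<omega>. indicator (?E j) \<omega> \<partial>M) * w"
          using w' by (intro mult_left_mono integral_nonneg) auto
        finally show ?thesis using a(2) by (intro mult_left_mono) (auto simp: mult.commute)
      qed simp
    qed
    also have "\<dots> = w * (\<Sum>j\<le>N. a (?c j) * (\<integral>\<omega>. indicator (?E j) \<omega> \<partial>M))"
      by (simp add: sum_distrib_left mult.left_commute)
    also have "(\<Sum>j\<le>N. a (?c j) * (\<integral>\<omega>. indicator (?E j) \<omega> \<partial>M)) = (\<integral>\<omega>. (\<Sum>j\<le>N. a (?c j) * indicator (?E j) \<omega>) \<partial>M)"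
      using int2 by (subst Bochner_Integration.integral_sum) auto
    also have "\<dots> = (\<integral>\<omega>. (\<Sum>j\<le>N. ?w N j (\<rho> \<omega>) * a (?c j)) \<partial>M)"
      using ind_eq by (intro Bochner_Integration.integral_cong refl sum.cong) simp_all
    finally show ?thesis .
  qed
  then show ?thesis
    by (intro LIMSEQ_le[OF lim1 tendsto_mult_left[OF lim2]]) (auto intro!: exI[of _ 1])
qed

section \<open>Convergence in law and events of continuity\<close>

lemma eventually_skorokhod_nhds:
  assumes "x \<in> skorokhod_space T"
  shows "eventually P (nhdsin (skorokhod_topology T) x) \<longleftrightarrow>
    (\<exists>\<delta>>0. \<forall>y\<in>skorokhod_space T. skorokhod_dist T x y < \<delta> \<longrightarrow> P y)"
proof
  assume "eventually P (nhdsin (skorokhod_topology T) x)"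
  then obtain S where S: "openin (Skorokhod.mtopology T) S" "x \<in> S" "\<forall>y\<in>S. P y"
    using assms by (auto simp: eventually_nhdsin skorokhod_topology_def)
  then obtain r where "0 < r" "Skorokhod.mball T x r \<subseteq> S"
    unfolding Skorokhod.openin_mtopology by blast
  then show "\<exists>\<delta>>0. \<forall>y\<in>skorokhod_space T. skorokhod_dist T x y < \<delta> \<longrightarrow> P y"
    using S assms by (intro exI[of _ r]) (auto simp: subset_iff Skorokhod.in_mball)
next
  assume "\<exists>\<delta>>0. \<forall>y\<in>skorokhod_space T. skorokhod_dist T x y < \<delta> \<longrightarrow> P y"
  then obtain r where "0 < r" "\<forall>y\<in>skorokhod_space T. skorokhod_dist T x y < r \<longrightarrow> P y" by blast
  then show "eventually P (nhdsin (skorokhod_topology T) x)"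
    unfolding eventually_nhdsin skorokhod_topology_def using assms
    by (intro disjI2 exI[of _ "Skorokhod.mball T x r"]) (auto simp: Skorokhod.in_mball)
qed

text \<open>The absence of fixed jumps makes evaluation at every deterministic time continuous at almost every path of the limit.\<close>

locale skorokhod_law_limit = prob_space M for M :: "'a measure" +
  fixes T :: real and Y :: "nat \<Rightarrow> real \<Rightarrow> 'a \<Rightarrow> real" and X :: "real \<Rightarrow> 'a \<Rightarrow> real"
    and \<rho> :: "nat \<Rightarrow> 'a \<Rightarrow> real" and \<tau> :: "'a \<Rightarrow> real"
  assumes T_pos: "0 < T"
    and cadlag_Y: "\<And>k. cadlag_process M T (Y k)" and cadlag_X: "cadlag_process M T X"
    and no_fixed_jump: "\<And>t. t \<in> {0..T} \<Longrightarrow> AE \<omega> in M. continuous (at t within {0..T}) (\<lambda>s. X s \<omega>)"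
    and conv: "converges_in_law M (prod_topology (skorokhod_topology T) euclideanreal)
      (\<lambda>k \<omega>. (sample_path T (Y k) \<omega>, \<rho> k \<omega>)) (\<lambda>\<omega>. (sample_path T X \<omega>, \<tau> \<omega>))"
begin

abbreviation "Xpath \<omega> \<equiv> sample_path T X \<omega>"
abbreviation "Ypath k \<omega> \<equiv> sample_path T (Y k) \<omega>"
abbreviation "path_nhds \<equiv> nhdsin (skorokhod_topology T)"
abbreviation "past t Z \<equiv> natural_filtration M Z t"
abbreviation "future t Z \<equiv> increments_after M T Z t UNIV"
abbreviation "grid \<equiv> clamped_grid T"
abbreviation "hat \<equiv> grid_hat T"

lemma Y_measurable: "t \<in> {0..T} \<Longrightarrow> Y k t \<in> borel_measurable M"
  and X_measurable: "t \<in> {0..T} \<Longrightarrow> X t \<in> borel_measurable M"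
  using cadlag_Y cadlag_X by (auto simp: cadlag_process_def)

lemma pair_measurable:
  "(\<lambda>\<omega>. (Ypath k \<omega>, \<rho> k \<omega>)) \<in> M \<rightarrow>\<^sub>M borel_of (prod_topology (skorokhod_topology T) euclideanreal)"
    "(\<lambda>\<omega>. (Xpath \<omega>, \<tau> \<omega>)) \<in> M \<rightarrow>\<^sub>M borel_of (prod_topology (skorokhod_topology T) euclideanreal)"
  using conv by (auto simp: converges_in_law_def)

lemma path_in_skorokhod_space:
  assumes "\<omega> \<in> space M"
  shows "Ypath k \<omega> \<in> skorokhod_space T" "Xpath \<omega> \<in> skorokhod_space T"
  using pair_measurable[THEN measurable_space, OF assms]
  by (auto simp: space_borel_of skorokhod_topology_def)

text \<open>Continuity is only required at the paths of the limit \<open>X\<close>, and there almost surely.\<close>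

definition ae_continuous :: "((real \<Rightarrow> real) \<Rightarrow> real) \<Rightarrow> bool" where
  "ae_continuous g \<longleftrightarrow> (AE \<omega> in M. (g \<longlongrightarrow> g (Xpath \<omega>)) (path_nhds (Xpath \<omega>)))"

lemma ae_continuous_eval:
  assumes t: "t \<in> {0..T}"
  shows "ae_continuous (\<lambda>y. y t)"
  unfolding ae_continuous_def using no_fixed_jump[OF t] AE_space
proof eventually_elim
  case (elim \<omega>)
  let ?x = "Xpath \<omega>"
  have x: "?x \<in> skorokhod_space T" using elim by (simp add: path_in_skorokhod_space)
  have c: "continuous (at t within {0..T}) ?x"
    using elim(1) t by (simp add: continuous_within_eps_delta sample_path_def)
  show ?case
  proof (rule tendstoI)
    fix e :: real assume "0 < e"
    from skorokhod_eval_near[OF x c this] obtain \<delta> where "0 < \<delta>"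
      "\<And>y s. y \<in> skorokhod_space T \<Longrightarrow> skorokhod_dist T ?x y < \<delta> \<Longrightarrow> s \<in> {0..T} \<Longrightarrow> \<bar>s - t\<bar> \<le> \<delta> \<Longrightarrow> \<bar>y s - ?x t\<bar> < e"
      by blast
    then show "eventually (\<lambda>y. dist (y t) (?x t) < e) (path_nhds ?x)"
      unfolding eventually_skorokhod_nhds[OF x] dist_real_def using t by (intro exI[of _ \<delta>]) auto
  qed
qed

text \<open>The constant sequence of functionals in \<open>portmanteau_upper\<close>, with \<open>f\<close> as its own limit.\<close>

lemma limsup_weighted_functional:
  assumes a: "continuous_on UNIV a" "\<And>s. 0 \<le> a s \<and> a s \<le> 1"
    and f: "ae_continuous f" "\<And>y. y \<in> skorokhod_space T \<Longrightarrow> 0 \<le> f y \<and> f y \<le> 1"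
    and meas: "\<And>k. (\<lambda>\<omega>. f (Ypath k \<omega>)) \<in> borel_measurable M"
      "(\<lambda>\<omega>. f (Xpath \<omega>)) \<in> borel_measurable M"
    and "0 < \<eta>"
  shows "eventually (\<lambda>k. (\<integral>\<omega>. a (\<rho> k \<omega>) * f (Ypath k \<omega>) \<partial>M)
    \<le> (\<integral>\<omega>. a (\<tau> \<omega>) * f (Xpath \<omega>) \<partial>M) + \<eta>) sequentially"
proof -
  have lim: "AE \<omega> in M. \<forall>\<epsilon>>0. \<exists>m0. \<forall>m\<ge>m0. \<forall>y\<in>skorokhod_space T.
      skorokhod_dist T (Xpath \<omega>) y < 1 / real (Suc m) \<longrightarrow> f y \<le> f (Xpath \<omega>) + \<epsilon>"
    using f(1)[unfolded ae_continuous_def] AE_space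
  proof eventually_elim
    case (elim \<omega>)
    let ?x = "Xpath \<omega>"
    have x: "?x \<in> skorokhod_space T" using elim by (simp add: path_in_skorokhod_space)
    show ?case
    proof (intro allI impI)
      fix \<epsilon> :: real assume "0 < \<epsilon>"
      then have "eventually (\<lambda>y. dist (f y) (f ?x) < \<epsilon>) (path_nhds ?x)"
        using elim(1) by (rule tendstoD[rotated])
      then obtain \<delta> where \<delta>: "0 < \<delta>" "\<And>y. y \<in> skorokhod_space T \<Longrightarrow> skorokhod_dist T ?x y < \<delta> \<Longrightarrow> dist (f y) (f ?x) < \<epsilon>"
        unfolding eventually_skorokhod_nhds[OF x] by blast
      obtain m0 where m0: "1 / real (Suc m0) < \<delta>" using \<delta>(1) nat_approx_posE by blast
      have "1 / real (Suc m) < \<delta>" if "m \<ge> m0" for m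
        using that by (intro order_le_less_trans[OF _ m0] divide_left_mono) auto
      then show "\<exists>m0. \<forall>m\<ge>m0. \<forall>y\<in>skorokhod_space T. skorokhod_dist T ?x y < 1 / real (Suc m) \<longrightarrow> f y \<le> f ?x + \<epsilon>"
        using \<delta>(2) by (intro exI[of _ m0]) (fastforce simp: dist_real_def)
    qed
  qed
  have "\<exists>m::nat. eventually (\<lambda>k. \<forall>f'\<in>borel_measurable M. (\<forall>\<omega>\<in>space M. 0 \<le> f' \<omega> \<and> f' \<omega> \<le> f (Ypath k \<omega>)) \<longrightarrow>
      (\<integral>\<omega>. a (\<rho> k \<omega>) * f' \<omega> \<partial>M) \<le> (\<integral>\<omega>. a (\<tau> \<omega>) * f (Xpath \<omega>) \<partial>M) + \<eta>) sequentially"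
    by (rule Skorokhod.portmanteau_upper[OF prob_space_axioms conv[unfolded skorokhod_topology_def] a _ meas(2) _ lim \<open>0 < \<eta>\<close>])
      (use f(2) path_in_skorokhod_space(2) in auto)
  then have "eventually (\<lambda>k. \<forall>f'\<in>borel_measurable M. (\<forall>\<omega>\<in>space M. 0 \<le> f' \<omega> \<and> f' \<omega> \<le> f (Ypath k \<omega>)) \<longrightarrow>
      (\<integral>\<omega>. a (\<rho> k \<omega>) * f' \<omega> \<partial>M) \<le> (\<integral>\<omega>. a (\<tau> \<omega>) * f (Xpath \<omega>) \<partial>M) + \<eta>) sequentially"
    by blast
  then show ?thesis
  proof eventually_elim
    case (elim k)
    show ?case
      by (rule elim[rule_format, OF meas(1)]) (use f(2) path_in_skorokhod_space(1) in auto)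
  qed
qed

lemma weight_measurable:
  assumes a: "continuous_on UNIV (a :: real \<Rightarrow> real)"
  shows "(\<lambda>\<omega>. a (\<rho> k \<omega>)) \<in> borel_measurable M" "(\<lambda>\<omega>. a (\<tau> \<omega>)) \<in> borel_measurable M"
proof -
  have "continuous_map (prod_topology (skorokhod_topology T) euclideanreal) euclideanreal (\<lambda>z. a (snd z))"
    using continuous_map_compose[OF continuous_map_snd, of euclideanreal euclideanreal a] a by (simp add: o_def)
  note m = continuous_map_borel_of_measurable[OF this]
  show "(\<lambda>\<omega>. a (\<rho> k \<omega>)) \<in> borel_measurable M" "(\<lambda>\<omega>. a (\<tau> \<omega>)) \<in> borel_measurable M"
    using measurable_compose[OF pair_measurable(1) m] measurable_compose[OF pair_measurable(2) m] by simp_all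
qed

lemma weight_limit:
  assumes a: "continuous_on UNIV (a :: real \<Rightarrow> real)" "\<And>s. \<bar>a s\<bar> \<le> 1"
  shows "(\<lambda>k. \<integral>\<omega>. a (\<rho> k \<omega>) \<partial>M) \<longlonglongrightarrow> (\<integral>\<omega>. a (\<tau> \<omega>) \<partial>M)"
proof -
  let ?g = "\<lambda>z::(real \<Rightarrow> real) \<times> real. a (snd z)"
  have "continuous_map (prod_topology (skorokhod_topology T) euclideanreal) euclideanreal ?g"
    using continuous_map_compose[OF continuous_map_snd, of euclideanreal euclideanreal a] a by (simp add: o_def)
  moreover have "bounded (?g ` topspace (prod_topology (skorokhod_topology T) euclideanreal))"
    using a(2) by (intro boundedI[of _ 1]) auto
  ultimately have "(\<lambda>k. \<integral>\<omega>. ?g (Ypath k \<omega>, \<rho> k \<omega>) \<partial>M) \<longlonglongrightarrow> (\<integral>\<omega>. ?g (Xpath \<omega>, \<tau> \<omega>) \<partial>M)"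
    using conv unfolding converges_in_law_def by blast
  then show ?thesis by simp
qed

text \<open>After rescaling to values in the unit interval, the upper bound applied to \<open>f\<close> and to \<open>1 - f\<close> gives both inequalities.\<close>

lemma weighted_functional_limit:
  assumes a: "continuous_on UNIV a" "\<And>s. 0 \<le> a s \<and> a s \<le> 1"
    and g: "ae_continuous g" "\<And>y. y \<in> skorokhod_space T \<Longrightarrow> \<bar>g y\<bar> \<le> B"
    and meas: "\<And>k. (\<lambda>\<omega>. g (Ypath k \<omega>)) \<in> borel_measurable M"
      "(\<lambda>\<omega>. g (Xpath \<omega>)) \<in> borel_measurable M"
  shows "(\<lambda>k. \<integral>\<omega>. a (\<rho> k \<omega>) * g (Ypath k \<omega>) \<partial>M) \<longlonglongrightarrow> (\<integral>\<omega>. a (\<tau> \<omega>) * g (Xpath \<omega>) \<partial>M)"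
proof -
  have ab: "\<bar>a s\<bar> \<le> 1" for s using a(2)[of s] by auto
  \<comment> \<open>the shift and the scale that bring a function bounded by \<open>B\<close> into the unit interval\<close>
  define C where "C = \<bar>B\<bar> + 1"
  have C: "0 < C" by (simp add: C_def)
  define f where "f y = (g y + C) / (2 * C)" for y
  have fr: "0 \<le> f y \<and> f y \<le> 1" if "y \<in> skorokhod_space T" for y
    using g(2)[OF that] C by (auto simp: f_def C_def field_simps)
  have fc: "ae_continuous f"
    using g(1) unfolding ae_continuous_def f_def by eventually_elim (use C in \<open>auto intro!: tendsto_intros\<close>)
  have f'c: "ae_continuous (\<lambda>y. 1 - f y)"
    using fc unfolding ae_continuous_def by eventually_elim (intro tendsto_intros)
  have fm: "(\<lambda>\<omega>. f (Ypath k \<omega>)) \<in> borel_measurable M" "(\<lambda>\<omega>. f (Xpath \<omega>)) \<in> borel_measurable M" for k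
    using meas by (auto simp: f_def)
  note am = weight_measurable[OF a(1)]
  have int: "integrable M (\<lambda>\<omega>. a (\<rho> k \<omega>) * f (Ypath k \<omega>))" "integrable M (\<lambda>\<omega>. a (\<rho> k \<omega>))"
    "integrable M (\<lambda>\<omega>. a (\<tau> \<omega>) * f (Xpath \<omega>))" "integrable M (\<lambda>\<omega>. a (\<tau> \<omega>))" for k
    using am fm a(2) fr path_in_skorokhod_space
    by (auto intro!: integrable_const_bound[of _ 1] AE_I2 mult_le_one simp: abs_mult)
  have fl: "(\<lambda>k. \<integral>\<omega>. a (\<rho> k \<omega>) * f (Ypath k \<omega>) \<partial>M) \<longlonglongrightarrow> (\<integral>\<omega>. a (\<tau> \<omega>) * f (Xpath \<omega>) \<partial>M)"
  proof (rule tendstoI)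
    fix e :: real assume "0 < e"
    then have e: "0 < e / 3" by simp
    have al: "(\<lambda>k. \<integral>\<omega>. a (\<rho> k \<omega>) \<partial>M) \<longlonglongrightarrow> (\<integral>\<omega>. a (\<tau> \<omega>) \<partial>M)"
      by (rule weight_limit[OF a(1) ab])
    have "eventually (\<lambda>k. (\<integral>\<omega>. a (\<rho> k \<omega>) * f (Ypath k \<omega>) \<partial>M)
        \<le> (\<integral>\<omega>. a (\<tau> \<omega>) * f (Xpath \<omega>) \<partial>M) + e / 3) sequentially"
      by (rule limsup_weighted_functional[OF a fc fr fm e])
    moreover have "eventually (\<lambda>k. (\<integral>\<omega>. a (\<rho> k \<omega>) * (1 - f (Ypath k \<omega>)) \<partial>M)
        \<le> (\<integral>\<omega>. a (\<tau> \<omega>) * (1 - f (Xpath \<omega>)) \<partial>M) + e / 3) sequentially"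
      using fr by (intro limsup_weighted_functional[OF a f'c _ _ _ e] borel_measurable_diff fm) auto
    moreover have "eventually (\<lambda>k. dist (\<integral>\<omega>. a (\<rho> k \<omega>) \<partial>M) (\<integral>\<omega>. a (\<tau> \<omega>) \<partial>M) < e / 3) sequentially"
      by (rule tendstoD[OF al e])
    ultimately show "eventually (\<lambda>k. dist (\<integral>\<omega>. a (\<rho> k \<omega>) * f (Ypath k \<omega>) \<partial>M)
        (\<integral>\<omega>. a (\<tau> \<omega>) * f (Xpath \<omega>) \<partial>M) < e) sequentially"
    proof eventually_elim
      case (elim k)
      have "(\<integral>\<omega>. a (\<rho> k \<omega>) * (1 - f (Ypath k \<omega>)) \<partial>M)
          = (\<integral>\<omega>. a (\<rho> k \<omega>) \<partial>M) - (\<integral>\<omega>. a (\<rho> k \<omega>) * f (Ypath k \<omega>) \<partial>M)"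
        "(\<integral>\<omega>. a (\<tau> \<omega>) * (1 - f (Xpath \<omega>)) \<partial>M)
          = (\<integral>\<omega>. a (\<tau> \<omega>) \<partial>M) - (\<integral>\<omega>. a (\<tau> \<omega>) * f (Xpath \<omega>) \<partial>M)"
        using int by (simp_all add: algebra_simps)
      then show ?case using elim unfolding dist_real_def by linarith
    qed
  qed
  have ge: "g y = 2 * C * f y - C" for y using C by (simp add: f_def)
  have lin: "(\<integral>\<omega>. u \<omega> * (2 * C * v \<omega> - C) \<partial>M) = 2 * C * (\<integral>\<omega>. u \<omega> * v \<omega> \<partial>M) - C * (\<integral>\<omega>. u \<omega> \<partial>M)"
    if "integrable M (\<lambda>\<omega>. u \<omega> * v \<omega>)" "integrable M u" for u v :: "'a \<Rightarrow> real"
  proof -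
    have "(\<lambda>\<omega>. u \<omega> * (2 * C * v \<omega> - C)) = (\<lambda>\<omega>. 2 * C * (u \<omega> * v \<omega>) - C * u \<omega>)"
      by (auto simp: algebra_simps)
    then show ?thesis using that by simp
  qed
  show ?thesis
    unfolding ge lin[OF int(1,2)] lin[OF int(3,4)]
    by (intro tendsto_intros fl weight_limit[OF a(1) ab])
qed

definition path_event :: "(real \<Rightarrow> 'a \<Rightarrow> real) \<Rightarrow> (real \<Rightarrow> real) set \<Rightarrow> 'a set" where
  "path_event Z S = {\<omega>\<in>space M. sample_path T Z \<omega> \<in> S}"

text \<open>Sets of paths, rather than events, because one set has to be read off the limit and off each approximating process. The argument
\<open>\<G>\<close> says which part of a process the set may look at, for example its past or its increments after a given time.\<close>

definition continuity_event :: "((real \<Rightarrow> 'a \<Rightarrow> real) \<Rightarrow> 'a measure) \<Rightarrow> (real \<Rightarrow> real) set \<Rightarrow> bool" where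
  "continuity_event \<G> S \<longleftrightarrow> (\<forall>Z. path_event Z S \<in> sets (\<G> Z)) \<and> ae_continuous (\<lambda>y. of_bool (y \<in> S))"

lemma continuity_event_Compl:
  assumes "\<And>Z. space (\<G> Z) = space M" "continuity_event \<G> S"
  shows "continuity_event \<G> (- S)"
proof -
  have "path_event Z (- S) = space M - path_event Z S" for Z by (auto simp: path_event_def)
  moreover have "ae_continuous (\<lambda>y. of_bool (y \<in> - S))"
  proof -
    have "ae_continuous (\<lambda>y. of_bool (y \<in> S))" using assms(2) by (simp add: continuity_event_def)
    then show ?thesis
      unfolding ae_continuous_def by eventually_elim (simp add: of_bool_not_iff tendsto_diff)
  qed
  ultimately show ?thesis
    using assms sets.Diff[OF sets.top] unfolding continuity_event_def by metis
qed

lemma ae_continuous_of_bool_Int: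
  assumes "ae_continuous (\<lambda>y. of_bool (y \<in> S))" "ae_continuous (\<lambda>y. of_bool (y \<in> S'))"
  shows "ae_continuous (\<lambda>y. of_bool (y \<in> S \<inter> S'))"
proof -
  have "AE \<omega> in M. ((\<lambda>y. of_bool (y \<in> S) * of_bool (y \<in> S')) \<longlongrightarrow>
      (of_bool (Xpath \<omega> \<in> S) * of_bool (Xpath \<omega> \<in> S') :: real)) (path_nhds (Xpath \<omega>))"
    using assms[unfolded ae_continuous_def] by eventually_elim (intro tendsto_intros)
  then show ?thesis by (simp add: ae_continuous_def of_bool_conj)
qed

lemma continuity_event_Int:
  assumes "continuity_event \<G> S" "continuity_event \<G> S'"
  shows "continuity_event \<G> (S \<inter> S')"
proof -
  have "path_event Z (S \<inter> S') = path_event Z S \<inter> path_event Z S'" for Z by (auto simp: path_event_def)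
  then show ?thesis
    using assms ae_continuous_of_bool_Int unfolding continuity_event_def by auto
qed

lemma continuity_event_UNIV:
  assumes "\<And>Z. space (\<G> Z) = space M"
  shows "continuity_event \<G> UNIV"
proof -
  have "path_event Z UNIV = space (\<G> Z)" for Z by (simp add: path_event_def assms)
  then show ?thesis by (simp add: continuity_event_def ae_continuous_def)
qed

lemma continuity_event_algebra:
  assumes sp: "\<And>Z. space (\<G> Z) = space M"
  shows "algebra (space M) {path_event X S |S. continuity_event \<G> S}"
proof (rule algebra_iff_Int[THEN iffD2], intro conjI ballI)
  show "{path_event X S |S. continuity_event \<G> S} \<subseteq> Pow (space M)" by (auto simp: path_event_def)
  have "path_event X (- UNIV) = {}" by (simp add: path_event_def)
  then show "{} \<in> {path_event X S |S. continuity_event \<G> S}"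
    using continuity_event_Compl[of \<G> UNIV] continuity_event_UNIV[of \<G>] sp by blast
  fix a assume "a \<in> {path_event X S |S. continuity_event \<G> S}"
  then obtain S where S: "a = path_event X S" "continuity_event \<G> S" by blast
  have "space M - a = path_event X (- S)" by (auto simp: S path_event_def)
  then show "space M - a \<in> {path_event X S |S. continuity_event \<G> S}"
    using continuity_event_Compl[OF sp S(2)] by blast
  fix b assume "b \<in> {path_event X S |S. continuity_event \<G> S}"
  then obtain S' where S': "b = path_event X S'" "continuity_event \<G> S'" by blast
  have "a \<inter> b = path_event X (S \<inter> S')" by (auto simp: S S' path_event_def)
  then show "a \<inter> b \<in> {path_event X S |S. continuity_event \<G> S}"
    using continuity_event_Int[OF S(2) S'(2)] by blast
qed

text \<open>Where the functional differs from the threshold \<open>r\<close>, its comparison with \<open>r\<close> does not change under small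
perturbations of the path.\<close>

lemma continuity_event_threshold:
  assumes sp: "\<And>Z. space (\<G> Z) = space M"
    and c: "\<And>Z. (\<lambda>\<omega>. c (sample_path T Z \<omega>)) \<in> borel_measurable (\<G> Z)" "ae_continuous c"
    and r: "AE \<omega> in M. c (Xpath \<omega>) \<noteq> r"
  shows "continuity_event \<G> {y. c y \<le> r}"
  unfolding continuity_event_def
proof (intro conjI allI)
  fix Z
  have "path_event Z {y. c y \<le> r} = {\<omega>\<in>space (\<G> Z). c (sample_path T Z \<omega>) \<le> r}"
    by (auto simp: path_event_def sp)
  then show "path_event Z {y. c y \<le> r} \<in> sets (\<G> Z)"
    using borel_measurable_iff_le[THEN iffD1, rule_format, OF c(1)[of Z]] by simp
next
  show "ae_continuous (\<lambda>y. of_bool (y \<in> {y. c y \<le> r}))"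
    unfolding ae_continuous_def using c(2)[unfolded ae_continuous_def] r
  proof eventually_elim
    case (elim \<omega>)
    let ?x = "Xpath \<omega>"
    have "eventually (\<lambda>y. of_bool (y \<in> {y. c y \<le> r}) = (of_bool (?x \<in> {y. c y \<le> r}) :: real)) (path_nhds ?x)"
    proof (cases "c ?x < r")
      case True
      show ?thesis
        by (rule eventually_mono[OF order_tendstoD(2)[OF elim(1) True]]) (use True in simp)
    next
      case False
      then have "r < c ?x" using elim(2) by simp
      then show ?thesis
        by (intro eventually_mono[OF order_tendstoD(1)[OF elim(1)]]) auto
    qed
    then show ?case by (rule tendsto_eventually)
  qed
qed

text \<open>All but countably many thresholds are no atoms of the functional, and thresholds \<open>q n\<close> of this kind
decreasing to \<open>r\<close> determine the level set at \<open>r\<close>.\<close>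

lemma continuity_events_generate:
  assumes sp: "\<And>Z. space (\<G> Z) = space M"
    and c: "\<And>Z. (\<lambda>\<omega>. c (sample_path T Z \<omega>)) \<in> borel_measurable (\<G> Z)" "ae_continuous c"
    and cX: "(\<lambda>\<omega>. c (Xpath \<omega>)) \<in> borel_measurable M"
  shows "(\<lambda>\<omega>. c (Xpath \<omega>)) \<in> borel_measurable (sigma (space M) {path_event X S |S. continuity_event \<G> S})"
    (is "?C \<in> borel_measurable ?N")
proof (rule borel_measurable_iff_le[THEN iffD2, rule_format])
  fix r :: real
  have sub: "{path_event X S |S. continuity_event \<G> S} \<subseteq> Pow (space M)" by (auto simp: path_event_def)
  have setsN: "sets ?N = sigma_sets (space M) {path_event X S |S. continuity_event \<G> S}" "space ?N = space M"
    using sub by simp_all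
  interpret D: prob_space "distr M borel ?C" by (rule prob_space_distr[OF cX])
  have "\<exists>q. r < q \<and> q < r + 1 / real (Suc n) \<and> measure (distr M borel ?C) {q} = 0" for n
  proof -
    have "uncountable {r<..<r + 1 / real (Suc n)}" by (simp add: uncountable_open_interval)
    then have "\<not> {r<..<r + 1 / real (Suc n)} \<subseteq> {q. measure (distr M borel ?C) {q} \<noteq> 0}"
      using D.countable_support countable_subset by blast
    then show ?thesis by auto
  qed
  then obtain q where q: "\<And>n. r < q n" "\<And>n. q n < r + 1 / real (Suc n)" "\<And>n. measure (distr M borel ?C) {q n} = 0"
    by metis
  have "AE \<omega> in M. ?C \<omega> \<noteq> q n" for n
  proof -
    have "AE z in distr M borel ?C. z \<noteq> q n"
      using q(3)[of n] by (intro AE_I[of _ _ "{q n}"]) (auto simp: D.emeasure_eq_measure)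
    then show ?thesis by (subst (asm) AE_distr_iff) (use cX in auto)
  qed
  then have "continuity_event \<G> {y. c y \<le> q n}" for n by (intro continuity_event_threshold sp c)
  then have "path_event X {y. c y \<le> q n} \<in> sets ?N" for n unfolding setsN by (intro sigma_sets.Basic) blast
  then have "(\<Inter>n. path_event X {y. c y \<le> q n}) \<in> sets ?N" by auto
  moreover have "(\<Inter>n. path_event X {y. c y \<le> q n}) = {\<omega>\<in>space M. ?C \<omega> \<le> r}"
  proof (intro set_eqI iffI)
    fix \<omega> assume \<omega>: "\<omega> \<in> (\<Inter>n. path_event X {y. c y \<le> q n})"
    have "?C \<omega> \<le> r + e" if "0 < e" for e
    proof -
      obtain n where "1 / real (Suc n) < e" using reals_Archimedean[OF \<open>0 < e\<close>] by (auto simp: inverse_eq_divide)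
      moreover have "?C \<omega> \<le> q n" using \<omega> by (simp add: path_event_def)
      ultimately show ?thesis using q(2)[of n] by linarith
    qed
    then have "?C \<omega> \<le> r" by (rule field_le_epsilon)
    then show "\<omega> \<in> {\<omega>\<in>space M. ?C \<omega> \<le> r}" using \<omega> by (auto simp: path_event_def)
  next
    fix \<omega> assume "\<omega> \<in> {\<omega>\<in>space M. ?C \<omega> \<le> r}"
    then show "\<omega> \<in> (\<Inter>n. path_event X {y. c y \<le> q n})"
      using q(1) by (auto simp: path_event_def intro: order_trans[OF _ less_imp_le])
  qed
  ultimately show "{\<omega> \<in> space ?N. ?C \<omega> \<le> r} \<in> sets ?N" by (simp only: setsN(2))
qed

end

section \<open>The limit of stopping times is a stopping time\<close>

lemma space_right_cont_filtration [simp]: "space (right_cont_filtration M T X t) = space M"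
  by (simp add: right_cont_filtration_def space_measure_of_conv)

lemma sets_right_cont_filtration_iff:
  assumes "t < T"
  shows "A \<in> sets (right_cont_filtration M T X t) \<longleftrightarrow> (\<forall>s\<in>{t<..T}. A \<in> sets (natural_filtration M X s))"
proof -
  have T: "T \<in> {t<..T}" using assms by simp
  have "(\<Inter>s\<in>{t<..T}. sets (natural_filtration M X s)) \<subseteq> Pow (space M)"
    by (rule order_trans[OF INF_lower[OF T]]) (use sets.space_closed[of "natural_filtration M X T"] in simp)
  then have eq: "sets (right_cont_filtration M T X t) = sigma_sets (space M) (\<Inter>s\<in>{t<..T}. sets (natural_filtration M X s))"
    using assms by (simp add: right_cont_filtration_def)
  have "sigma_sets (space M) (\<Inter>s\<in>{t<..T}. sets (natural_filtration M X s)) \<subseteq> sets (natural_filtration M X s)"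
    if "s \<in> {t<..T}" for s
  proof -
    have "sigma_sets (space (natural_filtration M X s)) (\<Inter>s\<in>{t<..T}. sets (natural_filtration M X s)) \<subseteq> sets (natural_filtration M X s)"
      by (rule sets.sigma_sets_subset) (use that in auto)
    then show ?thesis by simp
  qed
  then show ?thesis unfolding eq by (blast intro: sigma_sets.Basic)
qed

lemma right_cont_filtration_ge: "T \<le> t \<Longrightarrow> right_cont_filtration M T X t = natural_filtration M X T"
  by (simp add: right_cont_filtration_def)

lemma right_cont_filtration_subalgebra:
  assumes X: "cadlag_process M T X"
  shows "subalgebra M (right_cont_filtration M T X t)"
  using natural_filtration_subalgebra[OF X, of T]
  by (cases "t < T") (auto simp: subalgebra_def sets_right_cont_filtration_iff right_cont_filtration_ge)

lemma ramp_scaled_limit: "(\<lambda>m. ramp (real m * x)) \<longlonglongrightarrow> of_bool (0 < x)"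
proof (cases "0 < x")
  case True
  obtain n :: nat where n: "1 / x < real n" using reals_Archimedean2 by blast
  have "ramp (real m * x) = 1" if "m \<ge> n" for m
  proof -
    have "1 / x < real m" using n that by linarith
    then show ?thesis using True by (simp add: ramp_def field_simps)
  qed
  then show ?thesis using True by (auto intro!: tendsto_eventually eventually_sequentiallyI)
next
  case False
  then have "ramp (real m * x) = 0" for m
    using mult_nonneg_nonpos[of "real m" x] by (simp add: ramp_def)
  then show ?thesis using False by simp
qed

context skorokhod_law_limit
begin

lemma sample_path_eval: "s \<in> {0..T} \<Longrightarrow> sample_path T Z \<omega> s = Z s \<omega>"
  by (simp add: sample_path_def)

lemma natural_filtration_generated_by_continuity_events:
  assumes "t \<le> T"
  shows "sets (natural_filtration M X t) \<subseteq>
    sigma_sets (space M) {path_event X S |S. continuity_event (past t) S}"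
proof -
  let ?R = "{path_event X S |S. continuity_event (past t) S}"
  have "sets (natural_filtration M X t) \<subseteq> sets (sigma (space M) ?R)"
  proof (rule natural_filtration_least)
    fix s assume s: "0 \<le> s" "s \<le> t"
    then have sT: "s \<in> {0..T}" using assms by simp
    have "(\<lambda>\<omega>. Xpath \<omega> s) \<in> borel_measurable (sigma (space M) ?R)"
      by (rule continuity_events_generate[where c = "\<lambda>y. y s"])
        (use s sT in \<open>simp_all add: sample_path_eval ae_continuous_eval X_measurable measurable_natural_filtration\<close>)
    then show "X s \<in> borel_measurable (sigma (space M) ?R)" by (simp add: sample_path_eval[OF sT])
  qed (simp add: space_measure_of_conv)
  also have "\<dots> = sigma_sets (space M) ?R" by (rule sets_measure_of) (auto simp: path_event_def)
  finally show ?thesis .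
qed

lemma increments_after_generated_by_continuity_events:
  assumes "0 \<le> t"
  shows "sets (future t X) \<subseteq>
    sigma_sets (space M) {path_event X S |S. continuity_event (future t) S}"
proof -
  let ?R = "{path_event X S |S. continuity_event (future t) S}"
  have "sets (future t X) \<subseteq> sets (sigma (space M) ?R)"
  proof (rule increments_after_least)
    fix v assume v: "t < v" "v \<le> T"
    then have T: "v \<in> {0..T}" "t \<in> {0..T}" using assms by auto
    have c: "ae_continuous (\<lambda>y. y v - y t)"
      using ae_continuous_eval[OF T(1)] ae_continuous_eval[OF T(2)] unfolding ae_continuous_def
      by eventually_elim (intro tendsto_intros)
    have "(\<lambda>\<omega>. Xpath \<omega> v - Xpath \<omega> t) \<in> borel_measurable (sigma (space M) ?R)"
      by (rule continuity_events_generate[where c = "\<lambda>y. y v - y t"])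
        (use v T c X_measurable[OF T(1)] X_measurable[OF T(2)] in
          \<open>simp_all add: sample_path_eval measurable_increments_after\<close>)
    then show "(\<lambda>\<omega>. X v \<omega> - X t \<omega>) \<in> borel_measurable (sigma (space M) ?R)" by (simp only: sample_path_eval[OF T(1)] sample_path_eval[OF T(2)])
  qed (simp add: space_measure_of_conv)
  also have "\<dots> = sigma_sets (space M) ?R" by (rule sets_measure_of) (auto simp: path_event_def)
  finally show ?thesis .
qed

lemma path_event_indicator: "\<omega> \<in> space M \<Longrightarrow> indicator (path_event Z S) \<omega> = (of_bool (sample_path T Z \<omega> \<in> S) :: real)"
  by (simp add: path_event_def indicator_def)

lemma weighted_event_limit:
  fixes a :: "real \<Rightarrow> real"
  assumes a: "continuous_on UNIV a" "\<And>s. 0 \<le> a s \<and> a s \<le> 1"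
    and S: "ae_continuous (\<lambda>y. of_bool (y \<in> S))" "\<And>k. path_event (Y k) S \<in> events" "path_event X S \<in> events"
  shows "(\<lambda>k. \<integral>\<omega>. a (\<rho> k \<omega>) * indicator (path_event (Y k) S) \<omega> \<partial>M)
    \<longlonglongrightarrow> (\<integral>\<omega>. a (\<tau> \<omega>) * indicator (path_event X S) \<omega> \<partial>M)"
proof -
  have m: "(\<lambda>\<omega>. of_bool (sample_path T Z \<omega> \<in> S) :: real) \<in> borel_measurable M" if "path_event Z S \<in> events" for Z
  proof -
    have "indicat_real (path_event Z S) \<in> borel_measurable M" using that by simp
    then show ?thesis by (simp cong: measurable_cong add: path_event_indicator)
  qed
  have "(\<lambda>k. \<integral>\<omega>. a (\<rho> k \<omega>) * of_bool (Ypath k \<omega> \<in> S) \<partial>M)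
    \<longlonglongrightarrow> (\<integral>\<omega>. a (\<tau> \<omega>) * of_bool (Xpath \<omega> \<in> S) \<partial>M)"
    by (rule weighted_functional_limit[OF a S(1), of 1]) (auto intro: m S(2,3))
  moreover have "(\<integral>\<omega>. u \<omega> * of_bool (sample_path T Z \<omega> \<in> S) \<partial>M) = (\<integral>\<omega>. u \<omega> * indicator (path_event Z S) \<omega> \<partial>M)"
    for u :: "'a \<Rightarrow> real" and Z by (intro Bochner_Integration.integral_cong) (simp_all add: path_event_indicator)
  ultimately show ?thesis by simp
qed


end

locale independent_increments_limit = skorokhod_law_limit +
  assumes ind: "\<And>k. independent_increments M T (Y k)"
    and \<rho>_stop: "\<And>k. \<rho> k \<in> stopping_times M T (natural_filtration M (Y k))"
    and \<tau>_measurable: "\<tau> \<in> borel_measurable (natural_filtration M X T)"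
begin

lemma \<rho>_range: "\<omega> \<in> space M \<Longrightarrow> \<rho> k \<omega> \<in> {0..T}"
  using \<rho>_stop by (auto simp: stopping_times_def)

lemma \<tau>_M: "\<tau> \<in> borel_measurable M"
  using \<tau>_measurable natural_filtration_subalgebra[OF cadlag_X order_refl]
  by (rule measurable_from_subalg[rotated])

text \<open>The distance to the interval, cut at 1, is a continuous function that vanishes on all \<open>\<rho> k\<close>.\<close>

lemma limit_time_range: "AE \<omega> in M. \<tau> \<omega> \<in> {0..T}"
proof -
  define a where "a s = ramp (max (- s) (s - T))" for s
  have a: "continuous_on UNIV a"
    unfolding a_def by (intro continuous_on_compose2[OF continuous_ramp] continuous_intros) auto
  have ar: "\<bar>a s\<bar> \<le> 1" for s using ramp_range by (auto simp: a_def)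
  have "(\<integral>\<omega>. a (\<rho> k \<omega>) \<partial>M) = 0" for k
    using \<rho>_range by (subst Bochner_Integration.integral_cong[where g = "\<lambda>_. 0"]) (auto simp: a_def ramp_def)
  then have "(\<lambda>k::nat. 0) \<longlonglongrightarrow> (\<integral>\<omega>. a (\<tau> \<omega>) \<partial>M)"
    using weight_limit[OF a ar] by simp
  then have zero: "(\<integral>\<omega>. a (\<tau> \<omega>) \<partial>M) = 0" by (simp add: LIMSEQ_const_iff)
  have "integrable M (\<lambda>\<omega>. a (\<tau> \<omega>))"
    using ar weight_measurable(2)[OF a] by (intro integrable_const_bound[of _ 1]) auto
  then have "AE \<omega> in M. a (\<tau> \<omega>) = 0"
    using zero ramp_range by (subst (asm) integral_nonneg_eq_0_iff_AE) (auto simp: a_def)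
  then show ?thesis
    by eventually_elim (auto simp: a_def ramp_def min_def max_def split: if_splits)
qed

lemma past_weight_measurable:
  assumes t: "t \<le> T" and a: "continuous_on UNIV (a :: real \<Rightarrow> real)" "\<And>s. t \<le> s \<Longrightarrow> a s = a t"
  shows "(\<lambda>\<omega>. a (\<rho> k \<omega>)) \<in> borel_measurable (natural_filtration M (Y k) t)"
proof -
  let ?F = "natural_filtration M (Y k)"
  have "(\<lambda>\<omega>. min (\<rho> k \<omega>) t) \<in> borel_measurable (?F t)"
  proof (rule borel_measurable_iff_le[THEN iffD2, rule_format])
    fix c
    show "{\<omega>\<in>space (?F t). min (\<rho> k \<omega>) t \<le> c} \<in> sets (?F t)"
    proof (cases "t \<le> c")
      case True
      then have "{\<omega>\<in>space (?F t). min (\<rho> k \<omega>) t \<le> c} = space (?F t)" by auto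
      then show ?thesis using sets.top[of "?F t"] by argo
    next
      case False
      then have "{\<omega>\<in>space (?F t). min (\<rho> k \<omega>) t \<le> c} = {\<omega>\<in>space (?F c). \<rho> k \<omega> \<le> c}" by auto
      also have "\<dots> \<in> sets (?F c)"
        using \<rho>_stop[of k] unfolding stopping_times_def stopping_time_def pred_def by blast
      finally show ?thesis using natural_filtration_mono[of c t] False by auto
    qed
  qed
  then have "(\<lambda>\<omega>. a (min (\<rho> k \<omega>) t)) \<in> borel_measurable (?F t)"
    by (rule measurable_compose[OF _ borel_measurable_continuous_onI[OF a(1)]])
  moreover have "a (min s t) = a s" for s using a(2)[of s] by (auto simp: min_def)
  ultimately show ?thesis by simp
qed

text \<open>For the processes \<open>Y k\<close> the factorization is the independence of past and future; a weight that is constant from \<open>t\<close> on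
makes \<open>a (\<rho> k)\<close> a function of the past. Each factor is an almost surely continuous functional, so the identity
passes to the limit.\<close>

lemma weighted_product_limit:
  assumes t: "t \<in> {0..T}" and a: "continuous_on UNIV a" "\<And>s. 0 \<le> a s \<and> a s \<le> 1" "\<And>s. t \<le> s \<Longrightarrow> a s = a t"
    and S: "continuity_event (past t) S"
    and V: "continuity_event (future t) V"
  shows "(\<integral>\<omega>. a (\<tau> \<omega>) * indicator (path_event X (S \<inter> V)) \<omega> \<partial>M)
    = (\<integral>\<omega>. a (\<tau> \<omega>) * indicator (path_event X S) \<omega> \<partial>M) * prob (path_event X V)"
proof -
  have events: "path_event Z S \<in> events" "path_event Z V \<in> events" "path_event Z (S \<inter> V) \<in> events"
    if Z: "cadlag_process M T Z" for Z
  proof -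
    have sub: "sets (natural_filtration M Z t) \<subseteq> events"
      using natural_filtration_subalgebra[OF Z] t by (auto simp: subalgebra_def)
    have "sets (increments_after M T Z t UNIV) \<subseteq> events"
      using Z t by (intro increments_after_least borel_measurable_diff) (auto simp: cadlag_process_def)
    then show "path_event Z S \<in> events" "path_event Z V \<in> events"
      using S V sub by (auto simp: continuity_event_def)
    then have "path_event Z S \<inter> path_event Z V \<in> events" by (rule sets.Int)
    moreover have "path_event Z (S \<inter> V) = path_event Z S \<inter> path_event Z V" by (auto simp: path_event_def)
    ultimately show "path_event Z (S \<inter> V) \<in> events" by simp
  qed
  have cont: "ae_continuous (\<lambda>y. of_bool (y \<in> S))" "ae_continuous (\<lambda>y. of_bool (y \<in> V))" "ae_continuous (\<lambda>y. of_bool (y \<in> S \<inter> V))"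
    using S V ae_continuous_of_bool_Int by (auto simp: continuity_event_def)
  let ?i = "\<lambda>Z A. indicat_real (path_event Z A)"
  have limS: "(\<lambda>k. \<integral>\<omega>. a (\<rho> k \<omega>) * ?i (Y k) S \<omega> \<partial>M) \<longlonglongrightarrow> (\<integral>\<omega>. a (\<tau> \<omega>) * ?i X S \<omega> \<partial>M)"
    and limSV: "(\<lambda>k. \<integral>\<omega>. a (\<rho> k \<omega>) * ?i (Y k) (S \<inter> V) \<omega> \<partial>M) \<longlonglongrightarrow> (\<integral>\<omega>. a (\<tau> \<omega>) * ?i X (S \<inter> V) \<omega> \<partial>M)"
    by (intro weighted_event_limit a(1,2) cont events cadlag_X cadlag_Y)+
  have "(\<lambda>k. \<integral>\<omega>. 1 * ?i (Y k) V \<omega> \<partial>M) \<longlonglongrightarrow> (\<integral>\<omega>. 1 * ?i X V \<omega> \<partial>M)"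
    by (rule weighted_event_limit[where a = "\<lambda>_. 1"]) (auto intro: cont events cadlag_X cadlag_Y)
  then have limV: "(\<lambda>k. prob (path_event (Y k) V)) \<longlonglongrightarrow> prob (path_event X V)"
    using events(2)[OF cadlag_X] events(2)[OF cadlag_Y] by simp
  have "(\<integral>\<omega>. a (\<rho> k \<omega>) * ?i (Y k) (S \<inter> V) \<omega> \<partial>M) = (\<integral>\<omega>. a (\<rho> k \<omega>) * ?i (Y k) S \<omega> \<partial>M) * prob (path_event (Y k) V)" for k
  proof -
    note evk = events[OF cadlag_Y, of k]
    have "(\<integral>\<omega>. a (\<rho> k \<omega>) * ?i (Y k) (S \<inter> V) \<omega> \<partial>M) = (\<integral>\<omega>. (a (\<rho> k \<omega>) * ?i (Y k) S \<omega>) * ?i (Y k) V \<omega> \<partial>M)"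
      by (intro Bochner_Integration.integral_cong) (auto simp: path_event_def indicator_def)
    also have "\<dots> = (\<integral>\<omega>. a (\<rho> k \<omega>) * ?i (Y k) S \<omega> \<partial>M) * (\<integral>\<omega>. ?i (Y k) V \<omega> \<partial>M)"
    proof (rule indep_set_integral_mult)
      show "indep_set (sets (natural_filtration M (Y k) t)) (sets (future t (Y k)))"
        using t by (intro future_increments_independent prob_space_axioms cadlag_Y ind) auto
      show "(\<lambda>\<omega>. a (\<rho> k \<omega>) * ?i (Y k) S \<omega>) \<in> borel_measurable (natural_filtration M (Y k) t)"
        using t S past_weight_measurable[OF _ a(1,3)]
        by (intro borel_measurable_times borel_measurable_indicator) (auto simp: continuity_event_def)
      show "?i (Y k) V \<in> borel_measurable (future t (Y k))"
        using V by (intro borel_measurable_indicator) (auto simp: continuity_event_def)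
      show "integrable M (\<lambda>\<omega>. a (\<rho> k \<omega>) * ?i (Y k) S \<omega>)"
      proof (rule integrable_const_bound[of _ 1])
        show "AE \<omega> in M. norm (a (\<rho> k \<omega>) * ?i (Y k) S \<omega>) \<le> 1"
          using a(2) by (auto simp: abs_mult indicator_def)
        show "(\<lambda>\<omega>. a (\<rho> k \<omega>) * ?i (Y k) S \<omega>) \<in> borel_measurable M"
          using weight_measurable(1)[OF a(1)] evk by (intro borel_measurable_times borel_measurable_indicator) auto
      qed
      show "integrable M (?i (Y k) V)"
        using evk by (intro integrable_indicator_event) auto
    qed simp_all
    finally show ?thesis using evk by simp
  qed
  then show ?thesis
    using LIMSEQ_unique[OF limSV] tendsto_mult[OF limS limV] by simp
qed

text \<open>The event \<open>\<tau> < t\<close> has an indicator that is discontinuous in \<open>\<tau>\<close>; it is the increasing limit of ramps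
that vanish from \<open>t\<close> on, to which \<open>weighted_product_limit\<close> applies. The resulting product formula on generating
systems that are stable under intersection extends to the generated sigma algebras.\<close>

lemma limit_past_independent_of_future:
  assumes t: "t \<in> {0..T}"
  shows "\<exists>B. subalgebra M B \<and> subalgebra B (natural_filtration M X t) \<and>
    {\<omega>\<in>space M. \<tau> \<omega> < t} \<in> sets B \<and> indep_set (sets B) (sets (future t X))"
proof -
  let ?A = "{\<omega>\<in>space M. \<tau> \<omega> < t}"
  let ?past = "continuity_event (past t)"
  let ?future = "continuity_event (future t)"
  define P where "P = {path_event X S \<inter> E |S E. ?past S \<and> E \<in> {space M, ?A}}"
  define Q where "Q = {path_event X V |V. ?future V}"
  have AM: "?A \<in> events" using \<tau>_M by (metis borel_measurable_iff_less)
  have FM: "sets (natural_filtration M X t) \<subseteq> events"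
    using natural_filtration_subalgebra[OF cadlag_X] t by (auto simp: subalgebra_def)
  have GM: "sets (future t X) \<subseteq> events"
    using X_measurable t by (intro increments_after_least borel_measurable_diff) auto
  have pe: "path_event X S \<in> events" if "?past S" for S using that FM by (auto simp: continuity_event_def)
  have fe: "path_event X V \<in> events" if "?future V" for V using that GM by (auto simp: continuity_event_def)
  have PM: "P \<subseteq> events" using pe AM by (auto simp: P_def)
  have prod: "prob (path_event X S \<inter> E \<inter> path_event X V) = prob (path_event X S \<inter> E) * prob (path_event X V)"
    if S: "?past S" and V: "?future V" and E: "E \<in> {space M, ?A}" for S V E
  proof -
    have Int: "path_event X (S \<inter> V) = path_event X S \<inter> path_event X V" by (auto simp: path_event_def)
    \<comment> \<open>one weight for both kinds of sets in \<open>P\<close>: constant for the past alone, ramps for \<open>\<tau> < t\<close>\<close>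
    define a where "a m s = (if E = space M then 1 else ramp (real m * (t - s)))" for m :: nat and s
    have ac: "continuous_on UNIV (a m)" for m
      unfolding a_def by (cases "E = space M")
        (auto intro!: continuous_on_compose2[OF continuous_ramp] continuous_intros)
    have ar: "0 \<le> a m s \<and> a m s \<le> 1" for m s using ramp_range by (auto simp: a_def)
    have at: "a m s = a m t" if "t \<le> s" for m s
      using that mult_nonneg_nonpos[of "real m" "t - s"] by (auto simp: a_def ramp_def)
    have al: "(\<lambda>m. a m (\<tau> \<omega>)) \<longlonglongrightarrow> indicator E \<omega>" if "\<omega> \<in> space M" for \<omega>
    proof (cases "E = space M")
      case False
      then have "indicator E \<omega> = (of_bool (0 < t - \<tau> \<omega>) :: real)" using E that by (auto simp: indicator_def)
      then show ?thesis using ramp_scaled_limit[of "t - \<tau> \<omega>"] False by (simp add: a_def)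
    qed (use that in \<open>simp add: a_def\<close>)
    have lim: "(\<lambda>m. \<integral>\<omega>. a m (\<tau> \<omega>) * indicator C \<omega> \<partial>M) \<longlonglongrightarrow> prob (C \<inter> E)" if C: "C \<in> events" for C
    proof -
      have CE: "C \<inter> E \<in> events" using C E AM by auto
      have "(\<lambda>m. \<integral>\<omega>. a m (\<tau> \<omega>) * indicator C \<omega> \<partial>M) \<longlonglongrightarrow> (\<integral>\<omega>. indicator (C \<inter> E) \<omega> \<partial>M)"
      proof (rule integral_dominated_convergence[where w = "\<lambda>_. 1"])
        show "AE \<omega> in M. (\<lambda>m. a m (\<tau> \<omega>) * indicator C \<omega>) \<longlonglongrightarrow> indicat_real (C \<inter> E) \<omega>"
        proof (rule AE_I2)
          fix \<omega> assume "\<omega> \<in> space M"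
          from tendsto_mult_right[OF al[OF this], of "indicator C \<omega>"]
          show "(\<lambda>m. a m (\<tau> \<omega>) * indicator C \<omega>) \<longlonglongrightarrow> indicat_real (C \<inter> E) \<omega>"
            by (simp add: indicator_inter_arith mult.commute)
        qed
        show "AE \<omega> in M. norm (a m (\<tau> \<omega>) * indicator C \<omega>) \<le> 1" for m
          using ar by (auto simp: abs_mult indicator_def)
        show "(\<lambda>\<omega>. a m (\<tau> \<omega>) * indicator C \<omega>) \<in> borel_measurable M" for m
          using C weight_measurable(2)[OF ac] by (intro borel_measurable_times borel_measurable_indicator)
      qed (use CE in auto)
      then show ?thesis using CE by simp
    qed
    have "(\<integral>\<omega>. a m (\<tau> \<omega>) * indicator (path_event X S \<inter> path_event X V) \<omega> \<partial>M)
        = (\<integral>\<omega>. a m (\<tau> \<omega>) * indicator (path_event X S) \<omega> \<partial>M) * prob (path_event X V)" for m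
      using weighted_product_limit[OF t ac ar at S V, of m] by (simp add: Int)
    moreover have "(\<lambda>m. \<integral>\<omega>. a m (\<tau> \<omega>) * indicator (path_event X S \<inter> path_event X V) \<omega> \<partial>M)
        \<longlonglongrightarrow> prob (path_event X S \<inter> path_event X V \<inter> E)"
      using pe[OF S] fe[OF V] by (intro lim) auto
    ultimately have "prob (path_event X S \<inter> path_event X V \<inter> E) = prob (path_event X S \<inter> E) * prob (path_event X V)"
      using tendsto_mult_right[OF lim[OF pe[OF S]], of "prob (path_event X V)"] LIMSEQ_unique by simp
    then show ?thesis by (simp add: Int_ac)
  qed
  have indep: "indep_set P Q"
  proof (rule indep_setI)
    show "Q \<subseteq> events" using fe by (auto simp: Q_def)
    fix b q assume "b \<in> P" "q \<in> Q"
    then show "prob (b \<inter> q) = prob b * prob q" using prod unfolding P_def Q_def by blast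
  qed (rule PM)
  have IntP: "Int_stable P"
  proof (rule Int_stableI)
    fix b c assume "b \<in> P" "c \<in> P"
    then obtain S E S' E' where *: "b = path_event X S \<inter> E" "c = path_event X S' \<inter> E'" "?past S" "?past S'"
      "E \<in> {space M, ?A}" "E' \<in> {space M, ?A}" unfolding P_def by blast
    have "b \<inter> c = path_event X (S \<inter> S') \<inter> (E \<inter> E')" by (auto simp: * path_event_def)
    moreover have "E \<inter> E' \<in> {space M, ?A}" using *(5,6) by auto
    ultimately show "b \<inter> c \<in> P" unfolding P_def using continuity_event_Int[OF *(3,4)] by blast
  qed
  have IntQ: "Int_stable Q"
  proof (rule Int_stableI)
    fix b c assume "b \<in> Q" "c \<in> Q"
    then obtain V V' where *: "b = path_event X V" "c = path_event X V'" "?future V" "?future V'"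
      unfolding Q_def by blast
    have "b \<inter> c = path_event X (V \<inter> V')" by (auto simp: * path_event_def)
    then show "b \<inter> c \<in> Q" unfolding Q_def using continuity_event_Int[OF *(3,4)] by blast
  qed
  define B where "B = sigma (space M) P"
  have Psp: "P \<subseteq> Pow (space M)" using PM sets.sets_into_space by blast
  have B: "sets B = sigma_sets (space M) P" "space B = space M" using Psp by (simp_all add: B_def)
  have "indep_set (sigma_sets (space M) P) (sigma_sets (space M) Q)"
    by (rule indep_set_sigma_sets[OF indep IntP IntQ])
  then have "indep_set (sets B) (sets (future t X))"
    using increments_after_generated_by_continuity_events[of t] t unfolding indep_sets2_eq B(1) Q_def by (auto simp: subset_iff)
  moreover have "subalgebra M B"
    using sets.sigma_sets_subset[OF PM] by (simp add: subalgebra_def B)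
  moreover have "subalgebra B (natural_filtration M X t)"
  proof -
    have "{path_event X S |S. ?past S} \<subseteq> P"
    proof
      fix b assume "b \<in> {path_event X S |S. ?past S}"
      then obtain S where S: "b = path_event X S" "?past S" by blast
      then have "b = path_event X S \<inter> space M" by (auto simp: path_event_def)
      then show "b \<in> P" using S unfolding P_def by blast
    qed
    then have "sigma_sets (space M) {path_event X S |S. ?past S} \<subseteq> sigma_sets (space M) P"
      by (rule sigma_sets_mono')
    then have "sets (natural_filtration M X t) \<subseteq> sets B"
      using natural_filtration_generated_by_continuity_events[of t] t unfolding B(1) by simp
    then show ?thesis by (simp add: subalgebra_def B)
  qed
  moreover have "?A \<in> sets B"
  proof -
    have "?A = path_event X UNIV \<inter> ?A" by (auto simp: path_event_def)
    moreover have "?past UNIV" by (rule continuity_event_UNIV) simp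
    ultimately have "?A \<in> P" unfolding P_def by blast
    then show ?thesis unfolding B(1) by (rule sigma_sets.Basic)
  qed
  ultimately show ?thesis by blast
qed

text \<open>The past of \<open>t\<close> and the increments after \<open>t\<close> together generate the whole history of \<open>X\<close>, in which the event
\<open>\<tau> < t\<close> lies by assumption.\<close>

lemma limit_time_adapted:
  assumes t: "t \<in> {0..T}"
  shows "\<exists>A\<in>sets (natural_filtration M X t). AE \<omega> in M. \<tau> \<omega> < t \<longleftrightarrow> \<omega> \<in> A"
proof -
  let ?A = "{\<omega>\<in>space M. \<tau> \<omega> < t}"
  let ?F = "natural_filtration M X t" and ?G = "future t X"
  obtain B where B: "subalgebra M B" "subalgebra B ?F" "?A \<in> sets B" "indep_set (sets B) (sets ?G)"
    using limit_past_independent_of_future[OF t] by blast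
  define H where "H = sigma (space M) (sets ?F \<union> sets ?G)"
  have sub: "sets ?F \<union> sets ?G \<subseteq> Pow (space M)"
    using sets.space_closed[of ?F] sets.space_closed[of ?G] by auto
  have H: "sets H = sigma_sets (space M) (sets ?F \<union> sets ?G)" "space H = space M"
    using sub by (simp_all add: H_def)
  have FH: "subalgebra H ?F" "subalgebra H ?G" by (auto simp: subalgebra_def H)
  have "sets (natural_filtration M X T) \<subseteq> sets H"
  proof (rule natural_filtration_least)
    fix s assume s: "0 \<le> s" "s \<le> T"
    have Xu: "X u \<in> borel_measurable H" if "0 \<le> u" "u \<le> t" for u
      by (rule measurable_from_subalg[OF FH(1) measurable_natural_filtration[OF that]])
    show "X s \<in> borel_measurable H"
    proof (cases "s \<le> t")
      case False
      then have "(\<lambda>\<omega>. X s \<omega> - X t \<omega>) \<in> borel_measurable H"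
        using s by (intro measurable_from_subalg[OF FH(2)] measurable_increments_after) auto
      from borel_measurable_add[OF this Xu[of t]] show ?thesis using t by simp
    qed (use Xu s in auto)
  qed (simp add: H)
  moreover have "?A \<in> sets (natural_filtration M X T)"
    using \<tau>_measurable by (metis borel_measurable_iff_less space_natural_filtration)
  ultimately have "?A \<in> sigma_sets (space M) (sets ?F \<union> sets ?G)" using H by blast
  from independent_enlargement_mod_null[OF B(1,2) _ B(4,3) this]
  obtain A' where "A' \<in> sets ?F" "AE \<omega> in M. \<omega> \<in> ?A \<longleftrightarrow> \<omega> \<in> A'" by auto
  moreover from this(2) have "AE \<omega> in M. \<tau> \<omega> < t \<longleftrightarrow> \<omega> \<in> A'"
    using AE_space by eventually_elim simp
  ultimately show ?thesis by blast
qed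

text \<open>The filtration is not augmented by null sets, so \<open>\<tau>\<close> has to be modified. The
modification is the first rational time at which \<open>\<tau>\<close> has been announced by a genuine event of the past.\<close>

lemma limit_is_stopping_time:
  "\<exists>\<tau>'\<in>stopping_times M T (right_cont_filtration M T X). AE \<omega> in M. \<tau> \<omega> = \<tau>' \<omega>"
proof -
  let ?F = "natural_filtration M X"
  define Q :: "real set" where "Q = {q \<in> \<rat>. 0 < q \<and> q < T}"
  have Qc: "countable Q" unfolding Q_def by (rule countable_Collect) (rule countable_rat)
  have "\<exists>A. \<forall>q\<in>Q. A q \<in> sets (?F q) \<and> (AE \<omega> in M. \<tau> \<omega> < q \<longleftrightarrow> \<omega> \<in> A q)"
  proof (rule bchoice, rule ballI)
    fix q assume "q \<in> Q"
    then have "q \<in> {0..T}" by (auto simp: Q_def)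
    from limit_time_adapted[OF this]
    show "\<exists>A. A \<in> sets (?F q) \<and> (AE \<omega> in M. \<tau> \<omega> < q \<longleftrightarrow> \<omega> \<in> A)" by blast
  qed
  then obtain A where A: "\<And>q. q \<in> Q \<Longrightarrow> A q \<in> sets (?F q)"
      "\<And>q. q \<in> Q \<Longrightarrow> AE \<omega> in M. \<tau> \<omega> < q \<longleftrightarrow> \<omega> \<in> A q"
    by blast
  \<comment> \<open>inserting \<open>T\<close> keeps the infimum within the interval and defined when no event occurs\<close>
  define R where "R \<omega> = insert T {q\<in>Q. \<omega> \<in> A q}" for \<omega>
  define \<tau>' where "\<tau>' \<omega> = Inf (R \<omega>)" for \<omega>
  have R: "R \<omega> \<noteq> {}" "bdd_below (R \<omega>)" "\<And>q. q \<in> R \<omega> \<Longrightarrow> 0 \<le> q" "T \<in> R \<omega>" for \<omega>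
    using T_pos by (auto simp: R_def Q_def intro!: bdd_belowI[of _ 0])
  have range: "\<tau>' \<omega> \<in> {0..T}" for \<omega>
    unfolding \<tau>'_def using cInf_greatest[OF R(1,3)] cInf_lower[OF R(4,2)] by auto
  have less_iff: "\<tau>' \<omega> < s \<longleftrightarrow> (\<exists>q\<in>Q. q < s \<and> \<omega> \<in> A q)" if "s \<le> T" for \<omega> s
    unfolding \<tau>'_def cInf_less_iff[OF R(1,2)] using that by (auto simp: R_def)
  have less_F: "{\<omega>\<in>space M. \<tau>' \<omega> < s} \<in> sets (?F s)" if "s \<le> T" for s
  proof -
    have "{\<omega>\<in>space M. \<tau>' \<omega> < s} = (\<Union>q\<in>{q\<in>Q. q < s}. A q)"
      using sets.sets_into_space[OF A(1)] by (auto simp: less_iff[OF that])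
    also have "\<dots> \<in> sets (?F s)"
    proof (rule sets.countable_UN'')
      show "countable {q\<in>Q. q < s}" using Qc by simp
    next
      fix q assume "q \<in> {q\<in>Q. q < s}"
      then show "A q \<in> sets (?F s)"
        using A(1)[of q] natural_filtration_mono[of q s M X] by auto
    qed
    finally show ?thesis .
  qed
  have "stopping_time (right_cont_filtration M T X) \<tau>'"
    unfolding stopping_time_def pred_def
  proof
    fix t
    show "{\<omega>\<in>space (right_cont_filtration M T X t). \<tau>' \<omega> \<le> t} \<in> sets (right_cont_filtration M T X t)"
    proof (cases "t < T")
      case True
      have "{\<omega>\<in>space M. \<tau>' \<omega> \<le> t} \<in> sets (?F s)" if s: "s \<in> {t<..T}" for s
      proof -
        \<comment> \<open>times in \<open>(t, s]\<close> decreasing to \<open>t\<close>: all events used lie in the filtration at \<open>s\<close>\<close>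
        define u where "u n = t + (s - t) / real (Suc n)" for n
        have u: "t < u n" "u n \<le> s" for n
        proof -
          have "(s - t) / real (Suc n) \<le> (s - t) / 1" using s by (intro divide_left_mono) auto
          then show "t < u n" "u n \<le> s" using s by (auto simp: u_def)
        qed
        have ulim: "u \<longlonglongrightarrow> t"
        proof -
          have "(\<lambda>n. t + (s - t) * (1 / real (Suc n))) \<longlonglongrightarrow> t + (s - t) * 0"
            by (intro tendsto_intros LIMSEQ_Suc[OF lim_1_over_n])
          then show ?thesis by (simp add: u_def[abs_def])
        qed
        have "{\<omega>\<in>space M. \<tau>' \<omega> \<le> t} = (\<Inter>n. {\<omega>\<in>space M. \<tau>' \<omega> < u n})"
        proof (intro set_eqI iffI)
          fix \<omega> assume "\<omega> \<in> (\<Inter>n. {\<omega>\<in>space M. \<tau>' \<omega> < u n})"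
          then show "\<omega> \<in> {\<omega>\<in>space M. \<tau>' \<omega> \<le> t}"
            using LIMSEQ_le_const[OF ulim, of "\<tau>' \<omega>"] by (auto intro: less_imp_le)
        qed (use u in \<open>auto intro: order_le_less_trans\<close>)
        also have "\<dots> \<in> sets (?F s)"
        proof (rule sets.countable_INT)
          have "{\<omega>\<in>space M. \<tau>' \<omega> < u n} \<in> sets (?F s)" for n
          proof -
            have "u n \<le> T" using u(2)[of n] s by simp
            then show ?thesis using less_F natural_filtration_mono[OF u(2)] by blast
          qed
          then show "range (\<lambda>n. {\<omega>\<in>space M. \<tau>' \<omega> < u n}) \<subseteq> sets (?F s)" by blast
        qed simp
        finally show ?thesis .
      qed
      then show ?thesis using True by (simp add: sets_right_cont_filtration_iff)
    next
      case False
      then have "{\<omega>\<in>space (right_cont_filtration M T X t). \<tau>' \<omega> \<le> t} = space (right_cont_filtration M T X t)"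
        using range by (auto intro: order_trans[of _ T])
      then show ?thesis by (simp only: sets.top)
    qed
  qed
  then have "\<tau>' \<in> stopping_times M T (right_cont_filtration M T X)"
    using range by (simp add: stopping_times_def)
  moreover have "AE \<omega> in M. \<tau> \<omega> = \<tau>' \<omega>"
  proof -
    have "AE \<omega> in M. \<forall>q\<in>Q. \<tau> \<omega> < q \<longleftrightarrow> \<omega> \<in> A q"
      using Qc A(2) by (simp add: AE_ball_countable)
    then show ?thesis
      using limit_time_range
    proof eventually_elim
      case (elim \<omega>)
      have "\<tau> \<omega> < s \<longleftrightarrow> \<tau>' \<omega> < s" if sT: "s \<le> T" for s
      proof
        assume "\<tau> \<omega> < s"
        then obtain q where q: "q \<in> \<rat>" "\<tau> \<omega> < q" "q < s" using Rats_dense_in_real by blast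
        then have "q \<in> Q" using elim(2) sT by (auto simp: Q_def)
        then show "\<tau>' \<omega> < s" using q elim(1) less_iff[OF sT] by blast
      next
        assume "\<tau>' \<omega> < s"
        then obtain q where "q \<in> Q" "q < s" "\<omega> \<in> A q" using less_iff[OF sT] by blast
        then show "\<tau> \<omega> < s" using elim(1) by (meson less_trans)
      qed
      from this[of "\<tau> \<omega>"] this[of "\<tau>' \<omega>"] show ?case using elim(2) range[of \<omega>] by auto
    qed
  qed
  ultimately show ?thesis by blast
qed

end

section \<open>Equicontinuity in probability and compact containment\<close>

text \<open>Constant times are stopping times, so constants increasing strictly to \<open>t\<close> identify the left limit at \<open>t\<close>.\<close>

lemma quasi_left_continuous_no_fixed_jump:
  assumes T: "0 < T" and X: "cadlag_process M T X"
    and qlc: "quasi_left_continuous M T (right_cont_filtration M T X) X" and t: "t \<in> {0..T}"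
  shows "AE \<omega> in M. continuous (at t within {0..T}) (\<lambda>s. X s \<omega>)"
proof (cases "t = 0")
  case True
  then show ?thesis
    using cadlag_on_right_continuous[of T "\<lambda>s. X s _" 0] X t by (intro AE_I2) (auto simp: cadlag_process_def)
next
  case False
  then have t0: "0 < t" using t by simp
  define \<sigma> where "\<sigma> k = t - t * (1 / real (Suc k))" for k
  have \<sigma>r: "0 \<le> \<sigma> k" "\<sigma> k < t" for k
    using t0 by (auto simp: \<sigma>_def field_simps)
  have "(\<lambda>k. t - t * (1 / real (Suc k))) \<longlonglongrightarrow> t - t * 0"
    by (intro tendsto_intros LIMSEQ_Suc[OF lim_1_over_n])
  then have \<sigma>l: "\<sigma> \<longlonglongrightarrow> t" by (simp add: \<sigma>_def[abs_def])
  have \<sigma>inc: "incseq \<sigma>"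
    using t0 by (auto simp: incseq_def \<sigma>_def intro!: mult_left_mono divide_left_mono)
  have "(\<lambda>_. c) \<in> stopping_times M T F" if "c \<in> {0..T}" for c and F :: "real \<Rightarrow> 'a measure"
    using that by (simp add: stopping_times_def stopping_time_def)
  then have "(\<lambda>_. \<sigma> k) \<in> stopping_times M T (right_cont_filtration M T X)" for k
    using \<sigma>r[of k] t by simp
  then have "AE \<omega> in M. (\<lambda>k. X (\<sigma> k) \<omega>) \<longlonglongrightarrow> X t \<omega>"
    using qlc[unfolded quasi_left_continuous_def, rule_format, of "\<lambda>k _. \<sigma> k" "\<lambda>_. t"] \<sigma>l \<sigma>inc by simp
  then show ?thesis
    using AE_space
  proof eventually_elim
    case (elim \<omega>)
    have c: "cadlag_on T (\<lambda>s. X s \<omega>)" using X elim by (simp add: cadlag_process_def)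
    obtain l where l: "((\<lambda>s. X s \<omega>) \<longlongrightarrow> l) (at_left t)"
      using c[unfolded cadlag_on_def, THEN conjunct2, rule_format, of t] t t0 by auto
    have "filterlim \<sigma> (at_left t) sequentially"
      unfolding filterlim_at using \<sigma>l \<sigma>r by (auto simp: less_imp_neq)
    then have "(\<lambda>k. X (\<sigma> k) \<omega>) \<longlonglongrightarrow> l" by (rule filterlim_compose[OF l])
    then have "l = X t \<omega>" using elim(1) LIMSEQ_unique by blast
    then have left: "((\<lambda>s. X s \<omega>) \<longlongrightarrow> X t \<omega>) (at t within {0..t})"
      using l t0 by (simp add: at_within_Icc_at_left)
    have right: "((\<lambda>s. X s \<omega>) \<longlongrightarrow> X t \<omega>) (at t within {t..T})"
      using cadlag_on_right_continuous[OF c t] by (simp add: continuous_within)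
    have "{0..T} = {0..t} \<union> {t..T}" using t by auto
    then show ?case using left right by (simp add: continuous_within Lim_within_Un)
  qed
qed

definition abs_ramp :: "real \<Rightarrow> real" where "abs_ramp x = ramp \<bar>x\<bar>"

lemma continuous_abs_ramp: "continuous_on UNIV abs_ramp"
  unfolding abs_ramp_def by (intro continuous_on_compose2[OF continuous_ramp] continuous_intros) auto

lemma abs_ramp_range: "0 \<le> abs_ramp x" "abs_ramp x \<le> 1"
  by (auto simp: abs_ramp_def ramp_range)

context skorokhod_law_limit
begin

text \<open>If paths near \<open>X\<close> eventually avoid the sets \<open>bad m\<close>, then \<open>Y k\<close> rarely enters one of them. The bound is uniform over
all events inside, for instance over all times at which a path may be bad.\<close>

lemma negligible_path_sets:
  assumes lim: "AE \<omega> in M. \<exists>m0. \<forall>m\<ge>m0. \<forall>y\<in>skorokhod_space T.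
      skorokhod_dist T (Xpath \<omega>) y < 1 / real (Suc m) \<longrightarrow> y \<notin> bad m"
    and "0 < \<eta>"
  shows "\<exists>m. eventually (\<lambda>k. \<forall>E\<in>events. E \<subseteq> path_event (Y k) (bad m) \<longrightarrow> prob E \<le> \<eta>) sequentially"
proof -
  have lim': "AE \<omega> in M. \<forall>\<epsilon>>0. \<exists>m0. \<forall>m\<ge>m0. \<forall>y\<in>skorokhod_space T.
      skorokhod_dist T (Xpath \<omega>) y < 1 / real (Suc m) \<longrightarrow> of_bool (y \<in> bad m) \<le> 0 + (\<epsilon>::real)"
    using lim
  proof eventually_elim
    case (elim \<omega>)
    then obtain m0 where "\<And>m y. m \<ge> m0 \<Longrightarrow> y \<in> skorokhod_space T \<Longrightarrow>
      skorokhod_dist T (Xpath \<omega>) y < 1 / real (Suc m) \<Longrightarrow> y \<notin> bad m" by blast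
    then show ?case by (intro allI impI exI[of _ m0]) simp
  qed
  have "\<exists>m. eventually (\<lambda>k. \<forall>f\<in>borel_measurable M. (\<forall>\<omega>\<in>space M. 0 \<le> f \<omega> \<and> f \<omega> \<le> of_bool (Ypath k \<omega> \<in> bad m)) \<longrightarrow>
      (\<integral>\<omega>. 1 * f \<omega> \<partial>M) \<le> (\<integral>\<omega>. 1 * 0 \<partial>M) + \<eta>) sequentially"
    by (rule Skorokhod.portmanteau_upper[OF prob_space_axioms conv[unfolded skorokhod_topology_def],
          where a = "\<lambda>_. 1" and l = "\<lambda>_. 0" and g = "\<lambda>m y. of_bool (y \<in> bad m)", OF _ _ _ _ _ lim' \<open>0 < \<eta>\<close>]) auto
  then obtain m where "eventually (\<lambda>k. \<forall>f\<in>borel_measurable M. (\<forall>\<omega>\<in>space M. 0 \<le> f \<omega> \<and> f \<omega> \<le> of_bool (Ypath k \<omega> \<in> bad m)) \<longrightarrow>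
      (\<integral>\<omega>. f \<omega> \<partial>M) \<le> \<eta>) sequentially" by auto
  then have "eventually (\<lambda>k. \<forall>E\<in>events. E \<subseteq> path_event (Y k) (bad m) \<longrightarrow> prob E \<le> \<eta>) sequentially"
  proof eventually_elim
    case (elim k)
    show ?case
    proof (intro ballI impI)
      fix E assume E: "E \<in> events" "E \<subseteq> path_event (Y k) (bad m)"
      then have "(\<integral>\<omega>. indicat_real E \<omega> \<partial>M) \<le> \<eta>"
        by (intro elim[rule_format]) (auto simp: path_event_def indicator_def)
      then show "prob E \<le> \<eta>" using E by simp
    qed
  qed
  then show ?thesis by blast
qed

text \<open>Instance of \<open>negligible_path_sets\<close> in which the bad paths oscillate by \<open>\<epsilon>\<close> within a window of radius
\<open>1 / (m + 1)\<close> around \<open>t\<close>. The radius shrinks with the allowed Skorokhod distance, so that continuity of the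
limit path at \<open>t\<close> excludes them.\<close>

lemma small_oscillation_near:
  assumes t: "t \<in> {0..T}" and "0 < \<epsilon>"
  shows "\<exists>r>0. eventually (\<lambda>k. \<forall>u\<in>{0..T}. \<forall>v\<in>{0..T}. \<bar>u - t\<bar> \<le> r \<longrightarrow> \<bar>v - t\<bar> \<le> r \<longrightarrow>
    prob {\<omega>\<in>space M. \<epsilon> \<le> \<bar>Y k u \<omega> - Y k v \<omega>\<bar>} \<le> \<epsilon>) sequentially"
proof -
  define bad where "bad m = {y :: real \<Rightarrow> real. \<exists>u\<in>{0..T}. \<exists>v\<in>{0..T}. \<bar>u - t\<bar> \<le> 1 / real (Suc m) \<and> \<bar>v - t\<bar> \<le> 1 / real (Suc m) \<and> \<epsilon> \<le> \<bar>y u - y v\<bar>}" for m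
  have "AE \<omega> in M. \<exists>m0. \<forall>m\<ge>m0. \<forall>y\<in>skorokhod_space T.
      skorokhod_dist T (Xpath \<omega>) y < 1 / real (Suc m) \<longrightarrow> y \<notin> bad m"
    using no_fixed_jump[OF t] AE_space
  proof eventually_elim
    case (elim \<omega>)
    let ?x = "Xpath \<omega>"
    have x: "?x \<in> skorokhod_space T" using elim by (simp add: path_in_skorokhod_space)
    have c: "continuous (at t within {0..T}) ?x"
      using elim(1) t by (simp add: continuous_within_eps_delta sample_path_def)
    have "0 < \<epsilon> / 2" using \<open>0 < \<epsilon>\<close> by simp
    from skorokhod_eval_near[OF x c this] obtain \<delta> where \<delta>: "0 < \<delta>"
      "\<And>y s. y \<in> skorokhod_space T \<Longrightarrow> skorokhod_dist T ?x y < \<delta> \<Longrightarrow> s \<in> {0..T} \<Longrightarrow> \<bar>s - t\<bar> \<le> \<delta> \<Longrightarrow> \<bar>y s - ?x t\<bar> < \<epsilon> / 2"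
      by blast
    obtain m0 where m0: "1 / real (Suc m0) < \<delta>"
      using reals_Archimedean[OF \<delta>(1)] by (auto simp: inverse_eq_divide)
    show ?case
    proof (intro exI[of _ m0] allI impI ballI)
      fix m y assume m: "m0 \<le> m" and y: "y \<in> skorokhod_space T" "skorokhod_dist T ?x y < 1 / real (Suc m)"
      have "1 / real (Suc m) \<le> 1 / real (Suc m0)" using m by (intro divide_left_mono) auto
      then have m\<delta>: "1 / real (Suc m) < \<delta>" using m0 by linarith
      then have near: "\<bar>y s - ?x t\<bar> < \<epsilon> / 2" if "s \<in> {0..T}" "\<bar>s - t\<bar> \<le> 1 / real (Suc m)" for s
        using \<delta>(2)[OF y(1) _ that(1)] y(2) that(2) by linarith
      show "y \<notin> bad m"
      proof
        assume "y \<in> bad m"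
        then obtain u v where "u \<in> {0..T}" "v \<in> {0..T}" "\<bar>u - t\<bar> \<le> 1 / real (Suc m)" "\<bar>v - t\<bar> \<le> 1 / real (Suc m)" "\<epsilon> \<le> \<bar>y u - y v\<bar>"
          unfolding bad_def by blast
        then show False using near[of u] near[of v] by linarith
      qed
    qed
  qed
  from negligible_path_sets[OF this \<open>0 < \<epsilon>\<close>] obtain m where
    m: "eventually (\<lambda>k. \<forall>E\<in>events. E \<subseteq> path_event (Y k) (bad m) \<longrightarrow> prob E \<le> \<epsilon>) sequentially" by blast
  show ?thesis
  proof (intro exI[of _ "1 / real (Suc m)"] conjI)
    show "eventually (\<lambda>k. \<forall>u\<in>{0..T}. \<forall>v\<in>{0..T}. \<bar>u - t\<bar> \<le> 1 / real (Suc m) \<longrightarrow> \<bar>v - t\<bar> \<le> 1 / real (Suc m) \<longrightarrow>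
      prob {\<omega>\<in>space M. \<epsilon> \<le> \<bar>Y k u \<omega> - Y k v \<omega>\<bar>} \<le> \<epsilon>) sequentially"
      using m
    proof eventually_elim
      case (elim k)
      show ?case
      proof (intro ballI impI)
        fix u v assume uv: "u \<in> {0..T}" "v \<in> {0..T}" "\<bar>u - t\<bar> \<le> 1 / real (Suc m)" "\<bar>v - t\<bar> \<le> 1 / real (Suc m)"
        have "(\<lambda>\<omega>. \<bar>Y k u \<omega> - Y k v \<omega>\<bar>) \<in> borel_measurable M"
          using Y_measurable uv by (intro borel_measurable_abs borel_measurable_diff) auto
        then have "{\<omega>\<in>space M. \<epsilon> \<le> \<bar>Y k u \<omega> - Y k v \<omega>\<bar>} \<in> events"
          by (simp add: borel_measurable_iff_ge)
        moreover have "{\<omega>\<in>space M. \<epsilon> \<le> \<bar>Y k u \<omega> - Y k v \<omega>\<bar>} \<subseteq> path_event (Y k) (bad m)"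
        proof
          fix \<omega> assume "\<omega> \<in> {\<omega>\<in>space M. \<epsilon> \<le> \<bar>Y k u \<omega> - Y k v \<omega>\<bar>}"
          then have "\<omega> \<in> space M" "\<epsilon> \<le> \<bar>Ypath k \<omega> u - Ypath k \<omega> v\<bar>"
            by (simp_all add: sample_path_eval[OF uv(1)] sample_path_eval[OF uv(2)])
          then show "\<omega> \<in> path_event (Y k) (bad m)"
            using uv unfolding path_event_def bad_def by blast
        qed
        ultimately show "prob {\<omega>\<in>space M. \<epsilon> \<le> \<bar>Y k u \<omega> - Y k v \<omega>\<bar>} \<le> \<epsilon>" using elim by blast
      qed
    qed
  qed simp
qed

text \<open>Finitely many of the windows from \<open>small_oscillation_near\<close> cover the compact time interval.\<close>

lemma equicontinuous_in_probability:
  assumes "0 < \<epsilon>"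
  shows "\<exists>r>0. eventually (\<lambda>k. \<forall>u\<in>{0..T}. \<forall>v\<in>{0..T}. \<bar>u - v\<bar> < r \<longrightarrow>
    (\<integral>\<omega>. abs_ramp (Y k u \<omega> - Y k v \<omega>) \<partial>M) \<le> \<epsilon>) sequentially"
proof -
  have e: "0 < \<epsilon> / 2" using assms by simp
  define small where "small t r \<longleftrightarrow> eventually (\<lambda>k. \<forall>u\<in>{0..T}. \<forall>v\<in>{0..T}. \<bar>u - t\<bar> \<le> r \<longrightarrow> \<bar>v - t\<bar> \<le> r \<longrightarrow>
    prob {\<omega>\<in>space M. \<epsilon> / 2 \<le> \<bar>Y k u \<omega> - Y k v \<omega>\<bar>} \<le> \<epsilon> / 2) sequentially" for t r
  have "\<exists>r. \<forall>t\<in>{0..T}. 0 < r t \<and> small t (r t)"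
    using small_oscillation_near[OF _ e] unfolding small_def by (intro bchoice ballI)
  then obtain r where r: "\<And>t. t \<in> {0..T} \<Longrightarrow> 0 < r t" "\<And>t. t \<in> {0..T} \<Longrightarrow> small t (r t)"
    by blast
  have "compact {0..T}" by simp
  moreover have "open (ball t (r t / 2))" for t by simp
  moreover have "{0..T} \<subseteq> (\<Union>t\<in>{0..T}. ball t (r t / 2))"
  proof
    fix t assume "t \<in> {0..T}"
    then show "t \<in> (\<Union>t\<in>{0..T}. ball t (r t / 2))" using r(1)[of t] by (intro UN_I[of t]) auto
  qed
  ultimately obtain C where C: "C \<subseteq> {0..T}" "finite C" "{0..T} \<subseteq> (\<Union>t\<in>C. ball t (r t / 2))"
    by (rule compactE_image)
  have "C \<noteq> {}" using C(3) T_pos by force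
  define \<delta> where "\<delta> = Min ((\<lambda>t. r t / 2) ` C)"
  have "\<delta> \<in> (\<lambda>t. r t / 2) ` C"
    unfolding \<delta>_def using C(2) \<open>C \<noteq> {}\<close> by (intro Min_in) auto
  then have \<delta>: "0 < \<delta>" using r(1) C(1) by force
  have \<delta>le: "\<delta> \<le> r t / 2" if "t \<in> C" for t
    unfolding \<delta>_def by (rule Min_le) (use C(2) that in simp_all)
  have "eventually (\<lambda>k. \<forall>t\<in>C. \<forall>u\<in>{0..T}. \<forall>v\<in>{0..T}. \<bar>u - t\<bar> \<le> r t \<longrightarrow> \<bar>v - t\<bar> \<le> r t \<longrightarrow>
    prob {\<omega>\<in>space M. \<epsilon> / 2 \<le> \<bar>Y k u \<omega> - Y k v \<omega>\<bar>} \<le> \<epsilon> / 2) sequentially"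
    using C r(2) unfolding small_def by (intro eventually_ball_finite) auto
  then have "eventually (\<lambda>k. \<forall>u\<in>{0..T}. \<forall>v\<in>{0..T}. \<bar>u - v\<bar> < \<delta> \<longrightarrow>
    (\<integral>\<omega>. abs_ramp (Y k u \<omega> - Y k v \<omega>) \<partial>M) \<le> \<epsilon>) sequentially"
  proof eventually_elim
    case (elim k)
    show ?case
    proof (intro ballI impI)
      fix u v assume uv: "u \<in> {0..T}" "v \<in> {0..T}" "\<bar>u - v\<bar> < \<delta>"
      obtain t where t: "t \<in> C" "\<bar>u - t\<bar> < r t / 2"
        using C(3) uv(1) by (fastforce simp: dist_real_def abs_minus_commute)
      have rt: "\<bar>u - t\<bar> \<le> r t" "\<bar>v - t\<bar> \<le> r t" using t(2) \<delta>le[OF t(1)] uv(3) by linarith+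
      let ?E = "{\<omega>\<in>space M. \<epsilon> / 2 \<le> \<bar>Y k u \<omega> - Y k v \<omega>\<bar>}"
      have dM: "(\<lambda>\<omega>. Y k u \<omega> - Y k v \<omega>) \<in> borel_measurable M"
        using Y_measurable uv by (intro borel_measurable_diff) auto
      then have "(\<lambda>\<omega>. \<bar>Y k u \<omega> - Y k v \<omega>\<bar>) \<in> borel_measurable M" by (rule borel_measurable_abs)
      then have E: "?E \<in> events" unfolding borel_measurable_iff_ge by (rule spec)
      have i1: "integrable M (indicat_real ?E)"
        using E by (intro integrable_indicator_event) auto
      have "(\<integral>\<omega>. abs_ramp (Y k u \<omega> - Y k v \<omega>) \<partial>M) \<le> (\<integral>\<omega>. \<epsilon> / 2 + indicator ?E \<omega> \<partial>M)"
      proof (rule integral_mono)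
        show "integrable M (\<lambda>\<omega>. abs_ramp (Y k u \<omega> - Y k v \<omega>))"
          using abs_ramp_range measurable_compose[OF dM borel_measurable_continuous_onI[OF continuous_abs_ramp]]
          by (intro integrable_const_bound[of _ 1]) auto
        show "integrable M (\<lambda>\<omega>. \<epsilon> / 2 + indicator ?E \<omega>)" using i1 by simp
        show "abs_ramp (Y k u \<omega> - Y k v \<omega>) \<le> \<epsilon> / 2 + indicator ?E \<omega>" if "\<omega> \<in> space M" for \<omega>
          using that e by (auto simp: abs_ramp_def ramp_def indicator_def min_def max_def)
      qed
      also have "\<dots> = \<epsilon> / 2 + prob ?E" using i1 E prob_space by simp
      also have "\<dots> \<le> \<epsilon>" using elim[rule_format, OF t(1) uv(1,2) rt] by simp
      finally show "(\<integral>\<omega>. abs_ramp (Y k u \<omega> - Y k v \<omega>) \<partial>M) \<le> \<epsilon>" .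
    qed
  qed
  then show ?thesis using \<delta> by blast
qed

text \<open>Paths near a bounded path are bounded.\<close>

lemma compact_containment:
  assumes "0 < \<eta>"
  shows "\<exists>R>0. eventually (\<lambda>k. \<forall>E\<in>events. (\<forall>\<omega>\<in>E. \<exists>t\<in>{0..T}. R \<le> \<bar>Y k t \<omega>\<bar>) \<longrightarrow> prob E \<le> \<eta>) sequentially"
proof -
  define bad where "bad m = {y :: real \<Rightarrow> real. \<exists>t\<in>{0..T}. real (Suc m) \<le> \<bar>y t\<bar>}" for m
  have "AE \<omega> in M. \<exists>m0. \<forall>m\<ge>m0. \<forall>y\<in>skorokhod_space T.
      skorokhod_dist T (Xpath \<omega>) y < 1 / real (Suc m) \<longrightarrow> y \<notin> bad m"
  proof (rule AE_I2)
    fix \<omega> assume \<omega>: "\<omega> \<in> space M"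
    let ?x = "Xpath \<omega>"
    have x: "?x \<in> skorokhod_space T" using \<omega> by (simp add: path_in_skorokhod_space)
    then obtain B where B: "\<And>t. t \<in> {0..T} \<Longrightarrow> \<bar>?x t\<bar> \<le> B"
      using cadlag_on_bounded[of T ?x] unfolding skorokhod_space_def by blast
    obtain m0 :: nat where m0: "B < real m0" using reals_Archimedean2 by blast
    show "\<exists>m0. \<forall>m\<ge>m0. \<forall>y\<in>skorokhod_space T. skorokhod_dist T ?x y < 1 / real (Suc m) \<longrightarrow> y \<notin> bad m"
    proof (intro exI[of _ m0] allI impI ballI notI)
      fix m y assume m: "m0 \<le> m" and y: "y \<in> skorokhod_space T" "skorokhod_dist T ?x y < 1 / real (Suc m)"
        and "y \<in> bad m"
      then obtain s where s: "s \<in> {0..T}" "real (Suc m) \<le> \<bar>y s\<bar>" unfolding bad_def by blast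
      obtain u where u: "u \<in> {0..T}" "\<bar>y s - ?x u\<bar> < 1 / real (Suc m)"
        using skorokhod_close_value[OF x y s(1)] by blast
      have "1 / real (Suc m) \<le> 1" by simp
      then show False using u(2) B[OF u(1)] s(2) m m0 by linarith
    qed
  qed
  from negligible_path_sets[OF this assms] obtain m where
    m: "eventually (\<lambda>k. \<forall>E\<in>events. E \<subseteq> path_event (Y k) (bad m) \<longrightarrow> prob E \<le> \<eta>) sequentially" by blast
  show ?thesis
  proof (intro exI[of _ "real (Suc m)"] conjI)
    show "eventually (\<lambda>k. \<forall>E\<in>events. (\<forall>\<omega>\<in>E. \<exists>t\<in>{0..T}. real (Suc m) \<le> \<bar>Y k t \<omega>\<bar>) \<longrightarrow> prob E \<le> \<eta>) sequentially"
      using m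
    proof eventually_elim
      case (elim k)
      show ?case
      proof (intro ballI impI)
        fix E assume E: "E \<in> events" "\<forall>\<omega>\<in>E. \<exists>t\<in>{0..T}. real (Suc m) \<le> \<bar>Y k t \<omega>\<bar>"
        have "E \<subseteq> path_event (Y k) (bad m)"
        proof
          fix \<omega> assume \<omega>: "\<omega> \<in> E"
          then obtain t where t: "t \<in> {0..T}" "real (Suc m) \<le> \<bar>Y k t \<omega>\<bar>" using E(2) by blast
          then have "Ypath k \<omega> \<in> bad m"
            unfolding bad_def by (intro CollectI bexI[OF _ t(1)]) (simp add: sample_path_eval[OF t(1)])
          then show "\<omega> \<in> path_event (Y k) (bad m)"
            using \<omega> sets.sets_into_space[OF E(1)] by (auto simp: path_event_def)
        qed
        then show "prob E \<le> \<eta>" using elim E(1) by blast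
      qed
    qed
  qed simp
qed

end

section \<open>Rewards of the limit are approximated\<close>

lemma (in prob_space) integral_abs_le:
  fixes f :: "'a \<Rightarrow> real"
  assumes "\<And>\<omega>. \<omega> \<in> space M \<Longrightarrow> \<bar>f \<omega>\<bar> \<le> B" "0 \<le> B"
  shows "(\<integral>\<omega>. f \<omega> \<partial>M) \<le> B"
proof (cases "integrable M f")
  case True
  have "(\<integral>\<omega>. f \<omega> \<partial>M) \<le> (\<integral>\<omega>. B \<partial>M)"
    using assms(1) by (intro integral_mono True) (auto simp: abs_le_iff)
  then show ?thesis by (simp add: prob_space)
qed (simp add: not_integrable_integral_eq assms)

locale bounded_reward_limit = skorokhod_law_limit +
  fixes \<gamma> :: "real \<times> real \<Rightarrow> real" and B :: real
  assumes \<gamma>_cont: "continuous_on ({0..T} \<times> UNIV) \<gamma>"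
    and B_pos: "0 < B" and \<gamma>_bound: "\<And>t x. t \<in> {0..T} \<Longrightarrow> \<bar>\<gamma> (t, x)\<bar> \<le> B"
begin

lemma \<gamma>_section: "t \<in> {0..T} \<Longrightarrow> continuous_on UNIV (\<lambda>x. \<gamma> (t, x))"
  by (rule continuous_on_compose2[OF \<gamma>_cont]) (auto intro!: continuous_intros)

lemma \<gamma>_process_measurable:
  assumes "t \<in> {0..T}" "Z t \<in> borel_measurable M"
  shows "(\<lambda>\<omega>. \<gamma> (t, Z t \<omega>)) \<in> borel_measurable M"
  by (rule measurable_compose[OF assms(2) borel_measurable_continuous_onI[OF \<gamma>_section[OF assms(1)]]])

lemma \<gamma>_right_continuous:
  assumes Z: "cadlag_process M T Z" and \<omega>: "\<omega> \<in> space M" and s: "s \<in> {0..T}"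
  shows "continuous (at s within {s..T}) (\<lambda>t. \<gamma> (t, Z t \<omega>))"
proof -
  have rc: "continuous (at s within {s..T}) (\<lambda>t. Z t \<omega>)"
    using Z \<omega> s by (intro cadlag_on_right_continuous) (auto simp: cadlag_process_def)
  have "continuous (at s within {s..T}) (\<lambda>t. (t, Z t \<omega>))"
    by (intro continuous_intros rc)
  moreover have "continuous (at (s, Z s \<omega>) within (\<lambda>t. (t, Z t \<omega>)) ` {s..T}) \<gamma>"
  proof (rule continuous_within_subset)
    show "continuous (at (s, Z s \<omega>) within {0..T} \<times> UNIV) \<gamma>"
      using \<gamma>_cont s by (simp add: continuous_on_eq_continuous_within)
    show "(\<lambda>t. (t, Z t \<omega>)) ` {s..T} \<subseteq> {0..T} \<times> UNIV" using s by auto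
  qed
  ultimately show ?thesis
    using continuous_within_compose[of s "{s..T}" "\<lambda>t. (t, Z t \<omega>)" \<gamma>] by (simp add: o_def)
qed

lemma \<gamma>_grid_limits:
  assumes Z: "cadlag_process M T Z" and \<sigma>: "\<sigma> \<in> borel_measurable M" "\<And>\<omega>. \<omega> \<in> space M \<Longrightarrow> \<sigma> \<omega> \<in> {0..T}"
  shows "(\<lambda>\<omega>. \<gamma> (\<sigma> \<omega>, Z (\<sigma> \<omega>) \<omega>)) \<in> borel_measurable M"
    and "(\<lambda>N. \<integral>\<omega>. (\<Sum>j\<le>N. of_bool (0 < N \<and> grid_index T N (\<sigma> \<omega>) = j) * \<gamma> (grid N j, Z (grid N j) \<omega>)) \<partial>M)
      \<longlonglongrightarrow> reward M \<gamma> Z \<sigma>"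
    and "(\<lambda>N. \<integral>\<omega>. (\<Sum>j\<le>N. hat N j (\<sigma> \<omega>) * \<gamma> (grid N j, Z (grid N j) \<omega>)) \<partial>M)
      \<longlonglongrightarrow> reward M \<gamma> Z \<sigma>"
proof -
  have m: "(\<lambda>\<omega>. \<gamma> (t, Z t \<omega>)) \<in> borel_measurable M" if "t \<in> {0..T}" for t
    using \<gamma>_process_measurable[OF that, of Z] Z that by (auto simp: cadlag_process_def)
  show "(\<lambda>\<omega>. \<gamma> (\<sigma> \<omega>, Z (\<sigma> \<omega>) \<omega>)) \<in> borel_measurable M"
    by (rule random_time_grid_limits(1)[OF prob_space_axioms T_pos m \<gamma>_right_continuous[OF Z] \<gamma>_bound \<sigma>])
  show "(\<lambda>N. \<integral>\<omega>. (\<Sum>j\<le>N. of_bool (0 < N \<and> grid_index T N (\<sigma> \<omega>) = j) * \<gamma> (grid N j, Z (grid N j) \<omega>)) \<partial>M)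
      \<longlonglongrightarrow> reward M \<gamma> Z \<sigma>"
    unfolding reward_def
    by (rule random_time_grid_limits(2)[where f = "\<lambda>t \<omega>. \<gamma> (t, Z t \<omega>)",
          OF prob_space_axioms T_pos m \<gamma>_right_continuous[OF Z] \<gamma>_bound \<sigma>])
  show "(\<lambda>N. \<integral>\<omega>. (\<Sum>j\<le>N. hat N j (\<sigma> \<omega>) * \<gamma> (grid N j, Z (grid N j) \<omega>)) \<partial>M)
      \<longlonglongrightarrow> reward M \<gamma> Z \<sigma>"
    unfolding reward_def
    by (rule random_time_grid_limits(3)[where f = "\<lambda>t \<omega>. \<gamma> (t, Z t \<omega>)",
          OF prob_space_axioms T_pos m \<gamma>_right_continuous[OF Z] \<gamma>_bound \<sigma>])
qed

lemma ae_continuous_\<gamma>_eval: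
  assumes t: "t \<in> {0..T}"
  shows "ae_continuous (\<lambda>y. \<gamma> (t, y t))"
  unfolding ae_continuous_def using ae_continuous_eval[OF t, unfolded ae_continuous_def]
proof eventually_elim
  case (elim \<omega>)
  have "isCont (\<lambda>x. \<gamma> (t, x)) (Xpath \<omega> t)"
    using \<gamma>_section[OF t] by (simp add: continuous_on_eq_continuous_at)
  from isCont_tendsto_compose[OF this elim] show ?case .
qed

lemma reward_measurable_sample:
  assumes t: "t \<in> {0..T}" and Z: "cadlag_process M T Z"
  shows "(\<lambda>\<omega>. \<gamma> (t, sample_path T Z \<omega> t)) \<in> borel_measurable M"
  unfolding sample_path_eval[OF t]
  by (rule \<gamma>_process_measurable[OF t]) (use Z t in \<open>simp add: cadlag_process_def\<close>)

definition first_entry :: "(nat \<Rightarrow> (real \<Rightarrow> real) set) \<Rightarrow> nat \<Rightarrow> (real \<Rightarrow> real) set" where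
  "first_entry S j = S j \<inter> (\<Inter>i<j. - S i)"

lemma first_entry_iff:
  assumes "y \<in> S N"
  shows "y \<in> first_entry S j \<longleftrightarrow> j = (LEAST i. y \<in> S i)"
proof
  assume "y \<in> first_entry S j"
  then have j: "y \<in> S j" "\<And>i. i < j \<Longrightarrow> y \<notin> S i" by (auto simp: first_entry_def)
  have "(LEAST i. y \<in> S i) = j"
  proof (rule Least_equality)
    show "y \<in> S j" by (rule j(1))
    show "j \<le> i" if "y \<in> S i" for i using j(2)[of i] that by (cases "i < j") auto
  qed
  then show "j = (LEAST i. y \<in> S i)" by simp
next
  assume j: "j = (LEAST i. y \<in> S i)"
  have "y \<in> S j" unfolding j by (rule LeastI[of "\<lambda>i. y \<in> S i", OF assms])
  moreover have "y \<notin> S i" if "i < j" for i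
    using not_less_Least[of i "\<lambda>i. y \<in> S i"] that j by blast
  ultimately show "y \<in> first_entry S j" by (simp add: first_entry_def)
qed

lemma continuity_event_mono:
  assumes "continuity_event \<G> S" "\<And>Z. sets (\<G> Z) \<subseteq> sets (\<G>' Z)"
  shows "continuity_event \<G>' S"
  using assms unfolding continuity_event_def by blast

text \<open>The first entry at index \<open>j\<close> involves only the sets up to \<open>j\<close>, which look at the past of earlier times.\<close>

lemma continuity_event_first_entry:
  assumes S: "\<And>j. j \<le> N \<Longrightarrow> continuity_event (past (c j)) (S j)"
    and c: "\<And>i j. i \<le> j \<Longrightarrow> c i \<le> c j" and j: "j \<le> N"
  shows "continuity_event (past (c j)) (first_entry S j)"
proof -
  have "continuity_event (past (c j)) (\<Inter>i<n. - S i)" if "n \<le> j" for n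
    using that
  proof (induction n)
    case 0
    have "continuity_event (past (c j)) UNIV" by (rule continuity_event_UNIV) simp
    then show ?case by simp
  next
    case (Suc n)
    have "continuity_event (past (c n)) (- S n)"
      using Suc.prems j by (intro continuity_event_Compl S) auto
    then have "continuity_event (past (c j)) (- S n)"
      by (rule continuity_event_mono) (use Suc.prems in \<open>intro natural_filtration_mono c, simp\<close>)
    moreover have "(\<Inter>i<Suc n. - S i) = - S n \<inter> (\<Inter>i<n. - S i)" by (auto simp: lessThan_Suc)
    ultimately show ?case using Suc by (simp add: continuity_event_Int)
  qed
  from continuity_event_Int[OF S[OF j] this[OF order_refl]] show ?thesis unfolding first_entry_def .
qed

lemma first_entry_stopping_time:
  fixes N :: nat
  assumes S: "\<And>j. j \<le> N \<Longrightarrow> continuity_event (past (c j)) (S j)" and SN: "S N = UNIV"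
    and c: "\<And>i j. i \<le> j \<Longrightarrow> c i \<le> c j" "\<And>j. c j \<in> {0..T}"
  shows "(\<lambda>\<omega>. c (LEAST i. sample_path T Z \<omega> \<in> S i)) \<in> stopping_times M T (natural_filtration M Z)"
proof -
  let ?J = "\<lambda>\<omega>. LEAST i. sample_path T Z \<omega> \<in> S i"
  have J: "?J \<omega> \<le> N" for \<omega> by (rule Least_le) (simp add: SN)
  have "{\<omega>\<in>space M. c (?J \<omega>) \<le> t} \<in> sets (natural_filtration M Z t)" for t
  proof -
    have "{\<omega>\<in>space M. c (?J \<omega>) \<le> t} = (\<Union>j\<in>{j. j \<le> N \<and> c j \<le> t}. path_event Z (first_entry S j))"
      using J by (auto simp: path_event_def first_entry_iff[of _ S N] SN)
    also have "\<dots> \<in> sets (natural_filtration M Z t)"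
    proof (intro sets.finite_UN ballI)
      fix j assume j: "j \<in> {j. j \<le> N \<and> c j \<le> t}"
      then have "path_event Z (first_entry S j) \<in> sets (natural_filtration M Z (c j))"
        using continuity_event_first_entry[of N c S j] S c(1) by (auto simp: continuity_event_def)
      then show "path_event Z (first_entry S j) \<in> sets (natural_filtration M Z t)"
        using j natural_filtration_mono[of "c j" t M Z] by auto
    qed simp
    finally show ?thesis .
  qed
  then show ?thesis using c(2) by (simp add: stopping_times_def stopping_time_def pred_def)
qed

lemma path_event_cadlag_in_events:
  assumes "continuity_event (past t) S" "t \<le> T" "cadlag_process M T Z"
  shows "path_event Z S \<in> events"
proof -
  have "path_event Z S \<in> sets (natural_filtration M Z t)" using assms(1) by (simp add: continuity_event_def)
  then show ?thesis using natural_filtration_subalgebra[OF assms(3,2)] unfolding subalgebra_def by blast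
qed

text \<open>The grid events \<open>A j\<close> (the rounded time is at most the \<open>j\<close>-th grid time) lie in the natural filtration at the
\<open>j\<close>-th assigned time and are approximated by sets of paths \<open>S j\<close>. The competing time for \<open>Y k\<close> stops at the first \<open>j\<close> with
path in \<open>S j\<close>. For \<open>X\<close>, this rule differs from the rounded time only on the approximation errors \<open>d j\<close>, and its
reward for \<open>Y k\<close> converges to its reward for \<open>X\<close>, because it is a finite sum of almost surely continuous functionals.\<close>

lemma value_lower_bound:
  assumes \<sigma>: "\<sigma> \<in> stopping_times M T (right_cont_filtration M T X)" and "0 < \<epsilon>"
  shows "eventually (\<lambda>k. \<exists>\<sigma>'\<in>stopping_times M T (natural_filtration M (Y k)).
    reward M \<gamma> X \<sigma> \<le> reward M \<gamma> (Y k) \<sigma>' + \<epsilon>) sequentially"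
proof -
  have \<sigma>M: "\<sigma> \<in> borel_measurable M"
    using right_cont_filtration_subalgebra[OF cadlag_X] \<sigma>
    by (intro stopping_times_measurable[where T = T and F = "right_cont_filtration M T X"]) simp_all
  have \<sigma>T: "\<sigma> \<omega> \<in> {0..T}" if "\<omega> \<in> space M" for \<omega>
    using \<sigma> that by (simp add: stopping_times_def)
  let ?Sig = "\<lambda>N. \<integral>\<omega>. (\<Sum>j\<le>N. of_bool (0 < N \<and> grid_index T N (\<sigma> \<omega>) = j) * \<gamma> (grid N j, X (grid N j) \<omega>)) \<partial>M"
  have "?Sig \<longlonglongrightarrow> reward M \<gamma> X \<sigma>"
    by (rule \<gamma>_grid_limits(2)[OF cadlag_X \<sigma>M \<sigma>T])
  then have "eventually (\<lambda>N. reward M \<gamma> X \<sigma> - \<epsilon> / 3 < ?Sig N \<and> 0 < N) sequentially"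
    using \<open>0 < \<epsilon>\<close> by (intro eventually_conj order_tendstoD(1) eventually_gt_at_top) auto
  then obtain N where N: "reward M \<gamma> X \<sigma> - \<epsilon> / 3 < ?Sig N" "0 < N"
    by (auto simp: eventually_sequentially)
  define c where "c = grid N"
  have c: "c j \<in> {0..T}" "i \<le> j \<Longrightarrow> c i \<le> c j" for i j
    unfolding c_def using clamped_grid_range[OF T_pos] clamped_grid_mono[OF T_pos] by auto
  have cT: "c j \<le> T" for j using c(1)[of j] by simp
  define J where "J \<omega> = grid_index T N (\<sigma> \<omega>)" for \<omega>
  define A where "A j = {\<omega>\<in>space M. J \<omega> \<le> j}" for j
  \<comment> \<open>the \<open>N + 1\<close> errors cost at most \<open>2 * B\<close> each and sum up to \<open>\<epsilon> / 3\<close>\<close>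
  define \<eta> where "\<eta> = \<epsilon> / (6 * B * real (Suc N))"
  have \<eta>: "0 < \<eta>" using \<open>0 < \<epsilon>\<close> B_pos by (simp add: \<eta>_def)
  have AN: "A N = space M" using grid_index_le[OF T_pos N(2) \<sigma>T] by (auto simp: A_def J_def)
  have A: "A j \<in> sets (natural_filtration M X (c j))" if "j < N" for j
  proof -
    let ?t = "T * real j / real N"
    have "?t < T" using that T_pos N by (simp add: field_simps)
    have "?t < c j" using that T_pos N by (auto simp: c_def clamped_grid_def intro!: divide_strict_right_mono)
    have "{\<omega>\<in>space M. \<sigma> \<omega> \<le> ?t} \<in> sets (right_cont_filtration M T X ?t)"
      using \<sigma> unfolding stopping_times_def stopping_time_def pred_def by auto
    then have "{\<omega>\<in>space M. \<sigma> \<omega> \<le> ?t} \<in> sets (natural_filtration M X (c j))"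
      unfolding sets_right_cont_filtration_iff[OF \<open>?t < T\<close>] using \<open>?t < c j\<close> cT[of j] by simp
    then show ?thesis unfolding A_def J_def grid_index_le_iff[OF T_pos N(2)] .
  qed
  \<comment> \<open>at the last index the set is everything, so that the rule stops at \<open>T\<close> at the latest\<close>
  define good where "good j S \<longleftrightarrow> continuity_event (past (c j)) S \<and>
      prob ((A j - path_event X S) \<union> (path_event X S - A j)) < \<eta> \<and> (j = N \<longrightarrow> S = UNIV)" for j S
  have "\<exists>S. \<forall>j\<in>{..N}. good j (S j)"
  proof (intro bchoice ballI)
    fix j assume j: "j \<in> {..N}"
    show "\<exists>S. good j S"
    proof (cases "j = N")
      case True
      have "path_event X UNIV = space M" by (simp add: path_event_def)
      then show ?thesis
        using True AN \<eta> by (intro exI[of _ UNIV]) (auto simp: good_def intro: continuity_event_UNIV)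
    next
      case False
      let ?R = "{path_event X S |S. continuity_event (past (c j)) S}"
      have "?R \<subseteq> events" using path_event_cadlag_in_events[OF _ cT cadlag_X] by blast
      moreover have "A j \<in> sigma_sets (space M) ?R"
        using A[of j] False j natural_filtration_generated_by_continuity_events[OF cT[of j]] by auto
      moreover have "algebra (space M) ?R" by (rule continuity_event_algebra) simp
      ultimately obtain E where "E \<in> ?R" "prob ((A j - E) \<union> (E - A j)) < \<eta>"
        using algebra_approximates_sigma_algebra[of ?R "A j" \<eta>] \<eta> by blast
      then show ?thesis using False by (auto simp: good_def)
    qed
  qed
  then obtain S where S: "\<And>j. j \<le> N \<Longrightarrow> good j (S j)" by auto
  have Sc: "continuity_event (past (c j)) (S j)" if "j \<le> N" for j
    using S[OF that] by (simp add: good_def)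
  have SN: "S N = UNIV" using S[of N] by (simp add: good_def)
  define d where "d j = (A j - path_event X (S j)) \<union> (path_event X (S j) - A j)" for j
  have dp: "prob (d j) < \<eta>" if "j \<le> N" for j using S[OF that] by (simp add: good_def d_def)
  have AM: "A j \<in> events" if "j \<le> N" for j
    using A[of j] AN natural_filtration_subalgebra[OF cadlag_X cT[of j]] that
    by (cases "j = N") (auto simp: subalgebra_def)
  have dM: "d j \<in> events" if "j \<le> N" for j
    unfolding d_def using AM[OF that] path_event_cadlag_in_events[OF Sc[OF that] cT cadlag_X] by auto
  define D where "D = first_entry S"
  have Dc: "continuity_event (past (c j)) (D j)" if "j \<le> N" for j
    unfolding D_def using Sc c(2) that by (intro continuity_event_first_entry) auto
  define g where "g j y = of_bool (y \<in> D j) * \<gamma> (c j, y (c j))" for j y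
  define f where "f j \<omega> = \<gamma> (c j, X (c j) \<omega>)" for j \<omega>
  have fM: "f j \<in> borel_measurable M" for j
    unfolding f_def[abs_def]
    by (rule \<gamma>_process_measurable[where Z = X and t = "c j"]) (simp_all only: c(1) X_measurable[OF c(1)])
  have fB: "\<bar>f j \<omega>\<bar> \<le> B" for j \<omega> unfolding f_def by (rule \<gamma>_bound[OF c(1)])
  have gM: "(\<lambda>\<omega>. g j (sample_path T Z \<omega>)) \<in> borel_measurable M" if "j \<le> N" "cadlag_process M T Z" for j Z
  proof -
    have "indicat_real (path_event Z (D j)) \<in> borel_measurable M"
      using path_event_cadlag_in_events[OF Dc[OF that(1)] cT that(2)] by simp
    then have "(\<lambda>\<omega>. of_bool (sample_path T Z \<omega> \<in> D j) :: real) \<in> borel_measurable M"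
      by (simp cong: measurable_cong add: path_event_indicator)
    then show ?thesis
      unfolding g_def using reward_measurable_sample[OF c(1) that(2)] by (intro borel_measurable_times)
  qed
  have gB: "\<bar>g j y\<bar> \<le> B" for j y
    using \<gamma>_bound[OF c(1), of j "y (c j)"] B_pos by (auto simp: g_def)
  have gc: "ae_continuous (g j)" if "j \<le> N" for j
  proof -
    have "ae_continuous (\<lambda>y. of_bool (y \<in> D j))" using Dc[OF that] by (simp add: continuity_event_def)
    then show ?thesis
      using ae_continuous_\<gamma>_eval[OF c(1)[of j]] unfolding ae_continuous_def g_def
      by eventually_elim (intro tendsto_intros)
  qed
  define \<sigma>' where "\<sigma>' k \<omega> = c (LEAST i. Ypath k \<omega> \<in> S i)" for k \<omega>
  have \<sigma>': "\<sigma>' k \<in> stopping_times M T (natural_filtration M (Y k))" for k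
    unfolding \<sigma>'_def[abs_def] using Sc SN c by (intro first_entry_stopping_time[where N=N]) auto
  have sum_first: "(\<Sum>j\<le>N. of_bool (y \<in> D j) * h j) = h (LEAST i. y \<in> S i)" for y and h :: "nat \<Rightarrow> real"
  proof -
    have le: "(LEAST i. y \<in> S i) \<le> N" by (rule Least_le) (simp add: SN)
    have "(\<Sum>j\<le>N. of_bool (y \<in> D j) * h j) = (\<Sum>j\<in>{LEAST i. y \<in> S i}. h j)"
      using le by (intro sum.mono_neutral_cong_right) (auto simp: D_def first_entry_iff[of y S N] SN)
    then show ?thesis by simp
  qed
  have rew: "reward M \<gamma> (Y k) (\<sigma>' k) = (\<Sum>j\<le>N. \<integral>\<omega>. g j (Ypath k \<omega>) \<partial>M)" for k
  proof -
    have "\<gamma> (\<sigma>' k \<omega>, Y k (\<sigma>' k \<omega>) \<omega>) = (\<Sum>j\<le>N. g j (Ypath k \<omega>))" for \<omega>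
      unfolding g_def sum_first[of "Ypath k \<omega>" "\<lambda>j. \<gamma> (c j, Ypath k \<omega> (c j))"] \<sigma>'_def
      by (simp add: sample_path_eval[OF c(1)])
    then show ?thesis
      unfolding reward_def using gM[OF _ cadlag_Y] gB
      by (subst Bochner_Integration.integral_sum[symmetric]) (auto intro!: integrable_const_bound[of _ B])
  qed
  have "(\<lambda>k. \<integral>\<omega>. g j (Ypath k \<omega>) \<partial>M) \<longlonglongrightarrow> (\<integral>\<omega>. g j (Xpath \<omega>) \<partial>M)" if "j \<le> N" for j
    using weighted_functional_limit[of "\<lambda>_. 1" "g j" B] gc[OF that] gB gM[OF that] cadlag_X cadlag_Y by simp
  then have lim: "(\<lambda>k. reward M \<gamma> (Y k) (\<sigma>' k)) \<longlonglongrightarrow> (\<Sum>j\<le>N. \<integral>\<omega>. g j (Xpath \<omega>) \<partial>M)"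
    unfolding rew by (intro tendsto_sum) auto
  have gX: "g j (Xpath \<omega>) = of_bool (Xpath \<omega> \<in> D j) * f j \<omega>" for j \<omega>
    by (simp add: g_def f_def sample_path_eval[OF c(1)])
  have J1: "(\<Sum>j\<le>N. of_bool (0 < N \<and> J \<omega> = j) * f j \<omega>) = f (J \<omega>) \<omega>" if "\<omega> \<in> space M" for \<omega>
  proof -
    have le: "J \<omega> \<le> N" using grid_index_le[OF T_pos N(2) \<sigma>T[OF that]] by (simp add: J_def)
    have "(\<Sum>j\<le>N. of_bool (0 < N \<and> J \<omega> = j) * f j \<omega>) = (\<Sum>j\<in>{J \<omega>}. f j \<omega>)"
      using le N by (intro sum.mono_neutral_cong_right) auto
    then show ?thesis by simp
  qed
  have gXi: "integrable M (\<lambda>\<omega>. g j (Xpath \<omega>))" if "j \<le> N" for j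
    using gM[OF that cadlag_X] gB by (intro integrable_const_bound[of _ B]) auto
  have di: "integrable M (indicat_real (d j))" if "j \<le> N" for j
    using dM[OF that] by (intro integrable_indicator_event) auto
  define U where "U \<omega> = (\<Sum>j\<le>N. of_bool (0 < N \<and> J \<omega> = j) * f j \<omega>)" for \<omega>
  have UM: "U \<in> borel_measurable M"
    unfolding U_def
  proof (rule borel_measurable_sum, rule borel_measurable_times)
    fix j
    show "(\<lambda>\<omega>. of_bool (0 < N \<and> J \<omega> = j) :: real) \<in> borel_measurable M"
      unfolding J_def by (rule measurable_compose[OF \<sigma>M grid_index_weights(1)[OF T_pos]])
    show "(\<lambda>\<omega>. f j \<omega>) \<in> borel_measurable M" by (rule fM)
  qed
  have U: "U \<omega> = f (J \<omega>) \<omega>" if "\<omega> \<in> space M" for \<omega> unfolding U_def by (rule J1[OF that])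
  have "?Sig N = (\<integral>\<omega>. U \<omega> \<partial>M)" by (simp only: U_def J_def f_def c_def)
  also have "\<dots> \<le> (\<integral>\<omega>. (\<Sum>j\<le>N. g j (Xpath \<omega>)) + (\<Sum>j\<le>N. 2 * B * indicator (d j) \<omega>) \<partial>M)"
  proof (rule integral_mono_AE)
    have "AE \<omega> in M. norm (U \<omega>) \<le> B" using U fB by (intro AE_I2) simp
    then show "integrable M U" using UM by (rule integrable_const_bound)
    show "integrable M (\<lambda>\<omega>. (\<Sum>j\<le>N. g j (Xpath \<omega>)) + (\<Sum>j\<le>N. 2 * B * indicator (d j) \<omega>))"
      using gXi di by (intro Bochner_Integration.integrable_add Bochner_Integration.integrable_sum integrable_mult_right) auto
    show "AE \<omega> in M. U \<omega> \<le> (\<Sum>j\<le>N. g j (Xpath \<omega>)) + (\<Sum>j\<le>N. 2 * B * indicator (d j) \<omega>)"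
    proof (rule AE_I2)
      fix \<omega> assume \<omega>: "\<omega> \<in> space M"
      let ?L = "LEAST i. Xpath \<omega> \<in> S i"
      have "f (J \<omega>) \<omega> \<le> f ?L \<omega> + (\<Sum>j\<le>N. 2 * B * indicator (d j) \<omega>)"
      proof (cases "\<exists>j\<le>N. \<omega> \<in> d j")
        case True
        then obtain j where j: "j \<le> N" "\<omega> \<in> d j" by blast
        have "2 * B * indicator (d j) \<omega> \<le> (\<Sum>j\<le>N. 2 * B * indicator (d j) \<omega>)"
          using j B_pos by (intro member_le_sum) (auto simp: indicator_def)
        then show ?thesis using j fB[of "J \<omega>" \<omega>] fB[of ?L \<omega>] by (simp add: abs_le_iff)
      next
        case False
        then have iff: "Xpath \<omega> \<in> S j \<longleftrightarrow> J \<omega> \<le> j" if "j \<le> N" for j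
          using that \<omega> by (auto simp: d_def A_def path_event_def)
        have le: "J \<omega> \<le> N" using grid_index_le[OF T_pos N(2) \<sigma>T[OF \<omega>]] by (simp add: J_def)
        have "?L = J \<omega>"
        proof (rule Least_equality)
          show "Xpath \<omega> \<in> S (J \<omega>)" using iff[OF le] by simp
          fix i assume i: "Xpath \<omega> \<in> S i"
          show "J \<omega> \<le> i"
          proof (cases "i \<le> N")
            case True then show ?thesis using i iff by blast
          qed (use le in simp)
        qed
        then show ?thesis using B_pos by (simp add: sum_nonneg)
      qed
      moreover have "(\<Sum>j\<le>N. g j (Xpath \<omega>)) = f ?L \<omega>"
        unfolding gX by (rule sum_first)
      ultimately show "U \<omega> \<le> (\<Sum>j\<le>N. g j (Xpath \<omega>)) + (\<Sum>j\<le>N. 2 * B * indicator (d j) \<omega>)"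
        using U[OF \<omega>] by simp
    qed
  qed
  also have "\<dots> = (\<Sum>j\<le>N. \<integral>\<omega>. g j (Xpath \<omega>) \<partial>M) + (\<Sum>j\<le>N. 2 * B * prob (d j))"
  proof -
    have i1: "integrable M (\<lambda>\<omega>. \<Sum>j\<le>N. g j (Xpath \<omega>))"
      by (rule Bochner_Integration.integrable_sum) (use gXi in simp)
    have i2: "integrable M (\<lambda>\<omega>. 2 * B * indicator (d j) \<omega>)" if "j \<le> N" for j
      using di[OF that] by (rule integrable_mult_right)
    have i3: "integrable M (\<lambda>\<omega>. \<Sum>j\<le>N. 2 * B * indicator (d j) \<omega>)"
      by (rule Bochner_Integration.integrable_sum) (use i2 in simp)
    have "(\<integral>\<omega>. (\<Sum>j\<le>N. 2 * B * indicator (d j) \<omega>) \<partial>M) = (\<Sum>j\<le>N. \<integral>\<omega>. 2 * B * indicator (d j) \<omega> \<partial>M)"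
      by (rule Bochner_Integration.integral_sum) (use i2 in simp)
    also have "\<dots> = (\<Sum>j\<le>N. 2 * B * prob (d j))"
      using dM by (intro sum.cong) auto
    moreover have "(\<integral>\<omega>. (\<Sum>j\<le>N. g j (Xpath \<omega>)) \<partial>M) = (\<Sum>j\<le>N. \<integral>\<omega>. g j (Xpath \<omega>) \<partial>M)"
      by (rule Bochner_Integration.integral_sum) (use gXi in simp)
    ultimately show ?thesis using Bochner_Integration.integral_add[OF i1 i3] by simp
  qed
  also have "(\<Sum>j\<le>N. 2 * B * prob (d j)) \<le> (\<Sum>j\<le>N. 2 * B * \<eta>)"
    using dp B_pos by (intro sum_mono mult_left_mono) (auto intro: less_imp_le)
  also have "(\<Sum>j\<le>N. 2 * B * \<eta>) = \<epsilon> / 3"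
    using B_pos by (simp add: \<eta>_def field_simps del: of_nat_Suc)
  finally have bound: "reward M \<gamma> X \<sigma> - 2 * \<epsilon> / 3 < (\<Sum>j\<le>N. \<integral>\<omega>. g j (Xpath \<omega>) \<partial>M)"
    using N(1) by simp
  have "eventually (\<lambda>k. (\<Sum>j\<le>N. \<integral>\<omega>. g j (Xpath \<omega>) \<partial>M) - \<epsilon> / 3 < reward M \<gamma> (Y k) (\<sigma>' k)) sequentially"
    using \<open>0 < \<epsilon>\<close> by (intro order_tendstoD(1)[OF lim]) simp
  then show ?thesis
  proof eventually_elim
    case (elim k)
    then have "reward M \<gamma> X \<sigma> \<le> reward M \<gamma> (Y k) (\<sigma>' k) + \<epsilon>" using bound by linarith
    then show ?case using \<sigma>' by blast
  qed
qed

end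

section \<open>Optimality of the limit\<close>

lemma continuous_modulus_on_strip:
  fixes \<gamma> :: "real \<times> real \<Rightarrow> real"
  assumes "continuous_on ({0..T} \<times> UNIV) \<gamma>" "0 < e"
  obtains \<delta> where "0 < \<delta>" "\<delta> \<le> 1"
    "\<And>s t x y. s \<in> {0..T} \<Longrightarrow> t \<in> {0..T} \<Longrightarrow> \<bar>s - t\<bar> < \<delta> \<Longrightarrow> \<bar>x - y\<bar> < \<delta> \<Longrightarrow> \<bar>y\<bar> \<le> R \<Longrightarrow>
       \<bar>\<gamma> (s, x) - \<gamma> (t, y)\<bar> < e"
proof -
  let ?K = "{0..T} \<times> {-(R+1)..R+1}"
  have "compact ?K" by (intro compact_Times) auto
  moreover have "continuous_on ?K \<gamma>" by (rule continuous_on_subset[OF assms(1)]) auto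
  ultimately have "uniformly_continuous_on ?K \<gamma>" by (rule compact_uniformly_continuous[rotated])
  then obtain d where d: "0 < d" "\<And>p q. p \<in> ?K \<Longrightarrow> q \<in> ?K \<Longrightarrow> dist p q < d \<Longrightarrow> dist (\<gamma> p) (\<gamma> q) < e"
    using \<open>0 < e\<close> unfolding uniformly_continuous_on_def by metis
  show ?thesis
  proof (rule that[of "min 1 (d / 2)"])
    fix s t x y assume *: "s \<in> {0..T}" "t \<in> {0..T}" "\<bar>s - t\<bar> < min 1 (d / 2)" "\<bar>x - y\<bar> < min 1 (d / 2)" "\<bar>y\<bar> \<le> R"
    have "dist (s, x) (t, y) \<le> dist s t + dist x y"
      unfolding dist_prod_def by (simp add: sqrt_sum_squares_le_sum)
    also have "\<dots> < d" using *(3,4) by (simp add: dist_real_def)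
    finally have "dist (s, x) (t, y) < d" .
    then have "dist (\<gamma> (s, x)) (\<gamma> (t, y)) < e" using * by (intro d(2)) auto
    then show "\<bar>\<gamma> (s, x) - \<gamma> (t, y)\<bar> < e" by (simp add: dist_real_def)
  qed (use d in auto)
qed

locale optimal_stopping_limit = bounded_reward_limit + independent_increments_limit
begin

text \<open>Replace \<open>\<rho> k\<close> by the grid times carried by the hat functions. The reward changes little if the increment over the short delay is
small and the state stays in a bounded set, on which \<open>\<gamma>\<close> is uniformly continuous; the two exceptional cases cost at
most \<open>2 * B\<close> each and have small probability by \<open>stopped_increment_bound\<close> and \<open>compact_containment\<close>. The
refinement of the grid precedes the limit in \<open>k\<close>.\<close>

lemma reward_le_grid_average:
  assumes "0 < \<epsilon>"
  shows "\<exists>N0. \<forall>N\<ge>N0. eventually (\<lambda>k. reward M \<gamma> (Y k) (\<rho> k) \<le>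
    (\<integral>\<omega>. (\<Sum>j\<le>N. hat N j (\<rho> k \<omega>) * \<gamma> (grid N j, Y k (grid N j) \<omega>)) \<partial>M) + \<epsilon>) sequentially"
proof -
  have \<eta>: "0 < \<epsilon> / (6 * B)" using assms B_pos by simp
  from compact_containment[OF \<eta>] obtain R where R:
    "eventually (\<lambda>k. \<forall>E\<in>events. (\<forall>\<omega>\<in>E. \<exists>t\<in>{0..T}. R \<le> \<bar>Y k t \<omega>\<bar>) \<longrightarrow> prob E \<le> \<epsilon> / (6 * B)) sequentially"
    by blast
  have "0 < \<epsilon> / 3" using assms by simp
  from continuous_modulus_on_strip[OF \<gamma>_cont this, of R] obtain \<delta> where \<delta>: "0 < \<delta>" "\<delta> \<le> 1"
    "\<And>s t x y. s \<in> {0..T} \<Longrightarrow> t \<in> {0..T} \<Longrightarrow> \<bar>s - t\<bar> < \<delta> \<Longrightarrow> \<bar>x - y\<bar> < \<delta> \<Longrightarrow> \<bar>y\<bar> \<le> R \<Longrightarrow>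
       \<bar>\<gamma> (s, x) - \<gamma> (t, y)\<bar> < \<epsilon> / 3" by blast
  \<comment> \<open>small increments are those below \<open>\<delta>\<close>; dividing by \<open>\<delta>\<close> as in Markov's inequality turns \<open>w\<close> into \<open>\<epsilon> / 3\<close>\<close>
  define w where "w = \<epsilon> * \<delta> / (6 * B)"
  have w: "0 < w" using assms \<delta> B_pos by (simp add: w_def)
  from equicontinuous_in_probability[OF w] obtain r where r: "0 < r"
    "eventually (\<lambda>k. \<forall>u\<in>{0..T}. \<forall>v\<in>{0..T}. \<bar>u - v\<bar> < r \<longrightarrow> (\<integral>\<omega>. abs_ramp (Y k u \<omega> - Y k v \<omega>) \<partial>M) \<le> w) sequentially"
    by blast
  obtain N0 :: nat where N0: "2 * T / min \<delta> r < real N0" using reals_Archimedean2 by blast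
  \<comment> \<open>the last two terms dominate \<open>2 * B\<close> when the increment, respectively the state, is large\<close>
  have pointwise: "\<gamma> (s, x) \<le> \<gamma> (t, y) + \<epsilon> / 3 + 2 * B / \<delta> * abs_ramp (y - x) + 2 * B * of_bool (R \<le> \<bar>y\<bar>)"
    if "s \<in> {0..T}" "t \<in> {0..T}" "\<bar>s - t\<bar> < \<delta>" for s t x y
  proof -
    have b: "\<gamma> (s, x) \<le> \<gamma> (t, y) + 2 * B"
      using \<gamma>_bound[OF that(1), of x] \<gamma>_bound[OF that(2), of y] by linarith
    have p1: "0 \<le> 2 * B / \<delta> * abs_ramp (y - x)" using B_pos \<delta>(1) abs_ramp_range by simp
    consider "R \<le> \<bar>y\<bar>" | "\<bar>x - y\<bar> \<ge> \<delta>" | "\<bar>y\<bar> \<le> R" "\<bar>x - y\<bar> < \<delta>" by linarith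
    then show ?thesis
    proof cases
      case 1 then show ?thesis using b p1 assms by simp
    next
      case 2
      then have "\<delta> \<le> abs_ramp (y - x)"
        using \<delta>(2) by (simp add: abs_ramp_def ramp_def abs_minus_commute)
      then have "2 * B / \<delta> * \<delta> \<le> 2 * B / \<delta> * abs_ramp (y - x)"
        using B_pos \<delta>(1) by (intro mult_left_mono) auto
      then have "2 * B \<le> 2 * B / \<delta> * abs_ramp (y - x)" using \<delta>(1) by simp
      moreover have "0 \<le> 2 * B * (of_bool (R \<le> \<bar>y\<bar>) :: real)" using B_pos by simp
      ultimately show ?thesis using b assms by linarith
    next
      case 3
      have "\<bar>\<gamma> (s, x) - \<gamma> (t, y)\<bar> < \<epsilon> / 3" by (rule \<delta>(3)[OF that 3(2,1)])
      moreover have "0 \<le> 2 * B * (of_bool (R \<le> \<bar>y\<bar>) :: real)" using B_pos by simp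
      ultimately show ?thesis using p1 by linarith
    qed
  qed
  show ?thesis
  proof (intro exI[of _ "max N0 1"] allI impI)
    fix N assume "max N0 1 \<le> N"
    then have N: "N0 \<le> N" "0 < N" by auto
    have m: "0 < min \<delta> r" using \<delta>(1) r(1) by simp
    have "2 * T / min \<delta> r < real N" using N0 N by linarith
    then have "2 * T < real N * min \<delta> r" by (simp only: pos_divide_less_eq[OF m])
    then have "2 * T / real N < min \<delta> r" using N(2) by (simp only: pos_divide_less_eq of_nat_0_less_iff mult.commute)
    then have small: "2 * T / real N < \<delta>" "2 * T / real N < r" by auto
    let ?c = "grid N" and ?h = "hat N"
    have c: "?c j \<in> {0..T}" for j by (rule clamped_grid_range[OF T_pos])
    show "eventually (\<lambda>k. reward M \<gamma> (Y k) (\<rho> k) \<le>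
      (\<integral>\<omega>. (\<Sum>j\<le>N. ?h j (\<rho> k \<omega>) * \<gamma> (?c j, Y k (?c j) \<omega>)) \<partial>M) + \<epsilon>) sequentially"
      using R r(2)
    proof eventually_elim
      case (elim k)
      have \<rho>M: "\<rho> k \<in> borel_measurable M"
        using natural_filtration_subalgebra[OF cadlag_Y] \<rho>_stop
        by (intro stopping_times_measurable[where T = T and F = "natural_filtration M (Y k)"]) simp_all
      note \<rho>r = \<rho>_range[of _ k]
      have hM: "(\<lambda>\<omega>. ?h j (\<rho> k \<omega>)) \<in> borel_measurable M" for j
        by (rule weight_measurable(1)[OF continuous_grid_hat[OF T_pos]])
      have hr: "0 \<le> ?h j s" "?h j s \<le> 1" for j s by (rule grid_hat_range)+
      have YM: "Y k (?c j) \<in> borel_measurable M" for j by (rule Y_measurable[OF c])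
      have \<gamma>M: "(\<lambda>\<omega>. \<gamma> (?c j, Y k (?c j) \<omega>)) \<in> borel_measurable M" for j
        by (rule \<gamma>_process_measurable[where Z = "Y k" and t = "?c j"]) (simp_all only: c YM)
      let ?D = "\<lambda>j \<omega>. abs_ramp (Y k (?c j) \<omega> - Y k (\<rho> k \<omega>) \<omega>)"
      have DM: "?D j \<in> borel_measurable M" for j
      proof (rule random_time_grid_limits(1)[OF prob_space_axioms T_pos, where f = "\<lambda>u \<omega>. abs_ramp (Y k (?c j) \<omega> - Y k u \<omega>)" and B = 1])
        fix t assume "t \<in> {0..T}"
        then have "(\<lambda>\<omega>. Y k (?c j) \<omega> - Y k t \<omega>) \<in> borel_measurable M"
          using YM Y_measurable by (intro borel_measurable_diff) auto
        then show "(\<lambda>\<omega>. abs_ramp (Y k (?c j) \<omega> - Y k t \<omega>)) \<in> borel_measurable M"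
          by (rule measurable_compose[OF _ borel_measurable_continuous_onI[OF continuous_abs_ramp]])
      next
        fix \<omega> s assume *: "\<omega> \<in> space M" "s \<in> {0..T}"
        have "continuous (at s within {s..T}) (\<lambda>u. Y k u \<omega>)"
          using cadlag_Y[of k] * by (intro cadlag_on_right_continuous) (auto simp: cadlag_process_def)
        then have d: "continuous (at s within {s..T}) (\<lambda>u. Y k (?c j) \<omega> - Y k u \<omega>)"
          by (intro continuous_intros)
        have "isCont abs_ramp x" for x using continuous_abs_ramp continuous_on_eq_continuous_at by blast
        then show "continuous (at s within {s..T}) (\<lambda>t. abs_ramp (Y k (?c j) \<omega> - Y k t \<omega>))"
          by (rule continuous_within_compose3[OF _ d])
      next
        fix \<omega> t show "\<bar>abs_ramp (Y k (?c j) \<omega> - Y k t \<omega>)\<bar> \<le> 1"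
          using abs_ramp_range by simp
      qed (use \<rho>M \<rho>r in blast)+
      have IM: "(\<lambda>\<omega>. of_bool (R \<le> \<bar>Y k (?c j) \<omega>\<bar>) :: real) \<in> borel_measurable M" for j
        using YM[of j] by measurable
      let ?a = "\<lambda>j \<omega>. ?h j (\<rho> k \<omega>) * \<gamma> (?c j, Y k (?c j) \<omega>)"
      let ?b = "\<lambda>j \<omega>. ?h j (\<rho> k \<omega>) * ?D j \<omega>"
      let ?i = "\<lambda>j \<omega>. ?h j (\<rho> k \<omega>) * of_bool (R \<le> \<bar>Y k (?c j) \<omega>\<bar>)"
      have ai: "integrable M (?a j)" for j
      proof (rule integrable_const_bound[of _ B])
        show "AE \<omega> in M. norm (?a j \<omega>) \<le> B"
        proof (rule AE_I2)
          fix \<omega>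
          have "\<bar>?h j (\<rho> k \<omega>)\<bar> * \<bar>\<gamma> (?c j, Y k (?c j) \<omega>)\<bar> \<le> 1 * B"
            using hr[of j "\<rho> k \<omega>"] \<gamma>_bound[OF c] by (intro mult_mono) auto
          then show "norm (?a j \<omega>) \<le> B" by (simp add: abs_mult)
        qed
      qed (intro borel_measurable_times hM \<gamma>M)
      have bi: "integrable M (?b j)" for j
        using hr[of j] abs_ramp_range
        by (intro integrable_const_bound[of _ 1] borel_measurable_times hM DM) (auto simp: abs_mult intro!: mult_le_one)
      have ii: "integrable M (?i j)" for j
        using hr[of j] by (intro integrable_const_bound[of _ 1] borel_measurable_times hM IM) (auto simp: abs_mult)
      have hi: "integrable M (\<lambda>\<omega>. ?h j (\<rho> k \<omega>))" for j
        using hr[of j] by (intro integrable_const_bound[of _ 1] hM) auto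
      have "reward M \<gamma> (Y k) (\<rho> k) \<le> (\<integral>\<omega>. (\<Sum>j\<le>N. ?a j \<omega>) + \<epsilon> / 3 + 2 * B / \<delta> * (\<Sum>j\<le>N. ?b j \<omega>) + 2 * B * (\<Sum>j\<le>N. ?i j \<omega>) \<partial>M)"
        unfolding reward_def
      proof (rule integral_mono)
        show "integrable M (\<lambda>\<omega>. \<gamma> (\<rho> k \<omega>, Y k (\<rho> k \<omega>) \<omega>))"
          using \<gamma>_grid_limits(1)[OF cadlag_Y \<rho>M \<rho>r] \<gamma>_bound \<rho>r by (intro integrable_const_bound[of _ B]) auto
        show "integrable M (\<lambda>\<omega>. (\<Sum>j\<le>N. ?a j \<omega>) + \<epsilon> / 3 + 2 * B / \<delta> * (\<Sum>j\<le>N. ?b j \<omega>) + 2 * B * (\<Sum>j\<le>N. ?i j \<omega>))"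
          by (intro Bochner_Integration.integrable_add integrable_const integrable_mult_right Bochner_Integration.integrable_sum ai bi ii)
        fix \<omega> assume \<omega>: "\<omega> \<in> space M"
        let ?s = "\<rho> k \<omega>"
        have s1: "(\<Sum>j\<le>N. ?h j ?s) = 1" by (rule sum_grid_hat[OF T_pos N(2) \<rho>r[OF \<omega>]])
        have "\<gamma> (?s, Y k ?s \<omega>) = (\<Sum>j\<le>N. ?h j ?s * \<gamma> (?s, Y k ?s \<omega>))"
          using s1 by (simp flip: sum_distrib_right)
        also have "\<dots> \<le> (\<Sum>j\<le>N. ?h j ?s * (\<gamma> (?c j, Y k (?c j) \<omega>) + \<epsilon> / 3 + 2 * B / \<delta> * ?D j \<omega> + 2 * B * of_bool (R \<le> \<bar>Y k (?c j) \<omega>\<bar>)))"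
        proof (rule sum_mono)
          fix j assume j: "j \<in> {..N}"
          show "?h j ?s * \<gamma> (?s, Y k ?s \<omega>) \<le> ?h j ?s * (\<gamma> (?c j, Y k (?c j) \<omega>) + \<epsilon> / 3 + 2 * B / \<delta> * ?D j \<omega> + 2 * B * of_bool (R \<le> \<bar>Y k (?c j) \<omega>\<bar>))"
          proof (cases "?h j ?s = 0")
            case False
            then have "?s \<le> ?c j" "?c j \<le> ?s + 2 * T / real N"
              using grid_hat_support[OF T_pos N(2) \<rho>r[OF \<omega>], of j] j by auto
            then have "\<bar>?s - ?c j\<bar> < \<delta>" using small(1) by linarith
            then show ?thesis by (intro mult_left_mono hr pointwise \<rho>r[OF \<omega>] c)
          qed simp
        qed
        also have "\<dots> = (\<Sum>j\<le>N. ?a j \<omega>) + (\<Sum>j\<le>N. ?h j ?s) * (\<epsilon> / 3) + 2 * B / \<delta> * (\<Sum>j\<le>N. ?b j \<omega>) + 2 * B * (\<Sum>j\<le>N. ?i j \<omega>)"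
          unfolding sum_distrib_left sum_distrib_right sum.distrib[symmetric]
          by (intro sum.cong refl) (simp only: distrib_left mult.left_commute)
        finally show "\<gamma> (?s, Y k ?s \<omega>) \<le> (\<Sum>j\<le>N. ?a j \<omega>) + \<epsilon> / 3 + 2 * B / \<delta> * (\<Sum>j\<le>N. ?b j \<omega>) + 2 * B * (\<Sum>j\<le>N. ?i j \<omega>)"
          using s1 by simp
      qed
      also have "\<dots> = (\<integral>\<omega>. (\<Sum>j\<le>N. ?a j \<omega>) \<partial>M) + \<epsilon> / 3 + 2 * B / \<delta> * (\<integral>\<omega>. (\<Sum>j\<le>N. ?b j \<omega>) \<partial>M) + 2 * B * (\<integral>\<omega>. (\<Sum>j\<le>N. ?i j \<omega>) \<partial>M)"
      proof -
        have lin: "(\<integral>\<omega>. u \<omega> + e + x * v \<omega> + y * z \<omega> \<partial>M) = (\<integral>\<omega>. u \<omega> \<partial>M) + e + x * (\<integral>\<omega>. v \<omega> \<partial>M) + y * (\<integral>\<omega>. z \<omega> \<partial>M)"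
          if "integrable M u" "integrable M v" "integrable M z" for u v z :: "'a \<Rightarrow> real" and e x y
          using that by (simp add: prob_space)
        show ?thesis
          by (rule lin; rule Bochner_Integration.integrable_sum) (rule ai bi ii)+
      qed
      also have "(\<integral>\<omega>. (\<Sum>j\<le>N. ?b j \<omega>) \<partial>M) = (\<Sum>j\<le>N. \<integral>\<omega>. ?b j \<omega> \<partial>M)"
        by (rule Bochner_Integration.integral_sum) (rule bi)
      also have "(\<Sum>j\<le>N. \<integral>\<omega>. ?b j \<omega> \<partial>M) \<le> w"
      proof -
        have "(\<integral>\<omega>. ?b j \<omega> \<partial>M) \<le> w * (\<integral>\<omega>. ?h j (\<rho> k \<omega>) \<partial>M)" if j: "j \<le> N" for j
        proof (rule stopped_increment_bound[OF prob_space_axioms T_pos cadlag_Y ind \<rho>_stop c continuous_grid_hat[OF T_pos] _ continuous_abs_ramp])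
          show "0 \<le> ?h j s \<and> ?h j s \<le> 1" for s using hr by blast
          show "0 \<le> abs_ramp x \<and> abs_ramp x \<le> 1" for x using abs_ramp_range by blast
          show "abs_ramp 0 = 0" by (simp add: abs_ramp_def ramp_def)
          fix u assume u: "u \<in> {0..T}" "?h j u \<noteq> 0"
          have "u \<le> ?c j" "?c j \<le> u + 2 * T / real N" using grid_hat_support[OF T_pos N(2) u(1) j u(2)] by auto
          then show "u \<le> ?c j \<and> (\<integral>\<omega>. abs_ramp (Y k (?c j) \<omega> - Y k u \<omega>) \<partial>M) \<le> w"
            using elim(2)[rule_format, OF c u(1), of j] small(2) by auto
        qed
        then have "(\<Sum>j\<le>N. \<integral>\<omega>. ?b j \<omega> \<partial>M) \<le> (\<Sum>j\<le>N. w * (\<integral>\<omega>. ?h j (\<rho> k \<omega>) \<partial>M))"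
          by (intro sum_mono) auto
        also have "\<dots> = w * (\<integral>\<omega>. (\<Sum>j\<le>N. ?h j (\<rho> k \<omega>)) \<partial>M)"
          using hi by (simp add: sum_distrib_left)
        also have "(\<integral>\<omega>. (\<Sum>j\<le>N. ?h j (\<rho> k \<omega>)) \<partial>M) = (\<integral>\<omega>. 1 \<partial>M)"
          using sum_grid_hat[OF T_pos N(2) \<rho>r] by (intro Bochner_Integration.integral_cong) auto
        finally show ?thesis by (simp add: prob_space)
      qed
      also have "(\<integral>\<omega>. (\<Sum>j\<le>N. ?i j \<omega>) \<partial>M) \<le> \<epsilon> / (6 * B)"
      proof -
        define E where "E = (\<Union>j\<in>{..N}. {\<omega>\<in>space M. R \<le> \<bar>Y k (?c j) \<omega>\<bar>})"
        have "{\<omega>\<in>space M. R \<le> \<bar>Y k (?c j) \<omega>\<bar>} \<in> events" for j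
          using YM[of j] by measurable
        then have E: "E \<in> events" unfolding E_def by (intro sets.finite_UN) auto
        have "(\<integral>\<omega>. (\<Sum>j\<le>N. ?i j \<omega>) \<partial>M) \<le> (\<integral>\<omega>. indicator E \<omega> \<partial>M)"
        proof (rule integral_mono)
          show "integrable M (\<lambda>\<omega>. \<Sum>j\<le>N. ?i j \<omega>)" by (intro Bochner_Integration.integrable_sum ii)
          show "integrable M (indicat_real E)" using E by (intro integrable_indicator_event) auto
          fix \<omega> assume \<omega>: "\<omega> \<in> space M"
          have "(\<Sum>j\<le>N. ?i j \<omega>) \<le> (\<Sum>j\<le>N. ?h j (\<rho> k \<omega>) * indicator E \<omega>)"
            using \<omega> hr by (intro sum_mono mult_left_mono) (auto simp: E_def indicator_def)
          also have "\<dots> = indicator E \<omega>"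
            using sum_grid_hat[OF T_pos N(2) \<rho>r[OF \<omega>]] by (simp flip: sum_distrib_right)
          finally show "(\<Sum>j\<le>N. ?i j \<omega>) \<le> indicator E \<omega>" .
        qed
        also have "\<dots> = prob E" using E by simp
        also have "\<dots> \<le> \<epsilon> / (6 * B)"
        proof (rule elim(1)[rule_format, OF E])
          fix \<omega> assume "\<omega> \<in> E"
          then show "\<exists>t\<in>{0..T}. R \<le> \<bar>Y k t \<omega>\<bar>" unfolding E_def using c by blast
        qed
        finally show ?thesis .
      qed
      finally have "reward M \<gamma> (Y k) (\<rho> k) \<le> (\<integral>\<omega>. (\<Sum>j\<le>N. ?a j \<omega>) \<partial>M) + \<epsilon> / 3 + 2 * B / \<delta> * w + 2 * B * (\<epsilon> / (6 * B))"
        using B_pos \<delta>(1) by (simp add: divide_right_mono mult_left_mono)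
      also have "\<dots> = (\<integral>\<omega>. (\<Sum>j\<le>N. ?a j \<omega>) \<partial>M) + \<epsilon>"
        using B_pos \<delta>(1) by (simp add: w_def field_simps)
      finally show ?case .
    qed
  qed
qed

text \<open>On a fixed grid the averaged reward is a continuous function of \<open>\<rho> k\<close> and an almost surely continuous function of the path, so
it converges. Equality almost everywhere lets the limit be computed with \<open>\<tau>'\<close>, which takes values in the interval everywhere.\<close>

lemma reward_upper_bound:
  assumes \<tau>': "\<tau>' \<in> borel_measurable M" "\<And>\<omega>. \<omega> \<in> space M \<Longrightarrow> \<tau>' \<omega> \<in> {0..T}" "AE \<omega> in M. \<tau> \<omega> = \<tau>' \<omega>"
    and "0 < \<epsilon>"
  shows "eventually (\<lambda>k. reward M \<gamma> (Y k) (\<rho> k) \<le> reward M \<gamma> X \<tau>' + \<epsilon>) sequentially"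
proof -
  have e: "0 < \<epsilon> / 3" using \<open>0 < \<epsilon>\<close> by simp
  obtain N0 where N0: "\<And>N. N \<ge> N0 \<Longrightarrow> eventually (\<lambda>k. reward M \<gamma> (Y k) (\<rho> k) \<le>
    (\<integral>\<omega>. (\<Sum>j\<le>N. hat N j (\<rho> k \<omega>) * \<gamma> (grid N j, Y k (grid N j) \<omega>)) \<partial>M) + \<epsilon> / 3) sequentially"
    using reward_le_grid_average[OF e] by blast
  have "eventually (\<lambda>N. (\<integral>\<omega>. (\<Sum>j\<le>N. hat N j (\<tau>' \<omega>) * \<gamma> (grid N j, X (grid N j) \<omega>)) \<partial>M)
      < reward M \<gamma> X \<tau>' + \<epsilon> / 3 \<and> N0 \<le> N) sequentially"
    using e by (intro eventually_conj eventually_ge_at_top order_tendstoD(2)[OF \<gamma>_grid_limits(3)[OF cadlag_X \<tau>'(1,2)]]) auto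
  then obtain N where N: "(\<integral>\<omega>. (\<Sum>j\<le>N. hat N j (\<tau>' \<omega>) * \<gamma> (grid N j, X (grid N j) \<omega>)) \<partial>M)
      < reward M \<gamma> X \<tau>' + \<epsilon> / 3" "N0 \<le> N" by (auto simp: eventually_sequentially)
  let ?c = "grid N" and ?h = "hat N"
  have c: "?c j \<in> {0..T}" for j by (rule clamped_grid_range[OF T_pos])
  have int: "integrable M (\<lambda>\<omega>. ?h j (\<theta> \<omega>) * \<gamma> (?c j, Z (?c j) \<omega>))"
    if "cadlag_process M T Z" "(\<lambda>\<omega>. ?h j (\<theta> \<omega>)) \<in> borel_measurable M" for j Z \<theta>
  proof (rule integrable_const_bound[of _ B])
    show "AE \<omega> in M. norm (?h j (\<theta> \<omega>) * \<gamma> (?c j, Z (?c j) \<omega>)) \<le> B"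
    proof (rule AE_I2)
      fix \<omega>
      have "\<bar>?h j (\<theta> \<omega>)\<bar> * \<bar>\<gamma> (?c j, Z (?c j) \<omega>)\<bar> \<le> 1 * B"
        using grid_hat_range[of T N j "\<theta> \<omega>"] \<gamma>_bound[OF c] by (intro mult_mono) auto
      then show "norm (?h j (\<theta> \<omega>) * \<gamma> (?c j, Z (?c j) \<omega>)) \<le> B" by (simp add: abs_mult)
    qed
    have "(\<lambda>\<omega>. \<gamma> (?c j, Z (?c j) \<omega>)) \<in> borel_measurable M"
      using that(1) c[of j] by (intro \<gamma>_process_measurable[where Z = Z and t = "?c j"]) (auto simp: cadlag_process_def)
    then show "(\<lambda>\<omega>. ?h j (\<theta> \<omega>) * \<gamma> (?c j, Z (?c j) \<omega>)) \<in> borel_measurable M"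
      using that(2) by (rule borel_measurable_times[rotated])
  qed
  have hM: "(\<lambda>\<omega>. ?h j (\<rho> k \<omega>)) \<in> borel_measurable M" "(\<lambda>\<omega>. ?h j (\<tau> \<omega>)) \<in> borel_measurable M" for j k
    using weight_measurable[OF continuous_grid_hat[OF T_pos]] by auto
  have "(\<lambda>k. \<integral>\<omega>. ?h j (\<rho> k \<omega>) * \<gamma> (?c j, Ypath k \<omega> (?c j)) \<partial>M)
      \<longlonglongrightarrow> (\<integral>\<omega>. ?h j (\<tau> \<omega>) * \<gamma> (?c j, Xpath \<omega> (?c j)) \<partial>M)" for j
  proof (rule weighted_functional_limit[OF continuous_grid_hat[OF T_pos] _ ae_continuous_\<gamma>_eval[OF c]])
    show "0 \<le> ?h j s \<and> ?h j s \<le> 1" for s using grid_hat_range by blast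
    show "\<bar>\<gamma> (?c j, y (?c j))\<bar> \<le> B" for y by (rule \<gamma>_bound[OF c])
  qed (rule reward_measurable_sample[OF c], rule cadlag_X cadlag_Y)+
  then have "(\<lambda>k. \<Sum>j\<le>N. \<integral>\<omega>. ?h j (\<rho> k \<omega>) * \<gamma> (?c j, Y k (?c j) \<omega>) \<partial>M)
      \<longlonglongrightarrow> (\<Sum>j\<le>N. \<integral>\<omega>. ?h j (\<tau> \<omega>) * \<gamma> (?c j, X (?c j) \<omega>) \<partial>M)"
    unfolding sample_path_eval[OF c] by (intro tendsto_sum)
  then have "(\<lambda>k. \<integral>\<omega>. (\<Sum>j\<le>N. ?h j (\<rho> k \<omega>) * \<gamma> (?c j, Y k (?c j) \<omega>)) \<partial>M)
      \<longlonglongrightarrow> (\<integral>\<omega>. (\<Sum>j\<le>N. ?h j (\<tau> \<omega>) * \<gamma> (?c j, X (?c j) \<omega>)) \<partial>M)"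
    using int[OF cadlag_Y hM(1)] int[OF cadlag_X hM(2)] by simp
  moreover have "(\<integral>\<omega>. (\<Sum>j\<le>N. ?h j (\<tau> \<omega>) * \<gamma> (?c j, X (?c j) \<omega>)) \<partial>M) = (\<integral>\<omega>. (\<Sum>j\<le>N. ?h j (\<tau>' \<omega>) * \<gamma> (?c j, X (?c j) \<omega>)) \<partial>M)"
  proof (rule integral_cong_AE)
    have "(\<lambda>\<omega>. ?h j (\<tau>' \<omega>)) \<in> borel_measurable M" for j
      by (rule measurable_compose[OF \<tau>'(1) borel_measurable_continuous_onI[OF continuous_grid_hat[OF T_pos]]])
    from int[OF cadlag_X this] show "(\<lambda>\<omega>. \<Sum>j\<le>N. ?h j (\<tau>' \<omega>) * \<gamma> (?c j, X (?c j) \<omega>)) \<in> borel_measurable M"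
      by (intro borel_measurable_sum) (rule borel_measurable_integrable)
    from int[OF cadlag_X hM(2)] show "(\<lambda>\<omega>. \<Sum>j\<le>N. ?h j (\<tau> \<omega>) * \<gamma> (?c j, X (?c j) \<omega>)) \<in> borel_measurable M"
      by (intro borel_measurable_sum) (rule borel_measurable_integrable)
    show "AE \<omega> in M. (\<Sum>j\<le>N. ?h j (\<tau> \<omega>) * \<gamma> (?c j, X (?c j) \<omega>)) = (\<Sum>j\<le>N. ?h j (\<tau>' \<omega>) * \<gamma> (?c j, X (?c j) \<omega>))"
      using \<tau>'(3) by eventually_elim simp
  qed
  ultimately have "eventually (\<lambda>k. (\<integral>\<omega>. (\<Sum>j\<le>N. ?h j (\<rho> k \<omega>) * \<gamma> (?c j, Y k (?c j) \<omega>)) \<partial>M)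
      < (\<integral>\<omega>. (\<Sum>j\<le>N. ?h j (\<tau>' \<omega>) * \<gamma> (?c j, X (?c j) \<omega>)) \<partial>M) + \<epsilon> / 3) sequentially"
    using e by (intro order_tendstoD(2)) auto
  with N0[OF N(2)] show ?thesis
    by eventually_elim (use N(1) in linarith)
qed

lemma bdd_above_reward: "bdd_above (reward M \<gamma> Z ` stopping_times M T F)"
proof (rule bdd_aboveI2)
  fix \<sigma> assume "\<sigma> \<in> stopping_times M T F"
  then show "reward M \<gamma> Z \<sigma> \<le> B"
    unfolding reward_def using \<gamma>_bound B_pos by (intro integral_abs_le) (auto simp: stopping_times_def)
qed

text \<open>Every competitor \<open>\<sigma>\<close> for \<open>X\<close> is matched by stopping times for \<open>Y k\<close>, which earn no more than \<open>\<rho> k\<close>, whose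
rewards are asymptotically bounded by the reward of \<open>\<tau>'\<close>.\<close>

theorem limit_of_optimal_times_is_optimal:
  assumes opt: "\<And>k. optimal_stopping_time M T (natural_filtration M (Y k)) \<gamma> (Y k) (\<rho> k)"
  shows "\<exists>\<tau>'. optimal_stopping_time M T (right_cont_filtration M T X) \<gamma> X \<tau>' \<and> (AE \<omega> in M. \<tau> \<omega> = \<tau>' \<omega>)"
proof -
  obtain \<tau>' where \<tau>': "\<tau>' \<in> stopping_times M T (right_cont_filtration M T X)" "AE \<omega> in M. \<tau> \<omega> = \<tau>' \<omega>"
    using limit_is_stopping_time by blast
  have \<tau>'M: "\<tau>' \<in> borel_measurable M"
    using right_cont_filtration_subalgebra[OF cadlag_X] \<tau>'(1)
    by (intro stopping_times_measurable[where T = T and F = "right_cont_filtration M T X"]) simp_all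
  have \<tau>'T: "\<tau>' \<omega> \<in> {0..T}" if "\<omega> \<in> space M" for \<omega> using \<tau>'(1) that by (simp add: stopping_times_def)
  have "reward M \<gamma> X \<sigma> \<le> reward M \<gamma> X \<tau>'" if \<sigma>: "\<sigma> \<in> stopping_times M T (right_cont_filtration M T X)" for \<sigma>
  proof (rule field_le_epsilon)
    fix e :: real assume "0 < e"
    then have e: "0 < e / 2" by simp
    have "eventually (\<lambda>k. reward M \<gamma> (Y k) (\<rho> k) \<le> reward M \<gamma> X \<tau>' + e / 2) sequentially"
      using \<tau>'M \<tau>'T \<tau>'(2) e by (rule reward_upper_bound)
    with value_lower_bound[OF \<sigma> e]
    have "eventually (\<lambda>k. reward M \<gamma> X \<sigma> \<le> reward M \<gamma> X \<tau>' + e) sequentially"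
    proof eventually_elim
      case (elim k)
      then obtain \<sigma>' where \<sigma>': "\<sigma>' \<in> stopping_times M T (natural_filtration M (Y k))"
        "reward M \<gamma> X \<sigma> \<le> reward M \<gamma> (Y k) \<sigma>' + e / 2" by blast
      have "reward M \<gamma> (Y k) \<sigma>' \<le> optimal_value M T (natural_filtration M (Y k)) \<gamma> (Y k)"
        unfolding optimal_value_def by (rule cSUP_upper[OF \<sigma>'(1) bdd_above_reward])
      also have "\<dots> = reward M \<gamma> (Y k) (\<rho> k)" using opt[of k] by (simp add: optimal_stopping_time_def)
      finally show ?case using \<sigma>'(2) elim(2) by linarith
    qed
    then show "reward M \<gamma> X \<sigma> \<le> reward M \<gamma> X \<tau>' + e" by (auto simp: eventually_sequentially)
  qed
  then have "optimal_value M T (right_cont_filtration M T X) \<gamma> X = reward M \<gamma> X \<tau>'"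
    unfolding optimal_value_def using \<tau>'(1) by (intro cSup_eq_maximum) auto
  then show ?thesis using \<tau>' by (auto simp: optimal_stopping_time_def)
qed

end

theorem theorem21:
  fixes M :: "'a measure" and T :: real
    and Xn :: "nat \<Rightarrow> real \<Rightarrow> 'a \<Rightarrow> real" and X :: "real \<Rightarrow> 'a \<Rightarrow> real"
    and \<gamma> :: "real \<times> real \<Rightarrow> real"
    and \<tau>n :: "nat \<Rightarrow> 'a \<Rightarrow> real" and \<tau> :: "'a \<Rightarrow> real" and r :: "nat \<Rightarrow> nat"
  assumes "prob_space M" and "0 < T"
    and "\<And>n. cadlag_process M T (Xn n)"
    and "cadlag_process M T X"
    and "quasi_left_continuous M T (right_cont_filtration M T X) X"
    and "converges_in_law M (skorokhod_topology T) (\<lambda>n. sample_path T (Xn n)) (sample_path T X)"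
    and "\<And>n. independent_increments M T (Xn n)"
    and "continuous_on ({0..T} \<times> UNIV) \<gamma>" and "bounded (\<gamma> ` ({0..T} \<times> UNIV))"
    and "\<And>n. optimal_stopping_time M T (natural_filtration M (Xn n)) \<gamma> (Xn n) (\<tau>n n)"
    and "strict_mono r"
    and "converges_in_law M (prod_topology (skorokhod_topology T) euclideanreal)
           (\<lambda>k \<omega>. (sample_path T (Xn (r k)) \<omega>, \<tau>n (r k) \<omega>)) (\<lambda>\<omega>. (sample_path T X \<omega>, \<tau> \<omega>))"
    and "\<tau> \<in> borel_measurable (right_cont_filtration M T X T)"
  shows "\<exists>\<tau>'. optimal_stopping_time M T (right_cont_filtration M T X) \<gamma> X \<tau>' \<and>
              (AE \<omega> in M. \<tau> \<omega> = \<tau>' \<omega>)"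
proof -
  obtain B where B: "\<And>z. z \<in> {0..T} \<times> UNIV \<Longrightarrow> \<bar>\<gamma> z\<bar> \<le> B"
    using assms(9) unfolding bounded_iff by auto
  have "skorokhod_law_limit M T (\<lambda>k. Xn (r k)) X (\<lambda>k. \<tau>n (r k)) \<tau>"
  proof (intro skorokhod_law_limit.intro skorokhod_law_limit_axioms.intro)
    show "AE \<omega> in M. continuous (at t within {0..T}) (\<lambda>s. X s \<omega>)" if "t \<in> {0..T}" for t
      by (rule quasi_left_continuous_no_fixed_jump[OF assms(2,4,5) that])
  qed (fact assms)+
  moreover have "bounded_reward_limit_axioms T \<gamma> (max B 1)"
  proof
    show "\<bar>\<gamma> (t, x)\<bar> \<le> max B 1" if "t \<in> {0..T}" for t x
      using B[of "(t, x)"] that by auto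
  qed (use assms(8) in auto)
  moreover have "independent_increments_limit_axioms M T (\<lambda>k. Xn (r k)) X (\<lambda>k. \<tau>n (r k)) \<tau>"
  proof
    show "\<tau>n (r k) \<in> stopping_times M T (natural_filtration M (Xn (r k)))" for k
      using assms(10)[of "r k"] by (simp add: optimal_stopping_time_def)
    show "\<tau> \<in> borel_measurable (natural_filtration M X T)"
      using assms(13) by (simp add: right_cont_filtration_ge)
    show "independent_increments M T (Xn (r k))" for k by (rule assms(7))
  qed
  ultimately have "optimal_stopping_limit M T (\<lambda>k. Xn (r k)) X (\<lambda>k. \<tau>n (r k)) \<tau> \<gamma> (max B 1)"
    by (intro optimal_stopping_limit.intro bounded_reward_limit.intro independent_increments_limit.intro)
  then interpret optimal_stopping_limit M T "\<lambda>k. Xn (r k)" X "\<lambda>k. \<tau>n (r k)" \<tau> \<gamma> "max B 1" .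
  show ?thesis by (rule limit_of_optimal_times_is_optimal) (rule assms(10))
qed

end
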